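(* Let $G$ be a countable simple graph and let $q\in(1,\infty)$. Then the following statements are equivalent. (i) $G$ is rigid in $(\mathbb R^2,\|\cdot\|_q)$. (ii) $G$ is sequentially rigid in $(\mathbb R^2,\|\cdot\|_q)$.
   Context: "Countable" means countably infinite; $\|\cdot\|_q$ is the $\ell^q$ norm on $\mathbb R^d$ (here $d=2$). A bar-joint framework $(G,p)$ in a normed space $X$ consists of a simple graph $G$ and a map (placement) $p:V(G)\to X$ with $p_v\neq p_w$ whenever $vw\in E(G)$; $P(G)$ is the set of placements in $X$. A subframework is $(H,p)$ with $H$ a subgraph and $p$ restricted to $V(H)$. An infinitesimal flex is a map $u:V(G)\to X$ with $\|(p_v+tu_v)-(p_w+tu_w)\|-\|p_v-p_w\|=o(t)$ as $t\to 0$ for each edge $vw$. A continuous rigid motion is a map $\Gamma:X\times[-1,1]\to X$, isometric in $x$, continuous in $t$, with $\Gamma(x,0)=x$; an infinitesimal rigid motion is a map $\gamma(x)=\frac{d}{dt}\Gamma(x,t)|_{t=0}$ derived from such $\Gamma$. An infinitesimal flex $u$ is trivial if $u_v=\gamma(p_v)$ for all $v$, for some infinitesimal rigid motion $\gamma$. $(G,p)$ is infinitesimally rigid if all its infinitesimal flexes are trivial. For finite $G$ and $p:V(G)\to\mathbb R^d$ the rigidity matrix $R_q(G,p)$ is the $|E(G)|\times d|V(G)|$ matrix whose row for the edge $vw$ has $(p_v-p_w)^{(q-1)}$ in the $d$ columns of $v$, $-(p_v-p_w)^{(q-1)}$ in the $d$ columns of $w$ and zeros elsewhere, where $x^{(s)}=(\mathrm{sgn}(x_1)|x_1|^s,\dots,\mathrm{sgn}(x_d)|x_d|^s)$.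 A finite $(G,p)$ is regular if $x\mapsto \operatorname{rank}R_q(G,x)$, $x\in P(G)$, attains its maximum at $p$; it is generic if $p$ is a placement of the complete graph $K_{V(G)}$ on $V(G)$ and every subframework of $(K_{V(G)},p)$ is regular. A placement of a countable graph is generic if every finite subframework is generic. A countable graph $G$ is rigid in $(\mathbb R^d,\|\cdot\|_q)$ if its generic placements are infinitesimally rigid (this does not depend on the generic placement). A countable framework $(G,p)$ is sequentially infinitesimally rigid if there are finite subgraphs $G_1\subseteq G_2\subseteq\cdots$ of $G$ with $V(G)=\bigcup_kV(G_k)$ such that each $(G_k,p)$ is infinitesimally rigid. $G$ is sequentially rigid if its generic placements are sequentially infinitesimally rigid (again independent of the generic placement). *)

theory Defs
  imports "HOL-Analysis.Analysis" "HOL-Library.Landau_Symbols" "HOL-Library.Function_Algebras"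
begin

text \<open>
  A graph is a pair of a vertex set and a set of two-element subsets of it.  A placement is a
  total function of which only the values on the vertex set matter.
\<close>

type_synonym 'v ugraph = "'v set \<times> 'v set set"

abbreviation verts :: "'v ugraph \<Rightarrow> 'v set" where "verts G \<equiv> fst G"
abbreviation edges :: "'v ugraph \<Rightarrow> 'v set set" where "edges G \<equiv> snd G"

definition simple_graph :: "'v ugraph \<Rightarrow> bool" where
  "simple_graph G \<longleftrightarrow>
     (\<forall>e\<in>edges G. \<exists>v\<in>verts G. \<exists>w\<in>verts G. v \<noteq> w \<and> e = {v, w})"

definition subgraph :: "'v ugraph \<Rightarrow> 'v ugraph \<Rightarrow> bool" where
  "subgraph H G \<longleftrightarrow>
     simple_graph H \<and> verts H \<subseteq> verts G \<and> edges H \<subseteq> edges G"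

definition finite_subgraph :: "'v ugraph \<Rightarrow> 'v ugraph \<Rightarrow> bool" where
  "finite_subgraph H G \<longleftrightarrow> subgraph H G \<and> finite (verts H)"

definition complete_ugraph :: "'v set \<Rightarrow> 'v ugraph" where
  "complete_ugraph V = (V, {{v, w} | v w. v \<in> V \<and> w \<in> V \<and> v \<noteq> w})"

definition lq_norm :: "real \<Rightarrow> real ^ 'd \<Rightarrow> real" where
  "lq_norm q x = (\<Sum>i\<in>UNIV. \<bar>x $ i\<bar> powr q) powr (1 / q)"

definition placement :: "'v ugraph \<Rightarrow> ('v \<Rightarrow> real ^ 'd) \<Rightarrow> bool" where
  "placement G p \<longleftrightarrow> (\<forall>v w. {v, w} \<in> edges G \<longrightarrow> p v \<noteq> p w)"

definition infinitesimal_flex ::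
    "real \<Rightarrow> 'v ugraph \<Rightarrow> ('v \<Rightarrow> real ^ 'd) \<Rightarrow> ('v \<Rightarrow> real ^ 'd) \<Rightarrow> bool" where
  "infinitesimal_flex q G p u \<longleftrightarrow>
     (\<forall>v w. {v, w} \<in> edges G \<longrightarrow>
        (\<lambda>t. lq_norm q ((p v + t *\<^sub>R u v) - (p w + t *\<^sub>R u w)) - lq_norm q (p v - p w))
          \<in> o[at 0](\<lambda>t. t))"

text \<open>
  Continuity and differentiability in \<open>t\<close> refer to the standard topology of the coordinate
  space, which is the topology of every \<open>\<ell>\<^sup>q\<close> norm; isometry refers to the \<open>\<ell>\<^sup>q\<close> norm.
\<close>

definition continuous_rigid_motion ::
    "real \<Rightarrow> (real ^ 'd \<Rightarrow> real \<Rightarrow> real ^ 'd) \<Rightarrow> bool" where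
  "continuous_rigid_motion q \<Gamma> \<longleftrightarrow>
     (\<forall>t\<in>{-1..1}. \<forall>x y. lq_norm q (\<Gamma> x t - \<Gamma> y t) = lq_norm q (x - y)) \<and>
     (\<forall>x. continuous_on {-1..1} (\<Gamma> x)) \<and>
     (\<forall>x. \<Gamma> x 0 = x)"

definition infinitesimal_rigid_motion ::
    "real \<Rightarrow> (real ^ 'd \<Rightarrow> real ^ 'd) \<Rightarrow> bool" where
  "infinitesimal_rigid_motion q \<gamma> \<longleftrightarrow>
     (\<exists>\<Gamma>. continuous_rigid_motion q \<Gamma> \<and>
          (\<forall>x. (\<Gamma> x has_vector_derivative \<gamma> x) (at 0)))"

definition trivial_flex ::
    "real \<Rightarrow> 'v ugraph \<Rightarrow> ('v \<Rightarrow> real ^ 'd) \<Rightarrow> ('v \<Rightarrow> real ^ 'd) \<Rightarrow> bool" where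
  "trivial_flex q G p u \<longleftrightarrow>
     (\<exists>\<gamma>. infinitesimal_rigid_motion q \<gamma> \<and> (\<forall>v\<in>verts G. u v = \<gamma> (p v)))"

definition infinitesimally_rigid :: "real \<Rightarrow> 'v ugraph \<Rightarrow> ('v \<Rightarrow> real ^ 'd) \<Rightarrow> bool" where
  "infinitesimally_rigid q G p \<longleftrightarrow>
     (\<forall>u. infinitesimal_flex q G p u \<longrightarrow> trivial_flex q G p u)"

definition signed_power :: "real \<Rightarrow> real ^ 'd \<Rightarrow> real ^ 'd" where
  "signed_power s x = (\<chi> i. sgn (x $ i) * \<bar>x $ i\<bar> powr s)"

text \<open>
  Rows of the rigidity matrix are indexed by edges and columns by pairs of a vertex and a
  coordinate.  As \<open>signed_power\<close> is odd, the entries of a row do not depend on an orientation of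
  the edge: in the columns of each endpoint stands the power of its position minus the position
  of the other endpoint; see \<open>rigidity_matrix_edge\<close>.
\<close>

definition rigidity_matrix ::
    "real \<Rightarrow> ('v \<Rightarrow> real ^ 'd) \<Rightarrow> 'v set \<Rightarrow> 'v \<times> 'd \<Rightarrow> real" where
  "rigidity_matrix q p e = (\<lambda>(x, i).
     if x \<in> e then signed_power (q - 1) (p x - p (THE y. e = {x, y})) $ i else 0)"

lemma rigidity_matrix_edge:
  assumes "v \<noteq> w"
  shows "rigidity_matrix q p {v, w} (x, i) =
           (if x = v then signed_power (q - 1) (p v - p w) $ i
            else if x = w then - signed_power (q - 1) (p v - p w) $ i
            else 0)"
proof -
  have "(THE y. {v, w} = {v, y}) = w" "(THE y. {v, w} = {w, y}) = v"
    using assms by (auto simp: doubleton_eq_iff)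
  moreover have "sgn (p w $ i - p v $ i) = - sgn (p v $ i - p w $ i)"
    by (simp add: sgn_if)
  ultimately show ?thesis
    by (auto simp: rigidity_matrix_def signed_power_def abs_minus_commute)
qed

lemma vector_space_fun: "vector_space (\<lambda>(c::real) (f::'j \<Rightarrow> real) j. c * f j)"
  by unfold_locales (auto simp: fun_eq_iff algebra_simps)

definition row_rank :: "'i set \<Rightarrow> ('i \<Rightarrow> 'j \<Rightarrow> real) \<Rightarrow> nat" where
  "row_rank I M = vector_space.dim (\<lambda>c f j. c * f j) (M ` I)"

definition rigidity_rank :: "real \<Rightarrow> 'v ugraph \<Rightarrow> ('v \<Rightarrow> real ^ 'd) \<Rightarrow> nat" where
  "rigidity_rank q G p = row_rank (edges G) (rigidity_matrix q p)"

definition regular_placement :: "real \<Rightarrow> 'v ugraph \<Rightarrow> ('v \<Rightarrow> real ^ 'd) \<Rightarrow> bool" where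
  "regular_placement q G p \<longleftrightarrow>
     placement G p \<and>
     (\<forall>x :: 'v \<Rightarrow> real ^ 'd. placement G x \<longrightarrow> rigidity_rank q G x \<le> rigidity_rank q G p)"

definition generic_finite :: "real \<Rightarrow> 'v ugraph \<Rightarrow> ('v \<Rightarrow> real ^ 'd) \<Rightarrow> bool" where
  "generic_finite q G p \<longleftrightarrow>
     placement (complete_ugraph (verts G)) p \<and>
     (\<forall>H. subgraph H (complete_ugraph (verts G)) \<longrightarrow> regular_placement q H p)"

definition generic_placement :: "real \<Rightarrow> 'v ugraph \<Rightarrow> ('v \<Rightarrow> real ^ 'd) \<Rightarrow> bool" where
  "generic_placement q G p \<longleftrightarrow>
     placement G p \<and> (\<forall>H. finite_subgraph H G \<longrightarrow> generic_finite q H p)"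

definition sequentially_infinitesimally_rigid ::
    "real \<Rightarrow> 'v ugraph \<Rightarrow> ('v \<Rightarrow> real ^ 'd) \<Rightarrow> bool" where
  "sequentially_infinitesimally_rigid q G p \<longleftrightarrow>
     (\<exists>H :: nat \<Rightarrow> 'v ugraph.
        (\<forall>k. finite_subgraph (H k) G) \<and>
        (\<forall>k. subgraph (H k) (H (Suc k))) \<and>
        verts G = (\<Union>k. verts (H k)) \<and>
        (\<forall>k. infinitesimally_rigid q (H k) p))"

definition rigid_graph :: "'d::finite itself \<Rightarrow> real \<Rightarrow> 'v ugraph \<Rightarrow> bool" where
  "rigid_graph d q G \<longleftrightarrow>
     (\<forall>p :: 'v \<Rightarrow> real ^ 'd. generic_placement q G p \<longrightarrow> infinitesimally_rigid q G p)"

definition sequentially_rigid_graph :: "'d::finite itself \<Rightarrow> real \<Rightarrow> 'v ugraph \<Rightarrow> bool" where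
  "sequentially_rigid_graph d q G \<longleftrightarrow>
     (\<forall>p :: 'v \<Rightarrow> real ^ 'd. generic_placement q G p \<longrightarrow>
        sequentially_infinitesimally_rigid q G p)"

end

theory Submission
  imports Defs
begin

text \<open>
  The equivalence holds for each generic placement \<open>p\<close> separately
  (\<open>infinitesimally_rigid_iff_sequentially\<close>).

  \<^bold>\<open>Flexes and rigid motions.\<close>  A flex is a solution \<open>u\<close> of the linear equations
  \<open>f (p v - p w) \<bullet> (u v - u w) = 0\<close>, one for each edge, where \<open>f\<close> is the signed power with exponent
  \<open>q - 1\<close>.  The velocity field of a rigid motion solves these equations for all pairs of points of the
  plane, and this forces it to be \<open>x \<mapsto> a + c *\<^sub>R rot x\<close>, with \<open>c = 0\<close> unless \<open>q = 2\<close>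
  (\<open>infinitesimal_rigid_motion_iff\<close>).  So the trivial flexes form a space of dimension \<open>k = 3\<close> for
  \<open>q = 2\<close> and \<open>k = 2\<close> otherwise, and such a flex is determined by its values at two points.  Therefore
  the rigid motions that belong to the members of a rigid chain agree from some member on, which
  proves that sequential rigidity implies rigidity.

  \<^bold>\<open>From rigidity to a chain.\<close>  Let \<open>G\<close> be rigid and \<open>S\<close> a finite set of vertices.  For \<open>a, b\<close> in \<open>S\<close>
  the row of the pair \<open>{a, b}\<close> vanishes on all flexes of \<open>G\<close>.  A row has finite support, and a linear
  functional on the finitely supported functions is the same as an arbitrary velocity assignment.
  Hence this row lies in the span of the rows of \<open>G\<close>, and so in the span of finitely many of them: linear
  duality replaces a compactness argument.  This yields a finite independent set \<open>B\<close> of edges of \<open>G\<close>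
  that spans all pairs in \<open>S\<close>.  It remains to find a finite \<open>M \<supseteq> S\<close> for which \<open>B\<close> has \<open>2 * card M - k\<close>
  edges inside \<open>M\<close>; by a dimension count the subgraph of \<open>G\<close> induced by such a tight set \<open>M\<close> is rigid.
  This step is special to the plane.  By a theorem of Laman type (\<open>sparse_imp_stress_free\<close>) a pair
  outside \<open>B\<close> that depends on \<open>B\<close> lies in a tight set, and tight sets can be glued
  (\<open>tight_union\<close>, \<open>tight_triangle\<close>, \<open>tight_cover\<close>).

  \<^bold>\<open>Sparse edge sets are independent.\<close>  Besides injectivity of \<open>p\<close>, genericity provides one principle: edges whose
  rows are independent at \<^emph>\<open>some\<close> placement are independent at \<open>p\<close>, because the rank is maximal at \<open>p\<close>.  So special
  positions decide.  The proof is by induction on the number of vertices; a sparse graph has a vertex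
  \<open>v\<close> of degree at most three.  Up to degree two, \<open>v\<close> can be removed and added again.  In degree three,
  let two neighbours \<open>x\<close>, \<open>y\<close> of \<open>v\<close> be non-adjacent.  If removing \<open>v\<close> and adding \<open>{x, y}\<close> leaves a sparse
  graph, then \<open>v\<close> is put on the midpoint of \<open>x\<close> and \<open>y\<close>; otherwise there is a tight set that contains
  \<open>x\<close> and \<open>y\<close> but not \<open>v\<close>.  For \<open>q = 2\<close> the tight sets of the three pairs merge, and adding \<open>v\<close> with its
  three edges violates sparsity.  For \<open>q \<noteq> 2\<close> there is in any case a tight proper subset, possibly the
  complete graph on \<open>v\<close> and its neighbours; a maximal one is contracted to a single vertex, and the
  independence of the contracted graph is transferred back by a placement in which the tight set is
  small.
\<close>

section \<open>Signed powers and first-order changes of the norm\<close>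

definition spow :: "real \<Rightarrow> real \<Rightarrow> real" where
  "spow s x = sgn x * \<bar>x\<bar> powr s"

lemma signed_power_nth [simp]: "signed_power s x $ i = spow s (x $ i)"
  by (simp add: signed_power_def spow_def)

lemma spow_mult: "spow s (x * y) = spow s x * spow s y"
  by (simp add: spow_def sgn_mult abs_mult powr_mult)

lemma spow_minus [simp]: "spow s (- x) = - spow s x"
  by (simp add: spow_def sgn_minus)

lemma spow_0 [simp]: "spow s 0 = 0" and spow_1 [simp]: "spow s 1 = 1"
  by (simp_all add: spow_def)

lemma spow_eq_0_iff [simp]: "spow s x = 0 \<longleftrightarrow> x = 0"
  by (simp add: spow_def sgn_zero_iff)

text \<open>The function is strictly monotone; here injectivity follows because sign and
  absolute value of the argument can be recovered.\<close>

lemma spow_inject: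
  assumes "0 < s" "spow s x = spow s y" shows "x = y"
proof -
  have "sgn x = sgn (spow s x)" for x
    by (simp add: spow_def sgn_mult)
      (metis abs_0 abs_zero mult.right_neutral mult_zero_left powr_eq_0_iff sgn_0 sgn_pos powr_gt_zero zero_less_abs_iff)
  then have sg: "sgn x = sgn y" using assms(2) by metis
  have "\<bar>spow s z\<bar> = \<bar>z\<bar> powr s" for z
    by (cases "z = 0") (simp_all add: spow_def abs_mult)
  then have "\<bar>x\<bar> powr s = \<bar>y\<bar> powr s" using assms(2) by metis
  then have "\<bar>x\<bar> = \<bar>y\<bar>" using assms(1)
    by (metis abs_ge_zero powr_less_mono2 less_irrefl linorder_neqE_linordered_idom)
  then show ?thesis using sg by (metis mult_sgn_abs)
qed

lemma continuous_spow:
  assumes "0 < s" shows "isCont (spow s) x"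
proof -
  have "spow s = (\<lambda>x. (max x 0) powr s - (max (- x) 0) powr s)"
    by (auto simp: spow_def fun_eq_iff max_def sgn_if)
  moreover have "isCont (\<lambda>x. (max x 0) powr s - (max (- x) 0) powr s) x"
    unfolding isCont_def
    by (intro tendsto_diff tendsto_powr' tendsto_max tendsto_minus tendsto_const tendsto_ident_at)
      (use assms in auto)
  ultimately show ?thesis by simp
qed

lemma signed_power_minus: "signed_power s (- x) = - signed_power s x"
  by (simp add: vec_eq_iff)

lemma signed_power_scaleR: "signed_power s (c *\<^sub>R x) = spow s c *\<^sub>R signed_power s x"
  by (simp add: vec_eq_iff spow_mult)

lemma signed_power_eq_0_iff [simp]: "signed_power s x = 0 \<longleftrightarrow> x = 0"
  by (simp add: vec_eq_iff)

text \<open>At the origin the difference quotient is the signed power itself, which tends to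
  \<open>0\<close> because \<open>q > 1\<close>; this is where smoothness of the norm across the coordinate axes comes from.\<close>

lemma DERIV_abs_powr:
  assumes "1 < q"
  shows "((\<lambda>x. \<bar>x\<bar> powr q) has_real_derivative q * spow (q - 1) x) (at x)"
proof (cases "x = 0")
  case True
  have "(\<lambda>h. spow (q - 1) h) \<midarrow>0\<rightarrow> spow (q - 1) 0"
    using continuous_spow[of "q - 1" 0] assms by (simp add: isCont_def)
  moreover have "\<bar>h\<bar> powr q / h = spow (q - 1) h" if "h \<noteq> 0" for h
  proof -
    have "\<bar>h\<bar> powr q = \<bar>h\<bar> powr (q - 1) * \<bar>h\<bar>"
      using that by (simp add: powr_diff)
    then show ?thesis using that by (simp add: spow_def sgn_if)
  qed
  ultimately have "(\<lambda>h. \<bar>h\<bar> powr q / h) \<midarrow>0\<rightarrow> 0"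
    by (simp cong: LIM_cong)
  then show ?thesis using True assms by (simp add: DERIV_def)
next
  case False
  show ?thesis
  proof (cases "x > 0")
    case True
    have "((\<lambda>x. x powr q) has_real_derivative q * x powr (q - 1)) (at x)"
      using True by (auto intro!: derivative_eq_intros)
    moreover have "\<forall>\<^sub>F y in nhds x. \<bar>y\<bar> powr q = y powr q"
      using eventually_nhds_in_open[of "{0<..}" x] True by (auto elim: eventually_mono)
    ultimately show ?thesis
      using True by (subst DERIV_cong_ev[OF refl _ refl]) (auto simp: spow_def)
  next
    case False
    then have neg: "x < 0" using \<open>x \<noteq> 0\<close> by simp
    have "((\<lambda>x. (- x) powr q) has_real_derivative - (q * (- x) powr (q - 1))) (at x)"
      using neg by (auto intro!: derivative_eq_intros)
    moreover have "\<forall>\<^sub>F y in nhds x. \<bar>y\<bar> powr q = (- y) powr q"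
      using eventually_nhds_in_open[of "{..<0}" x] neg by (auto elim!: eventually_mono)
    ultimately show ?thesis
      using neg by (subst DERIV_cong_ev[OF refl _ refl]) (auto simp: spow_def)
  qed
qed

text \<open>The derivative is described up to a positive factor because only its kernel matters for
  first-order changes of length.\<close>

lemma lq_norm_has_derivative:
  fixes d :: "real ^ 'd"
  assumes q: "1 < q" and d: "d \<noteq> 0"
  obtains c where "c > 0"
    "(lq_norm q has_derivative (\<lambda>h. c * (signed_power (q - 1) d \<bullet> h))) (at d)"
proof -
  let ?S = "\<lambda>x :: real ^ 'd. \<Sum>i\<in>UNIV. \<bar>x $ i\<bar> powr q"
  obtain j where "d $ j \<noteq> 0" using d by (auto simp: vec_eq_iff)
  then have "0 < \<bar>d $ j\<bar> powr q" by simp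
  then have pos: "0 < ?S d"
    by (intro sum_pos2[of UNIV j]) auto
  have "((\<lambda>x :: real ^ 'd. \<bar>x $ i\<bar> powr q) has_derivative
          (\<lambda>h. h $ i * (q * spow (q - 1) (d $ i)))) (at d)" for i
    using has_derivative_compose[OF bounded_linear_imp_has_derivative[OF bounded_linear_vec_nth]
        DERIV_abs_powr[OF q, of "d $ i", unfolded has_field_derivative_def]]
    by (subst mult.commute) blast
  then have S: "(?S has_derivative (\<lambda>h. \<Sum>i\<in>UNIV. h $ i * (q * spow (q - 1) (d $ i)))) (at d)"
    by (intro has_derivative_sum) auto
  have "((\<lambda>s. s powr (1 / q)) has_real_derivative (1 / q) * ?S d powr (1 / q - 1)) (at (?S d))"
    using pos by (auto intro!: derivative_eq_intros)
  from has_derivative_compose[OF S this[unfolded has_field_derivative_def]]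
  have "(lq_norm q has_derivative (\<lambda>h. (1 / q) * ?S d powr (1 / q - 1) *
           (\<Sum>i\<in>UNIV. h $ i * (q * spow (q - 1) (d $ i))))) (at d)"
    by (simp add: lq_norm_def[abs_def])
  also have "(\<lambda>h. (1 / q) * ?S d powr (1 / q - 1) *
           (\<Sum>i\<in>UNIV. h $ i * (q * spow (q - 1) (d $ i)))) =
      (\<lambda>h. ?S d powr (1 / q - 1) * (signed_power (q - 1) d \<bullet> h))"
    using q by (simp add: inner_vec_def fun_eq_iff sum_distrib_left sum_distrib_right
        sum_divide_distrib mult_ac)
  finally show thesis using pos by (intro that[of "?S d powr (1 / q - 1)"]) auto
qed

lemma lq_norm_first_order:
  fixes d e :: "real ^ 'd"
  assumes q: "1 < q" and d: "d \<noteq> 0"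
  shows "(\<lambda>t. lq_norm q (d + t *\<^sub>R e) - lq_norm q d) \<in> o[at 0](\<lambda>t. t) \<longleftrightarrow>
           signed_power (q - 1) d \<bullet> e = 0"
proof -
  obtain c where c: "c > 0"
    and D: "(lq_norm q has_derivative (\<lambda>h. c * (signed_power (q - 1) d \<bullet> h))) (at d)"
    using lq_norm_has_derivative[OF assms] by blast
  have "((\<lambda>t. d + t *\<^sub>R e) has_derivative (\<lambda>t. t *\<^sub>R e)) (at 0)"
    by (auto intro!: derivative_eq_intros)
  from has_derivative_compose[OF this, of "lq_norm q" "\<lambda>h. c * (signed_power (q - 1) d \<bullet> h)"] D
  have "((\<lambda>t. lq_norm q (d + t *\<^sub>R e)) has_derivative
          (\<lambda>t. c * (signed_power (q - 1) d \<bullet> (t *\<^sub>R e)))) (at 0)"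
    by simp
  moreover have "(\<lambda>t. c * (signed_power (q - 1) d \<bullet> (t *\<^sub>R e))) = (*) (c * (signed_power (q - 1) d \<bullet> e))"
    by (simp add: fun_eq_iff)
  ultimately have "((\<lambda>t. lq_norm q (d + t *\<^sub>R e)) has_real_derivative
           c * (signed_power (q - 1) d \<bullet> e)) (at 0)"
    by (simp add: has_field_derivative_def)
  then have lim: "(\<lambda>t. (lq_norm q (d + t *\<^sub>R e) - lq_norm q d) / t)
      \<midarrow>0\<rightarrow> c * (signed_power (q - 1) d \<bullet> e)"
    by (simp add: DERIV_def)
  have "(\<lambda>t. lq_norm q (d + t *\<^sub>R e) - lq_norm q d) \<in> o[at 0](\<lambda>t. t) \<longleftrightarrow>
      (\<lambda>t. (lq_norm q (d + t *\<^sub>R e) - lq_norm q d) / t) \<midarrow>0\<rightarrow> 0"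
    (is "?f \<in> _ \<longleftrightarrow> _")
  proof
    assume "?f \<in> o[at 0](\<lambda>t. t)"
    then show "(\<lambda>t. ?f t / t) \<midarrow>0\<rightarrow> 0" by (rule smalloD_tendsto)
  next
    assume "(\<lambda>t. ?f t / t) \<midarrow>0\<rightarrow> 0"
    then show "?f \<in> o[at 0](\<lambda>t. t)"
      by (rule smalloI_tendsto) (simp add: eventually_at_filter)
  qed
  also have "\<dots> \<longleftrightarrow> c * (signed_power (q - 1) d \<bullet> e) = 0"
  proof
    assume "(\<lambda>t. (lq_norm q (d + t *\<^sub>R e) - lq_norm q d) / t) \<midarrow>0\<rightarrow> 0"
    from LIM_unique[OF lim this] show "c * (signed_power (q - 1) d \<bullet> e) = 0" .
  next
    assume "c * (signed_power (q - 1) d \<bullet> e) = 0"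
    then show "(\<lambda>t. (lq_norm q (d + t *\<^sub>R e) - lq_norm q d) / t) \<midarrow>0\<rightarrow> 0"
      using lim by (simp only:)
  qed
  finally show ?thesis using c by simp
qed

lemma infinitesimal_flex_iff:
  assumes "1 < q" and "placement G p"
  shows "infinitesimal_flex q G p u \<longleftrightarrow>
    (\<forall>v w. {v, w} \<in> edges G \<longrightarrow> signed_power (q - 1) (p v - p w) \<bullet> (u v - u w) = 0)"
proof -
  have eq: "(p v + t *\<^sub>R u v) - (p w + t *\<^sub>R u w) = (p v - p w) + t *\<^sub>R (u v - u w)" for v w t
    by (simp add: algebra_simps)
  show ?thesis
    unfolding infinitesimal_flex_def eq
  proof (intro all_cong1 imp_cong refl)
    fix v w assume "{v, w} \<in> edges G"
    then have "p v - p w \<noteq> 0" using assms(2) by (simp add: placement_def)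
    then show "(\<lambda>t. lq_norm q (p v - p w + t *\<^sub>R (u v - u w)) - lq_norm q (p v - p w)) \<in> o[at 0](\<lambda>t. t)
        \<longleftrightarrow> signed_power (q - 1) (p v - p w) \<bullet> (u v - u w) = 0"
      by (rule lq_norm_first_order[OF assms(1)])
  qed
qed

lemma infinitesimal_rigid_motion_orthogonal:
  assumes q: "1 < q" and g: "infinitesimal_rigid_motion q \<gamma>"
  shows "signed_power (q - 1) (x - y) \<bullet> (\<gamma> x - \<gamma> y) = 0"
proof (cases "x = y")
  case False
  then have d: "x - y \<noteq> 0" by simp
  obtain \<Gamma> where \<Gamma>: "continuous_rigid_motion q \<Gamma>"
    and der: "\<And>x. (\<Gamma> x has_vector_derivative \<gamma> x) (at 0)"
    using g by (auto simp: infinitesimal_rigid_motion_def)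
  obtain c where c: "c > 0"
    and D: "(lq_norm q has_derivative (\<lambda>h. c * (signed_power (q - 1) (x - y) \<bullet> h))) (at (x - y))"
    using lq_norm_has_derivative[OF q d] by blast
  have 0: "\<Gamma> x 0 - \<Gamma> y 0 = x - y"
    using \<Gamma> by (simp add: continuous_rigid_motion_def)
  have "((\<lambda>t. \<Gamma> x t - \<Gamma> y t) has_derivative (\<lambda>t. t *\<^sub>R (\<gamma> x - \<gamma> y))) (at 0)"
    using has_vector_derivative_diff[OF der der] by (simp add: has_vector_derivative_def)
  from has_derivative_compose[OF this, of "lq_norm q"
      "\<lambda>h. c * (signed_power (q - 1) (x - y) \<bullet> h)"] D
  have "((\<lambda>t. lq_norm q (\<Gamma> x t - \<Gamma> y t)) has_derivative
          (\<lambda>t. c * (signed_power (q - 1) (x - y) \<bullet> (t *\<^sub>R (\<gamma> x - \<gamma> y))))) (at 0)"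
    by (simp add: 0)
  moreover have "(\<lambda>t. c * (signed_power (q - 1) (x - y) \<bullet> (t *\<^sub>R (\<gamma> x - \<gamma> y)))) =
      (*) (c * (signed_power (q - 1) (x - y) \<bullet> (\<gamma> x - \<gamma> y)))"
    by (simp add: fun_eq_iff)
  ultimately have "((\<lambda>t. lq_norm q (\<Gamma> x t - \<Gamma> y t)) has_real_derivative
           c * (signed_power (q - 1) (x - y) \<bullet> (\<gamma> x - \<gamma> y))) (at 0)"
    by (simp add: has_field_derivative_def)
  moreover have "\<forall>\<^sub>F t in nhds 0. lq_norm q (\<Gamma> x t - \<Gamma> y t) = lq_norm q (x - y)"
    using eventually_nhds_in_open[of "{-1<..<1}" "0::real"] \<Gamma>
    by (auto simp: continuous_rigid_motion_def elim!: eventually_mono)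
  ultimately have "((\<lambda>t::real. lq_norm q (x - y)) has_real_derivative
           c * (signed_power (q - 1) (x - y) \<bullet> (\<gamma> x - \<gamma> y))) (at 0)"
    by (subst (asm) DERIV_cong_ev[OF refl _ refl]) auto
  then have "c * (signed_power (q - 1) (x - y) \<bullet> (\<gamma> x - \<gamma> y)) = 0"
    by (rule DERIV_unique[OF _ DERIV_const])
  then show ?thesis using c by simp
qed simp

section \<open>Infinitesimal rigid motions of the plane\<close>

definition rot :: "real ^ 2 \<Rightarrow> real ^ 2" where
  "rot x = vector [- (x $ 2), x $ 1]"

lemma rot_nth [simp]: "rot x $ 1 = - (x $ 2)" "rot x $ 2 = x $ 1"
  by (simp_all add: rot_def)

lemma rot_diff: "rot (x - y) = rot x - rot y"
  by (simp add: vec_eq_iff forall_2)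

lemma rot_eq_0_iff [simp]: "rot x = 0 \<longleftrightarrow> x = 0"
  by (auto simp: vec_eq_iff forall_2)

definition det2 :: "real ^ 2 \<Rightarrow> real ^ 2 \<Rightarrow> real" where
  "det2 x y = x $ 1 * y $ 2 - x $ 2 * y $ 1"

text \<open>Signed powers are multiplicative and injective, so taking them coordinatewise
  preserves and reflects linear dependence of two vectors in the plane.\<close>

lemma det2_signed_power_eq_0_iff:
  assumes "0 < s"
  shows "det2 (signed_power s x) (signed_power s y) = 0 \<longleftrightarrow> det2 x y = 0"
  using spow_inject[OF assms] by (auto simp: det2_def spow_mult[symmetric])

lemma orthogonal_two_directions:
  assumes "det2 a b \<noteq> 0" "a \<bullet> x = 0" "b \<bullet> x = 0"
  shows "x = 0"
proof -
  have "det2 a b * x $ 1 = b $ 2 * (a \<bullet> x) - a $ 2 * (b \<bullet> x)"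
    "det2 a b * x $ 2 = a $ 1 * (b \<bullet> x) - b $ 1 * (a \<bullet> x)"
    by (simp_all add: det2_def inner_vec_def sum_2 algebra_simps)
  then show ?thesis using assms by (simp add: vec_eq_iff forall_2)
qed

lemma orthogonal_imp_rot:
  assumes "d \<noteq> 0" "d \<bullet> x = 0"
  obtains c where "x = c *\<^sub>R rot d"
proof
  let ?c = "(x \<bullet> rot d) / (d \<bullet> d)"
  have "(d \<bullet> d) * x $ 1 = (d \<bullet> x) * d $ 1 + (x \<bullet> rot d) * rot d $ 1"
    "(d \<bullet> d) * x $ 2 = (d \<bullet> x) * d $ 2 + (x \<bullet> rot d) * rot d $ 2"
    by (simp_all add: inner_vec_def sum_2 algebra_simps)
  then show "x = ?c *\<^sub>R rot d"
    using assms by (simp add: vec_eq_iff forall_2 field_simps)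
qed

lemma signed_power_1 [simp]: "signed_power 1 x = x"
  by (simp add: vec_eq_iff spow_def mult_sgn_abs)

lemma signed_power_orthogonal_rot:
  assumes "q \<noteq> 2 \<longrightarrow> c = 0"
  shows "signed_power (q - 1) x \<bullet> (c *\<^sub>R rot x) = 0"
proof (cases "q = 2")
  case True
  then have "signed_power (q - 1) x = x" by simp
  then show ?thesis by (simp add: inner_vec_def sum_2)
qed (use assms in simp)

text \<open>The orthogonality relations among the four points \<open>(0, 0)\<close>, \<open>(1, 0)\<close>, \<open>(1, 1)\<close> and
  \<open>(2, 1)\<close> are overdetermined: they give \<open>c * (2 - 2 powr (q - 1)) = 0\<close> for the rotational part \<open>c\<close>, so
  \<open>c = 0\<close> unless \<open>q = 2\<close>.  The value at any other point is then forced by two independent relations.\<close>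

lemma orthogonal_field_form:
  fixes \<gamma> :: "real ^ 2 \<Rightarrow> real ^ 2"
  assumes q: "1 < q"
    and orth: "\<And>x y. signed_power (q - 1) (x - y) \<bullet> (\<gamma> x - \<gamma> y) = 0"
  shows "\<exists>a c. (q \<noteq> 2 \<longrightarrow> c = 0) \<and> (\<forall>x. \<gamma> x = a + c *\<^sub>R rot x)"
proof -
  let ?f = "signed_power (q - 1) :: real ^ 2 \<Rightarrow> real ^ 2"
  define \<delta> where "\<delta> x = \<gamma> x - \<gamma> 0" for x
  have d0: "?f x \<bullet> \<delta> x = 0" and dd: "?f (x - y) \<bullet> (\<delta> x - \<delta> y) = 0" for x y
    using orth[of x 0] orth[of x y] by (simp_all add: \<delta>_def)
  define c where "c = \<delta> (vector [1, 0]) $ 2"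
  have e1: "\<delta> (vector [1, 0]) $ 1 = 0"
    using d0[of "vector [1, 0]"] by (simp add: inner_vec_def sum_2)
  have s2: "\<delta> (vector [1, 1]) $ 2 = c"
    using dd[of "vector [1, 1]" "vector [1, 0]"] by (simp add: inner_vec_def sum_2 c_def)
  have s1: "\<delta> (vector [1, 1]) $ 1 = - c"
    using d0[of "vector [1, 1]"] s2 by (simp add: inner_vec_def sum_2)
  have t1: "\<delta> (vector [2, 1]) $ 1 = - c"
    using dd[of "vector [2, 1]" "vector [1, 1]"] s1 by (simp add: inner_vec_def sum_2)
  have t2: "\<delta> (vector [2, 1]) $ 2 = 2 * c"
    using dd[of "vector [2, 1]" "vector [1, 0]"] e1 t1 by (simp add: inner_vec_def sum_2 c_def)
  have "spow (q - 1) 2 * (- c) + 2 * c = 0"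
    using d0[of "vector [2, 1]"] t1 t2 by (simp add: inner_vec_def sum_2)
  then have "c * (2 - 2 powr (q - 1)) = 0"
    by (simp add: spow_def algebra_simps)
  moreover have "(2::real) powr (q - 1) \<noteq> 2" if "q \<noteq> 2"
    using that powr_inj[of 2 "q - 1" 1] by simp
  ultimately have c0: "q \<noteq> 2 \<longrightarrow> c = 0"
    by auto
  \<comment> \<open>once the form is known at \<open>z\<close>, the relations of \<open>x\<close> with \<open>0\<close> and \<open>z\<close> determine the value at \<open>x\<close>\<close>
  have key: "\<delta> x = c *\<^sub>R rot x" if z: "\<delta> z = c *\<^sub>R rot z" and det: "det2 x (x - z) \<noteq> 0" for x z
  proof -
    let ?y = "\<delta> x - c *\<^sub>R rot x"
    have "?y = (\<delta> x - \<delta> z) - c *\<^sub>R rot (x - z)"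
      using z by (simp add: rot_diff algebra_simps)
    then have 1: "?f (x - z) \<bullet> ?y = 0"
      using dd signed_power_orthogonal_rot[OF c0, of "x - z"] by (simp only: inner_diff_right)
    have 2: "?f x \<bullet> ?y = 0"
      using d0[of x] signed_power_orthogonal_rot[OF c0, of x] by (simp only: inner_diff_right)
    have "det2 (?f x) (?f (x - z)) \<noteq> 0"
      using det2_signed_power_eq_0_iff[of "q - 1"] q det by simp
    then show ?thesis using orthogonal_two_directions[OF _ 2 1] by simp
  qed
  have "\<delta> (vector [1, 0]) = c *\<^sub>R rot (vector [1, 0])"
    using e1 by (simp add: vec_eq_iff forall_2 c_def)
  then have off: "\<delta> x = c *\<^sub>R rot x" if "x $ 2 \<noteq> 0" for x
    using key that by (simp add: det2_def algebra_simps)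
  \<comment> \<open>a point of the first axis is reached from \<open>(1, 1)\<close>\<close>
  have all: "\<delta> x = c *\<^sub>R rot x" for x
  proof (cases "x = 0 \<or> x $ 2 \<noteq> 0")
    case False
    then have "x $ 1 \<noteq> 0" by (auto simp: vec_eq_iff forall_2)
    then show ?thesis
      using False key[OF off, of "vector [1, 1]" x] by (simp add: det2_def algebra_simps)
  next
    case True
    then show ?thesis using off by (auto simp: \<delta>_def)
  qed
  have "\<gamma> x = \<gamma> 0 + c *\<^sub>R rot x" for x
    using all[of x] by (simp add: \<delta>_def algebra_simps)
  then show ?thesis using c0 by blast
qed

lemma rotation_rigid_motion:
  "infinitesimal_rigid_motion 2 (\<lambda>x :: real ^ 2. a + c *\<^sub>R rot x)"
proof -
  define \<Gamma> where "\<Gamma> x t = t *\<^sub>R a + cos (c * t) *\<^sub>R x + sin (c * t) *\<^sub>R rot x" for x t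
  have lq2: "lq_norm 2 x = sqrt ((x $ 1)\<^sup>2 + (x $ 2)\<^sup>2)" for x :: "real ^ 2"
    by (simp add: lq_norm_def sum_2 powr_half_sqrt)
  have "lq_norm 2 (\<Gamma> x t - \<Gamma> y t) = lq_norm 2 (x - y)" for x y t
  proof -
    let ?C = "cos (c * t)" and ?S = "sin (c * t)"
    let ?d = "x - y"
    have "(\<Gamma> x t - \<Gamma> y t) = ?C *\<^sub>R ?d + ?S *\<^sub>R rot ?d"
      by (simp add: \<Gamma>_def rot_diff algebra_simps)
    moreover have "(?C * (a - b) + ?S * (e - d))\<^sup>2 + (?C * (d - e) + ?S * (a - b))\<^sup>2 = (a - b)\<^sup>2 + (d - e)\<^sup>2"
      for a b d e :: real
    proof -
      have "(?C * (a - b) + ?S * (e - d))\<^sup>2 + (?C * (d - e) + ?S * (a - b))\<^sup>2 =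
          (?S\<^sup>2 + ?C\<^sup>2) * ((a - b)\<^sup>2 + (d - e)\<^sup>2)"
        unfolding power2_eq_square by (simp only: algebra_simps)
      then show ?thesis by (simp only: sin_cos_squared_add mult_1)
    qed
    ultimately show ?thesis
      by (simp add: lq2)
  qed
  moreover have "continuous_on {-1..1} (\<Gamma> x)" for x
    unfolding \<Gamma>_def by (intro continuous_intros)
  moreover have "\<Gamma> x 0 = x" for x
    by (simp add: \<Gamma>_def)
  moreover have "(\<Gamma> x has_vector_derivative a + c *\<^sub>R rot x) (at 0)" for x
    unfolding \<Gamma>_def by (auto intro!: derivative_eq_intros)
  ultimately show ?thesis
    unfolding infinitesimal_rigid_motion_def continuous_rigid_motion_def by blast
qed

lemma translation_rigid_motion:
  "infinitesimal_rigid_motion q (\<lambda>x. a)"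
  unfolding infinitesimal_rigid_motion_def continuous_rigid_motion_def
  by (intro exI[of _ "\<lambda>x t. x + t *\<^sub>R a"])
    (auto intro!: continuous_intros derivative_eq_intros)

theorem infinitesimal_rigid_motion_iff:
  fixes \<gamma> :: "real ^ 2 \<Rightarrow> real ^ 2"
  assumes "1 < q"
  shows "infinitesimal_rigid_motion q \<gamma> \<longleftrightarrow>
    (\<exists>a c. (q \<noteq> 2 \<longrightarrow> c = 0) \<and> \<gamma> = (\<lambda>x. a + c *\<^sub>R rot x))"
proof
  assume "infinitesimal_rigid_motion q \<gamma>"
  from orthogonal_field_form[OF assms infinitesimal_rigid_motion_orthogonal[OF assms this]]
  show "\<exists>a c. (q \<noteq> 2 \<longrightarrow> c = 0) \<and> \<gamma> = (\<lambda>x. a + c *\<^sub>R rot x)"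
    by (simp add: fun_eq_iff)
next
  assume "\<exists>a c. (q \<noteq> 2 \<longrightarrow> c = 0) \<and> \<gamma> = (\<lambda>x. a + c *\<^sub>R rot x)"
  then show "infinitesimal_rigid_motion q \<gamma>"
    using rotation_rigid_motion translation_rigid_motion[of q] by (cases "q = 2") auto
qed

section \<open>Rows of the rigidity matrix and stresses\<close>

definition pairs :: "'v set \<Rightarrow> 'v set set" where
  "pairs V = {{v, w} | v w. v \<in> V \<and> w \<in> V \<and> v \<noteq> w}"

definition nbrs :: "'v set set \<Rightarrow> 'v \<Rightarrow> 'v set" where
  "nbrs E v = {w. {v, w} \<in> E}"

text \<open>An equilibrium stress.  Its equations say that the rows of the edges, weighted with
  \<open>\<omega>\<close>, add up to \<open>0\<close>, collected at each vertex; see \<open>stress_iff_row_relation\<close>.  In this form special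
  positions can be evaluated vertex by vertex.\<close>

definition stress ::
    "real \<Rightarrow> ('v \<Rightarrow> real ^ 'd) \<Rightarrow> 'v set set \<Rightarrow> ('v set \<Rightarrow> real) \<Rightarrow> bool" where
  "stress q p E \<omega> \<longleftrightarrow>
     (\<forall>v. (\<Sum>w\<in>nbrs E v. \<omega> {v, w} *\<^sub>R signed_power (q - 1) (p v - p w)) = 0)"

text \<open>Linear independence of the rows as a family, so it includes that distinct edges have
  distinct rows; see \<open>stress_free_iff_independent\<close>.\<close>

definition stress_free :: "real \<Rightarrow> ('v \<Rightarrow> real ^ 'd) \<Rightarrow> 'v set set \<Rightarrow> bool" where
  "stress_free q p E \<longleftrightarrow> (\<forall>\<omega>. stress q p E \<omega> \<longrightarrow> (\<forall>e\<in>E. \<omega> e = 0))"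

lemma pairs_mono: "V \<subseteq> W \<Longrightarrow> pairs V \<subseteq> pairs W"
  by (auto simp: pairs_def)

lemma doubleton_in_pairs [simp]: "{v, w} \<in> pairs V \<longleftrightarrow> v \<in> V \<and> w \<in> V \<and> v \<noteq> w"
  by (auto simp: pairs_def doubleton_eq_iff)

lemma pairsE:
  assumes "e \<in> pairs V"
  obtains v w where "e = {v, w}" "v \<in> V" "w \<in> V" "v \<noteq> w"
  using assms by (auto simp: pairs_def)

lemma finite_pairs: "finite V \<Longrightarrow> finite (pairs V)"
  by (rule finite_subset[of _ "Pow V"]) (auto simp: pairs_def)

lemma pairs_imp_subset: "e \<in> pairs V \<Longrightarrow> e \<subseteq> V"
  by (auto simp: pairs_def)

lemma mem_pairs_iff: "e \<in> pairs W \<longleftrightarrow> e \<in> pairs UNIV \<and> e \<subseteq> W"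
  by (auto simp: pairs_def)

lemma inj_on_doubleton: "inj_on (\<lambda>w. {v, w}) A"
  by (auto simp: inj_on_def doubleton_eq_iff)

lemma finite_nbrs: "finite E \<Longrightarrow> finite (nbrs E v)"
  by (rule finite_imageD[OF finite_subset inj_on_doubleton, of v _ E]) (auto simp: nbrs_def)

lemma nbrs_irrefl: "E \<subseteq> pairs V \<Longrightarrow> w \<in> nbrs E v \<Longrightarrow> w \<noteq> v \<and> v \<in> V \<and> w \<in> V"
  using subsetD[of E "pairs V" "{v, w}"] by (auto simp: nbrs_def)

lemma incident_edgeE:
  assumes "E \<subseteq> pairs UNIV" "e \<in> E" "v \<in> e"
  obtains w where "e = {v, w}" "w \<in> nbrs E v"
proof -
  have "e \<in> pairs UNIV" using assms by blast
  then obtain a b where e: "e = {a, b}" by (rule pairsE)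
  show thesis
  proof (cases "v = a")
    case True
    then show thesis using that[of b] e assms(2) by (simp add: nbrs_def)
  next
    case False
    then have "v = b" using e assms(3) by simp
    then show thesis using that[of a] e assms(2) by (simp add: nbrs_def insert_commute)
  qed
qed

lemma sum_incident_edges:
  assumes "finite E" and "E \<subseteq> pairs UNIV"
  shows "(\<Sum>e | e \<in> E \<and> v \<in> e. h e) = (\<Sum>w\<in>nbrs E v. h {v, w})"
proof -
  have "e \<in> (\<lambda>w. {v, w}) ` nbrs E v" if "e \<in> E" "v \<in> e" for e
    using incident_edgeE[OF assms(2) that] by blast
  then have "{e. e \<in> E \<and> v \<in> e} = (\<lambda>w. {v, w}) ` nbrs E v"
    by (auto simp: nbrs_def)
  then show ?thesis
    by (simp add: sum.reindex[OF inj_on_doubleton])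
qed

lemma sum_rigidity_rows:
  fixes p :: "'v \<Rightarrow> real ^ 'd"
  assumes "finite E" and "E \<subseteq> pairs UNIV"
  shows "(\<Sum>e\<in>E. \<omega> e * rigidity_matrix q p e (v, i)) =
    (\<Sum>w\<in>nbrs E v. \<omega> {v, w} *\<^sub>R signed_power (q - 1) (p v - p w)) $ i"
proof -
  have "(\<Sum>e\<in>E. \<omega> e * rigidity_matrix q p e (v, i)) =
      (\<Sum>e | e \<in> E \<and> v \<in> e. \<omega> e * rigidity_matrix q p e (v, i))"
    using assms(1) by (intro sum.mono_neutral_right) (auto simp: rigidity_matrix_def)
  also have "\<dots> = (\<Sum>w\<in>nbrs E v. \<omega> {v, w} * rigidity_matrix q p {v, w} (v, i))"
    by (rule sum_incident_edges[OF assms])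
  also have "\<dots> = (\<Sum>w\<in>nbrs E v. \<omega> {v, w} * signed_power (q - 1) (p v - p w) $ i)"
  proof (intro sum.cong refl)
    fix w assume "w \<in> nbrs E v"
    then have "v \<noteq> w" using nbrs_irrefl[OF assms(2)] by auto
    then show "\<omega> {v, w} * rigidity_matrix q p {v, w} (v, i) =
        \<omega> {v, w} * signed_power (q - 1) (p v - p w) $ i"
      by (simp add: rigidity_matrix_edge)
  qed
  finally show ?thesis by simp
qed

text \<open>The vector space of all functions into the reals, with its scalar multiplication
  as a constant so that the general theory of vector spaces can be instantiated.\<close>

definition fscale :: "real \<Rightarrow> ('j \<Rightarrow> real) \<Rightarrow> 'j \<Rightarrow> real" where
  "fscale c f = (\<lambda>j. c * f j)"

lemma fscale_apply [simp]: "fscale c f j = c * f j"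
  by (simp add: fscale_def)

interpretation fs: vector_space fscale
  by unfold_locales (auto simp: fun_eq_iff algebra_simps)

interpretation fs_real: vector_space_pair fscale "(*) :: real \<Rightarrow> real \<Rightarrow> real"
  by unfold_locales (auto simp: algebra_simps)

abbreviation functional :: "(('j \<Rightarrow> real) \<Rightarrow> real) \<Rightarrow> bool" where
  "functional \<equiv> Vector_Spaces.linear fscale (*)"

lemma row_rank_eq_dim: "row_rank I M = fs.dim (M ` I)"
  by (simp add: row_rank_def fscale_def[abs_def])

lemma sum_fun_apply: "(\<Sum>a\<in>A. f a) j = (\<Sum>a\<in>A. f a j)" for f :: "'a \<Rightarrow> 'j \<Rightarrow> real"
  by (induction A rule: infinite_finite_induct) auto

lemma stress_iff_row_relation:
  fixes p :: "'v \<Rightarrow> real ^ 'd"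
  assumes "finite E" and "E \<subseteq> pairs UNIV"
  shows "stress q p E \<omega> \<longleftrightarrow> (\<Sum>e\<in>E. fscale (\<omega> e) (rigidity_matrix q p e)) = 0"
proof -
  have "(\<Sum>e\<in>E. fscale (\<omega> e) (rigidity_matrix q p e)) = 0 \<longleftrightarrow>
      (\<forall>v i. (\<Sum>e\<in>E. \<omega> e * rigidity_matrix q p e (v, i)) = 0)"
    unfolding fun_eq_iff sum_fun_apply split_paired_All zero_fun_apply fscale_apply ..
  also have "\<dots> \<longleftrightarrow> stress q p E \<omega>"
    unfolding sum_rigidity_rows[OF assms] stress_def by (simp only: vec_eq_iff zero_index)
  finally show ?thesis by simp
qed

lemma stress_free_iff_independent:
  fixes p :: "'v \<Rightarrow> real ^ 'd"
  assumes "finite E" and "E \<subseteq> pairs UNIV"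
  shows "stress_free q p E \<longleftrightarrow>
    inj_on (rigidity_matrix q p) E \<and> fs.independent (rigidity_matrix q p ` E)"
proof
  assume sf: "stress_free q p E"
  have inj: "inj_on (rigidity_matrix q p) E"
  proof (rule inj_onI, rule ccontr)
    fix e e' assume e: "e \<in> E" "e' \<in> E" "rigidity_matrix q p e = rigidity_matrix q p e'" "e \<noteq> e'"
    define \<omega> where "\<omega> d = (if d = e then 1 else if d = e' then - 1 else 0 :: real)" for d
    have "(\<Sum>d\<in>E. \<omega> d * rigidity_matrix q p d j) = 0" for j
    proof -
      have "(\<Sum>d\<in>E. \<omega> d * rigidity_matrix q p d j) = (\<Sum>d\<in>{e, e'}. \<omega> d * rigidity_matrix q p d j)"
        using e assms(1) by (intro sum.mono_neutral_right) (auto simp: \<omega>_def)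
      then show ?thesis using e by (simp add: \<omega>_def)
    qed
    then have "stress q p E \<omega>"
      by (simp add: stress_iff_row_relation[OF assms] fun_eq_iff sum_fun_apply)
    then have "\<omega> e = 0" using sf e(1) by (simp add: stress_free_def)
    then show False by (simp add: \<omega>_def)
  qed
  moreover have "fs.independent (rigidity_matrix q p ` E)"
  proof
    assume "fs.dependent (rigidity_matrix q p ` E)"
    then obtain u where u: "\<exists>e\<in>E. u (rigidity_matrix q p e) \<noteq> 0"
      "(\<Sum>x\<in>rigidity_matrix q p ` E. fscale (u x) x) = 0"
      using assms(1) by (auto simp: fs.dependent_finite)
    then have "stress q p E (\<lambda>e. u (rigidity_matrix q p e))"
      by (simp add: stress_iff_row_relation[OF assms] sum.reindex[OF inj])
    then show False using sf u(1) by (auto simp: stress_free_def)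
  qed
  ultimately show "inj_on (rigidity_matrix q p) E \<and> fs.independent (rigidity_matrix q p ` E)" ..
next
  assume R: "inj_on (rigidity_matrix q p) E \<and> fs.independent (rigidity_matrix q p ` E)"
  show "stress_free q p E"
    unfolding stress_free_def
  proof (intro allI impI ballI, rule ccontr)
    fix \<omega> e assume \<omega>: "stress q p E \<omega>" "e \<in> E" "\<omega> e \<noteq> 0"
    let ?u = "\<lambda>x. \<omega> (the_inv_into E (rigidity_matrix q p) x)"
    have "(\<Sum>x\<in>rigidity_matrix q p ` E. fscale (?u x) x) =
        (\<Sum>e\<in>E. fscale (\<omega> e) (rigidity_matrix q p e))"
      using R by (subst sum.reindex) (auto intro!: sum.cong simp: the_inv_into_f_f)
    also have "\<dots> = 0" using \<omega>(1) by (simp add: stress_iff_row_relation[OF assms])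
    finally have "fs.dependent (rigidity_matrix q p ` E)"
      using \<omega>(2,3) R assms(1)
      by (subst fs.dependent_finite) (auto intro!: exI[of _ ?u] simp: the_inv_into_f_f)
    then show False using R by simp
  qed
qed

lemma stress_free_mono:
  fixes p :: "'v \<Rightarrow> real ^ 'd"
  assumes "stress_free q p E" "F \<subseteq> E" "finite E" "E \<subseteq> pairs UNIV"
  shows "stress_free q p F"
proof -
  have F: "finite F" "F \<subseteq> pairs UNIV" using assms finite_subset by auto
  have "fs.independent (rigidity_matrix q p ` F)"
    using assms stress_free_iff_independent[OF assms(3,4)]
    by (meson fs.independent_mono image_mono)
  moreover have "inj_on (rigidity_matrix q p) F"
    using assms stress_free_iff_independent[OF assms(3,4)] inj_on_subset by blast
  ultimately show ?thesis
    by (simp add: stress_free_iff_independent[OF F])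
qed

lemma stress_free_iff_row_rank:
  fixes p :: "'v \<Rightarrow> real ^ 'd"
  assumes "finite E" and "E \<subseteq> pairs UNIV"
  shows "stress_free q p E \<longleftrightarrow> card E \<le> row_rank E (rigidity_matrix q p)"
proof
  let ?R = "rigidity_matrix q p"
  assume "stress_free q p E"
  then show "card E \<le> row_rank E ?R"
    unfolding stress_free_iff_independent[OF assms] row_rank_eq_dim
    by (simp add: fs.dim_eq_card_independent card_image)
next
  let ?R = "rigidity_matrix q p"
  assume le: "card E \<le> row_rank E ?R"
  have fin: "finite (?R ` E)" using assms(1) by simp
  have "row_rank E ?R \<le> card (?R ` E)"
    unfolding row_rank_eq_dim by (rule fs.dim_le_card[OF fs.span_superset fin])
  then have inj: "inj_on ?R E"
    using le assms(1) by (simp add: inj_on_iff_eq_card le_antisym card_image_le)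
  moreover have "fs.independent (?R ` E)"
  proof
    assume "fs.dependent (?R ` E)"
    then obtain a where a: "a \<in> ?R ` E" "a \<in> fs.span (?R ` E - {a})"
      by (auto simp: fs.dependent_def)
    have sub: "?R ` E \<subseteq> fs.span (?R ` E - {a})"
    proof
      fix x assume "x \<in> ?R ` E"
      then show "x \<in> fs.span (?R ` E - {a})"
        using a(2) fs.span_base[of x "?R ` E - {a}"] by (cases "x = a") auto
    qed
    have "finite (?R ` E - {a})" using fin by simp
    with sub have "row_rank E ?R \<le> card (?R ` E - {a})"
      unfolding row_rank_eq_dim by (rule fs.dim_le_card)
    moreover have "card (?R ` E - {a}) < card (?R ` E)"
      using fin a(1) by (rule card_Diff1_less)
    ultimately show False using le inj card_image by fastforce
  qed
  ultimately show "stress_free q p E"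
    by (simp add: stress_free_iff_independent[OF assms])
qed

text \<open>A two-vertex subgraph without edges is a finite subgraph, and genericity speaks of the
  complete graph on its vertices.\<close>

lemma generic_placement_inj:
  assumes "generic_placement q G p"
  shows "inj_on p (verts G)"
proof (rule inj_onI, rule ccontr)
  fix v w assume vw: "v \<in> verts G" "w \<in> verts G" "p v = p w" "v \<noteq> w"
  have "finite_subgraph ({v, w}, {}) G"
    using vw by (simp add: finite_subgraph_def subgraph_def simple_graph_def)
  then have "placement (complete_ugraph {v, w}) p"
    using assms by (auto simp: generic_placement_def generic_finite_def)
  then show False using vw by (auto simp: placement_def complete_ugraph_def)
qed

text \<open>Every set \<open>E\<close> of pairs of vertices is the edge set of a subgraph of a finite complete
  graph, whether or not its pairs are edges of \<open>G\<close>.  Its rank is maximal at a generic placement, so full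
  rank at one placement \<open>x\<close> implies full rank at \<open>p\<close>.  Apart from
  injectivity of \<open>p\<close>, genericity is used only in this form.\<close>

lemma generic_placement_stress_free:
  fixes p x :: "'v \<Rightarrow> real ^ 'd"
  assumes gen: "generic_placement q G p"
    and fin: "finite E" and E: "E \<subseteq> pairs (verts G)"
    and x: "\<And>v w. {v, w} \<in> E \<Longrightarrow> x v \<noteq> x w"
    and sf: "stress_free q x E"
  shows "stress_free q p E"
proof -
  have E': "E \<subseteq> pairs UNIV" using E pairs_mono[of "verts G" UNIV] by blast
  have finW: "finite (\<Union>E)" using fin E by (auto simp: pairs_def)
  have W: "\<Union>E \<subseteq> verts G" using E pairs_imp_subset by blast
  have "finite_subgraph (\<Union>E, {}) G"
    using finW W by (simp add: finite_subgraph_def subgraph_def simple_graph_def)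
  moreover have "subgraph (\<Union>E, E) (complete_ugraph (\<Union>E))"
  proof -
    have "\<exists>v\<in>\<Union>E. \<exists>w\<in>\<Union>E. v \<noteq> w \<and> e = {v, w}" if "e \<in> E" for e
    proof -
      have "e \<in> pairs UNIV" using that E' by blast
      then obtain v w where e: "e = {v, w}" "v \<noteq> w" by (rule pairsE)
      show ?thesis
        by (rule bexI[of _ v], rule bexI[of _ w]) (use e that in auto)
    qed
    moreover from this have "E \<subseteq> pairs (\<Union>E)"
      by (intro subsetI) (simp add: pairs_def, metis)
    ultimately show ?thesis
      by (simp add: subgraph_def simple_graph_def complete_ugraph_def pairs_def)
  qed
  ultimately have "regular_placement q (\<Union>E, E) p"
    using gen by (auto simp: generic_placement_def generic_finite_def)
  then have "row_rank E (rigidity_matrix q x) \<le> row_rank E (rigidity_matrix q p)"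
    using x by (auto simp: regular_placement_def rigidity_rank_def placement_def)
  then show ?thesis
    using sf stress_free_iff_row_rank[OF fin E'] le_trans by blast
qed

section \<open>Duality between rows and velocities\<close>

text \<open>The subspace may be infinite dimensional: a basis of it is extended by \<open>z\<close>, and \<open>\<phi>\<close> is
  prescribed on the extended basis.  On rows, \<open>\<phi>\<close> is then an honest velocity assignment, see
  \<open>functional_row\<close>.\<close>

lemma separating_functional:
  fixes z :: "'j \<Rightarrow> real"
  assumes "z \<notin> fs.span Y"
  obtains \<phi> where "functional \<phi>" "\<And>y. y \<in> Y \<Longrightarrow> \<phi> y = 0" "\<phi> z = 1"
proof -
  obtain B where B: "B \<subseteq> Y" "fs.independent B" "Y \<subseteq> fs.span B"
    using fs.maximal_independent_subset by blast
  have "z \<notin> fs.span B" using assms B(1) fs.span_mono by blast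
  then have "fs.independent (insert z B)" using B(2) by (rule fs.independent_insertI)
  from fs_real.linear_independent_extend[OF this, of "\<lambda>y. if y = z then 1 else 0"]
  obtain \<phi> where \<phi>: "functional \<phi>" "\<And>y. y \<in> insert z B \<Longrightarrow> \<phi> y = (if y = z then 1 else 0)"
    by blast
  have "\<phi> y = 0" if "y \<in> Y" for y
  proof -
    have "y \<in> fs.span B" using that B(3) by blast
    then show ?thesis
    proof (rule fs_real.linear_eq_0_on_span[OF \<phi>(1), rotated])
      fix b assume "b \<in> B"
      moreover have "b \<noteq> z" using \<open>b \<in> B\<close> \<open>z \<notin> fs.span B\<close> fs.span_base by blast
      ultimately show "\<phi> b = 0" using \<phi>(2) by simp
    qed
  qed
  then show thesis using that \<phi> by simp
qed

definition unit_fun :: "'j \<Rightarrow> 'j \<Rightarrow> real" where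
  "unit_fun j k = (if k = j then 1 else 0)"

definition functional_velocity :: "(('v \<times> 'd::finite \<Rightarrow> real) \<Rightarrow> real) \<Rightarrow> 'v \<Rightarrow> real ^ 'd" where
  "functional_velocity \<phi> v = (\<chi> i. \<phi> (unit_fun (v, i)))"

lemmas functional_diff = fs_real.linear_diff
  and functional_scale = fs_real.linear_scale
  and functional_sum = fs_real.linear_sum

text \<open>A row is a finite combination of unit functions, so a functional acts on it through
  its values on those.\<close>

lemma functional_row:
  fixes p :: "'v \<Rightarrow> real ^ 'd"
  assumes \<phi>: "functional \<phi>" and "v \<noteq> w"
  shows "\<phi> (rigidity_matrix q p {v, w}) =
    signed_power (q - 1) (p v - p w) \<bullet> (functional_velocity \<phi> v - functional_velocity \<phi> w)"
proof -
  let ?f = "signed_power (q - 1) (p v - p w)"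
  have row: "rigidity_matrix q p {v, w} =
    (\<Sum>i\<in>UNIV. fscale (?f $ i) (unit_fun (v, i) - unit_fun (w, i)))"
  proof
    fix j :: "'v \<times> 'd"
    obtain x k where j: "j = (x, k)" by (cases j)
    have "?f $ i * (unit_fun (v, i) - unit_fun (w, i)) (x, k) =
        (if i = k then ?f $ k * ((if x = v then 1 else 0) - (if x = w then 1 else 0)) else 0)" for i
      by (auto simp: unit_fun_def)
    then have "(\<Sum>i\<in>UNIV. ?f $ i * (unit_fun (v, i) - unit_fun (w, i)) (x, k)) =
        ?f $ k * ((if x = v then 1 else 0) - (if x = w then 1 else 0))"
      by (simp only: sum.delta finite_code) simp
    then show "rigidity_matrix q p {v, w} j =
        (\<Sum>i\<in>UNIV. fscale (?f $ i) (unit_fun (v, i) - unit_fun (w, i))) j"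
      unfolding sum_fun_apply fscale_apply j using assms(2) by (simp add: rigidity_matrix_edge del: signed_power_nth)
  qed
  show ?thesis
    unfolding row functional_sum[OF \<phi>] functional_scale[OF \<phi>] functional_diff[OF \<phi>]
    by (simp add: inner_vec_def functional_velocity_def)
qed

text \<open>The converse construction, with a finite vertex set to make the sum meaningful on all
  functions.\<close>

definition velocity_functional :: "'v set \<Rightarrow> ('v \<Rightarrow> real ^ 'd) \<Rightarrow> ('v \<times> 'd \<Rightarrow> real) \<Rightarrow> real" where
  "velocity_functional M u z = (\<Sum>v\<in>M. \<Sum>i\<in>UNIV. z (v, i) * u v $ i)"

lemma functional_velocity_functional: "functional (velocity_functional M u)"
  by unfold_locales
    (auto simp: velocity_functional_def algebra_simps sum.distrib sum_distrib_left)

lemma velocity_functional_inverse: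
  assumes "finite M" "v \<in> M"
  shows "functional_velocity (velocity_functional M u) v = u v"
proof -
  have "(\<Sum>w\<in>M. \<Sum>k\<in>UNIV. unit_fun (v, i) (w, k) * u w $ k) = u v $ i" for i
  proof -
    have "(\<Sum>k\<in>UNIV. unit_fun (v, i) (w, k) * u w $ k) = (if w = v then u v $ i else 0)" for w
      by (cases "w = v") (simp_all add: unit_fun_def if_distrib[of "\<lambda>x. x * _"] cong: if_cong)
    then show ?thesis using assms by simp
  qed
  then show ?thesis
    by (simp add: functional_velocity_def velocity_functional_def vec_eq_iff)
qed

section \<open>Counting independent edges\<close>

text \<open>Translations account for two dimensions of the infinitesimal rigid motions; rotations add
  one for the Euclidean norm.\<close>

definition motion_dim :: "real \<Rightarrow> nat" where
  "motion_dim q = (if q = 2 then 3 else 2)"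

definition general_position :: "('v \<Rightarrow> real ^ 2) \<Rightarrow> 'v set \<Rightarrow> bool" where
  "general_position p V \<longleftrightarrow>
     (\<forall>a\<in>V. \<forall>b\<in>V. \<forall>c\<in>V. a \<noteq> b \<and> b \<noteq> c \<and> a \<noteq> c \<longrightarrow> det2 (p a - p c) (p b - p c) \<noteq> 0)"

definition trivial_on :: "real \<Rightarrow> ('v \<Rightarrow> real ^ 2) \<Rightarrow> 'v set \<Rightarrow> ('v \<Rightarrow> real ^ 2) \<Rightarrow> bool" where
  "trivial_on q p M u \<longleftrightarrow>
     (\<exists>a c. (q \<noteq> 2 \<longrightarrow> c = 0) \<and> (\<forall>v\<in>M. u v = a + c *\<^sub>R rot (p v)))"

lemma trivial_on_orthogonal:
  assumes "trivial_on q p M u" "v \<in> M" "w \<in> M"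
  shows "signed_power (q - 1) (p v - p w) \<bullet> (u v - u w) = 0"
proof -
  obtain a c where c: "q \<noteq> 2 \<longrightarrow> c = 0" and u: "\<forall>v\<in>M. u v = a + c *\<^sub>R rot (p v)"
    using assms(1) by (auto simp: trivial_on_def)
  have "u v - u w = c *\<^sub>R rot (p v - p w)"
    using u assms(2,3) by (simp add: rot_diff algebra_simps)
  then show ?thesis using signed_power_orthogonal_rot[OF c] by simp
qed

text \<open>After subtracting the rigid motion that matches \<open>u\<close> at \<open>a\<close> and \<open>b\<close>, the velocity of every
  other point is orthogonal to two independent directions.\<close>

lemma trivial_on_if_triangulated:
  assumes gp: "general_position p M" and inj: "inj_on p M" and ab: "a \<in> M" "b \<in> M" "a \<noteq> b"
    and o: "(p a - p b) \<bullet> (u a - u b) = 0"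
    and ov: "\<And>v. v \<in> M - {a, b} \<Longrightarrow>
      (p v - p a) \<bullet> (u v - u a) = 0 \<and> (p v - p b) \<bullet> (u v - u b) = 0"
  shows "trivial_on 2 p M u"
proof -
  have "p a - p b \<noteq> 0" using ab inj by (auto dest: inj_onD)
  then obtain c where c: "u a - u b = c *\<^sub>R rot (p a - p b)"
    using orthogonal_imp_rot o by blast
  define t where "t v = u v - (u b + c *\<^sub>R rot (p v - p b))" for v
  have rr: "d \<bullet> rot d = 0" for d
    using signed_power_orthogonal_rot[of 2 1 d] by simp
  have "t v = 0" if "v \<in> M" for v
  proof (cases "v = a \<or> v = b")
    case True then show ?thesis using c by (auto simp: t_def rot_diff algebra_simps)
  next
    case False
    then have v: "v \<in> M - {a, b}" using that by simp
    have "t v = (u v - u a) - c *\<^sub>R rot (p v - p a)"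
      using c by (simp add: t_def rot_diff algebra_simps)
    then have "(p v - p a) \<bullet> t v = 0"
      using ov[OF v] rr[of "p v - p a"] by (simp add: inner_diff_right[of _ "u v - u a"])
    moreover have "t v = (u v - u b) - c *\<^sub>R rot (p v - p b)"
      by (simp add: t_def)
    then have "(p v - p b) \<bullet> t v = 0"
      using ov[OF v] rr[of "p v - p b"] by (simp add: inner_diff_right[of _ "u v - u b"])
    moreover have "det2 (p a - p v) (p b - p v) \<noteq> 0"
      using gp ab v by (auto simp: general_position_def)
    then have "det2 (p v - p a) (p v - p b) \<noteq> 0"
      by (simp add: det2_def algebra_simps)
    ultimately show ?thesis using orthogonal_two_directions by blast
  qed
  then have "\<forall>v\<in>M. u v = (u b - c *\<^sub>R rot (p b)) + c *\<^sub>R rot (p v)"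
    by (simp add: t_def rot_diff algebra_simps)
  then show ?thesis by (auto simp: trivial_on_def)
qed

text \<open>An upper bound \<open>2 * card M - motion_dim q\<close> for the number of conditions that make a flex
  trivial.  For \<open>q = 2\<close> the conditions are the rows of a triangulation: an edge \<open>{a, b}\<close> and two edges from
  each further vertex to \<open>a\<close> and \<open>b\<close>.  For \<open>q \<noteq> 2\<close> they say that both velocity coordinates agree with those
  of a base vertex \<open>b\<close>.\<close>

lemma determining_functionals:
  assumes gp: "general_position p M" and inj: "inj_on p M" and M: "finite M" "2 \<le> card M"
  obtains Y where "finite Y" "card Y + motion_dim q \<le> 2 * card M"
    "\<And>\<phi>. functional \<phi> \<Longrightarrow> \<forall>y\<in>Y. \<phi> y = 0 \<Longrightarrow> trivial_on q p M (functional_velocity \<phi>)"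
proof -
  obtain a b where ab: "a \<in> M" "b \<in> M" "a \<noteq> b"
    using M by (metis card_2_iff' ex_card insert_subset subsetD)
  show thesis
  proof (cases "q = 2")
    case True
    let ?R = "rigidity_matrix q p"
    let ?A = "?R ` (\<lambda>v. {v, a}) ` (M - {a, b})" and ?B = "?R ` (\<lambda>v. {v, b}) ` (M - {a, b})"
    let ?Y = "insert (?R {a, b}) (?A \<union> ?B)"
    have "card (M - {a, b}) = card M - 2"
      using ab M by (simp add: card_Diff_subset)
    moreover have "card ?A \<le> card (M - {a, b})" "card ?B \<le> card (M - {a, b})"
      using M(1) by (simp_all add: image_image card_image_le)
    moreover have "card ?Y \<le> Suc (card ?A + card ?B)"
      using card_Un_le[of ?A ?B] card_insert_le_m1 M(1) by (simp add: card_insert_if)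
    ultimately have "card ?Y + motion_dim q \<le> 2 * card M"
      using M(2) True by (simp add: motion_dim_def)
    moreover have "trivial_on q p M (functional_velocity \<phi>)"
      if \<phi>: "functional \<phi>" "\<forall>y\<in>?Y. \<phi> y = 0" for \<phi>
    proof -
      have row: "(p v - p w) \<bullet> (functional_velocity \<phi> v - functional_velocity \<phi> w) = 0"
        if "v \<noteq> w" "?R {v, w} \<in> ?Y" for v w
      proof -
        have "\<phi> (?R {v, w}) = 0" using that(2) \<phi>(2) by (rule bspec[rotated])
        then show ?thesis using functional_row[OF \<phi>(1) that(1), of q p] True by simp
      qed
      show ?thesis unfolding True
        by (rule trivial_on_if_triangulated[OF gp inj ab]) (use row ab in auto)
    qed
    ultimately show thesis
      using M(1) by (intro that[of ?Y]) simp_all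
  next
    case False
    let ?Y = "(\<lambda>(v, i :: 2). unit_fun (v, i) - unit_fun (b, i)) ` ((M - {b}) \<times> UNIV)"
    have "card ?Y \<le> card ((M - {b}) \<times> (UNIV :: 2 set))"
      using M(1) by (intro card_image_le) auto
    also have "\<dots> = 2 * (card M - 1)"
      using M(1) ab by (simp add: card_cartesian_product)
    finally have "card ?Y + motion_dim q \<le> 2 * card M"
      using M(2) False by (simp add: motion_dim_def)
    moreover have "trivial_on q p M (functional_velocity \<phi>)"
      if \<phi>: "functional \<phi>" "\<forall>y\<in>?Y. \<phi> y = 0" for \<phi>
    proof -
      have "functional_velocity \<phi> v = functional_velocity \<phi> b" if "v \<in> M" for v
      proof (cases "v = b")
        case False
        then have "\<phi> (unit_fun (v, i) - unit_fun (b, i)) = 0" for i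
          using \<phi>(2) that by auto
        then show ?thesis
          by (simp add: functional_diff[OF \<phi>(1)] functional_velocity_def vec_eq_iff)
      qed simp
      then show ?thesis unfolding trivial_on_def
        by (intro exI[of _ "functional_velocity \<phi> b"] exI[of _ 0]) auto
    qed
    ultimately show thesis
      using M(1) by (intro that[of ?Y]) simp_all
  qed
qed

text \<open>A row outside of the span would be separated from it by a functional, that is, by a
  velocity assignment which is trivial but changes the length of a pair.\<close>

lemma rows_in_span_determining:
  fixes p :: "'v \<Rightarrow> real ^ 2"
  assumes Y: "\<And>\<phi>. functional \<phi> \<Longrightarrow> \<forall>y\<in>Y. \<phi> y = 0 \<Longrightarrow> trivial_on q p M (functional_velocity \<phi>)"
    and e: "e \<in> pairs M"
  shows "rigidity_matrix q p e \<in> fs.span Y"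
proof (rule ccontr)
  assume "rigidity_matrix q p e \<notin> fs.span Y"
  then obtain \<phi> where \<phi>: "functional \<phi>" "\<And>y. y \<in> Y \<Longrightarrow> \<phi> y = 0" "\<phi> (rigidity_matrix q p e) = 1"
    using separating_functional by blast
  obtain v w where vw: "e = {v, w}" "v \<in> M" "w \<in> M" "v \<noteq> w" using e by (rule pairsE)
  have "\<phi> (rigidity_matrix q p e) = 0"
    unfolding vw(1) functional_row[OF \<phi>(1) vw(4)]
    by (rule trivial_on_orthogonal[OF Y]) (use \<phi> vw in auto)
  then show False using \<phi>(3) by simp
qed

text \<open>The rows of \<open>E\<close> are independent and lie in the span of the determining functionals.\<close>

theorem stress_free_count:
  fixes p :: "'v \<Rightarrow> real ^ 2"
  assumes gp: "general_position p M" and inj: "inj_on p M" and M: "finite M" "2 \<le> card M"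
    and E: "E \<subseteq> pairs M" and sf: "stress_free q p E"
  shows "card E + motion_dim q \<le> 2 * card M"
proof -
  obtain Y where Y: "finite Y" "card Y + motion_dim q \<le> 2 * card M"
    "\<And>\<phi>. functional \<phi> \<Longrightarrow> \<forall>y\<in>Y. \<phi> y = 0 \<Longrightarrow> trivial_on q p M (functional_velocity \<phi>)"
    using determining_functionals[OF gp inj M] by metis
  have fin: "finite E" using finite_subset[OF E finite_pairs] M by blast
  have "E \<subseteq> pairs UNIV" using E pairs_mono[of M UNIV] by blast
  then have "inj_on (rigidity_matrix q p) E" "fs.independent (rigidity_matrix q p ` E)"
    using sf stress_free_iff_independent[OF fin] by auto
  moreover have "rigidity_matrix q p ` E \<subseteq> fs.span Y"
    using rows_in_span_determining[OF Y(3)] E by blast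
  ultimately have "card E \<le> card Y"
    using fs.independent_span_bound[OF Y(1)] by (metis card_image)
  then show ?thesis using Y(2) by simp
qed

text \<open>With as many independent rows as there are determining functionals, the exchange
  principle puts the latter into the span of the rows, so a flex of \<open>E\<close> satisfies them too.\<close>

theorem tight_stress_free_rigid:
  fixes p u :: "'v \<Rightarrow> real ^ 2"
  assumes gp: "general_position p M" and inj: "inj_on p M" and M: "finite M" "2 \<le> card M"
    and E: "E \<subseteq> pairs M" and sf: "stress_free q p E"
    and tight: "2 * card M \<le> card E + motion_dim q"
    and u: "\<And>v w. {v, w} \<in> E \<Longrightarrow> signed_power (q - 1) (p v - p w) \<bullet> (u v - u w) = 0"
  shows "trivial_on q p M u"
proof -
  let ?R = "rigidity_matrix q p"
  obtain Y where Y: "finite Y" "card Y + motion_dim q \<le> 2 * card M"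
    "\<And>\<phi>. functional \<phi> \<Longrightarrow> \<forall>y\<in>Y. \<phi> y = 0 \<Longrightarrow> trivial_on q p M (functional_velocity \<phi>)"
    using determining_functionals[OF gp inj M] by metis
  have fin: "finite E" using finite_subset[OF E finite_pairs] M by blast
  have E': "E \<subseteq> pairs UNIV" using E pairs_mono[of M UNIV] by blast
  then have R: "inj_on ?R E" "fs.independent (?R ` E)"
    using sf stress_free_iff_independent[OF fin] by auto
  have span: "?R ` E \<subseteq> fs.span Y"
    using rows_in_span_determining[OF Y(3)] E by blast
  have YE: "y \<in> fs.span (?R ` E)" if "y \<in> Y" for y
  proof (rule ccontr)
    assume y: "y \<notin> fs.span (?R ` E)"
    then have "fs.independent (insert y (?R ` E))" using R(2) by (intro fs.independent_insertI)
    moreover have "insert y (?R ` E) \<subseteq> fs.span Y"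
      using span fs.span_base[OF that] by simp
    ultimately have "card (insert y (?R ` E)) \<le> card Y"
      using fs.independent_span_bound[OF Y(1), of "insert y (?R ` E)"] by simp
    moreover have "y \<notin> ?R ` E" using y fs.span_base[of y "?R ` E"] by auto
    ultimately show False
      using Y(2) tight R(1) fin by (simp add: card_image)
  qed
  let ?\<phi> = "velocity_functional M u"
  have fv: "functional_velocity ?\<phi> v = u v" if "v \<in> M" for v
    using velocity_functional_inverse[OF M(1) that] .
  have "?\<phi> x = 0" if "x \<in> ?R ` E" for x
  proof -
    from that obtain e where e: "e \<in> E" "x = ?R e" by blast
    then have "e \<in> pairs M" using E by blast
    then obtain v w where vw: "e = {v, w}" "v \<in> M" "w \<in> M" "v \<noteq> w" by (rule pairsE)
    show ?thesis
      unfolding e(2) vw(1) functional_row[OF functional_velocity_functional vw(4)]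
      using fv vw e u by simp
  qed
  then have "\<forall>y\<in>Y. ?\<phi> y = 0"
    using fs_real.linear_eq_0_on_span[OF functional_velocity_functional _ YE] by simp
  from Y(3)[OF functional_velocity_functional this] show ?thesis
    using fv by (simp add: trivial_on_def)
qed

section \<open>Special positions\<close>

lemma stress_iff_rows:
  fixes p :: "'v \<Rightarrow> real ^ 'd"
  assumes "finite E" and "E \<subseteq> pairs UNIV"
  shows "stress q p E \<omega> \<longleftrightarrow> (\<forall>v i. (\<Sum>e\<in>E. \<omega> e * rigidity_matrix q p e (v, i)) = 0)"
  unfolding sum_rigidity_rows[OF assms] stress_def by (simp only: vec_eq_iff zero_index)

lemma det2_independent:
  assumes "det2 A B \<noteq> 0" "a *\<^sub>R A + b *\<^sub>R B = 0"
  shows "a = 0" "b = 0"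
proof -
  have "a * A $ 1 + b * B $ 1 = 0" "a * A $ 2 + b * B $ 2 = 0"
    using assms(2) by (simp_all add: vec_eq_iff forall_2)
  moreover have "a * det2 A B = (a * A $ 1 + b * B $ 1) * B $ 2 - (a * A $ 2 + b * B $ 2) * B $ 1"
    "b * det2 A B = (a * A $ 2 + b * B $ 2) * A $ 1 - (a * A $ 1 + b * B $ 1) * A $ 2"
    by (simp_all add: det2_def algebra_simps)
  ultimately have "a * det2 A B = 0" "b * det2 A B = 0"
    by (simp_all only: mult_zero_left diff_self)
  then show "a = 0" "b = 0" using assms(1) by simp_all
qed

lemma nbrs_pairs: "nbrs (pairs W) v = (if v \<in> W then W - {v} else {})"
  by (auto simp: nbrs_def)

text \<open>The three rows are multiples of one vector spread over the vertices.  With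
  \<open>p b - p c = t *\<^sub>R (p a - p c)\<close> the equilibrium conditions have a nonzero solution, given in the proof.
  Together with the next lemma this shows that generic points are in general position.\<close>

lemma collinear_triangle_stressed:
  fixes p :: "'v \<Rightarrow> real ^ 2"
  assumes abc: "a \<noteq> b" "b \<noteq> c" "a \<noteq> c" and inj: "inj_on p {a, b, c}"
    and det: "det2 (p a - p c) (p b - p c) = 0"
  shows "\<not> stress_free q p (pairs {a, b, c})"
proof
  assume sf: "stress_free q p (pairs {a, b, c})"
  let ?d = "p a - p c" and ?f = "signed_power (q - 1) :: real ^ 2 \<Rightarrow> _" and ?g = "spow (q - 1)"
  have ne: "p a \<noteq> p c" "p b \<noteq> p c" "p a \<noteq> p b" using inj abc by (auto dest: inj_onD)
  have "rot ?d \<noteq> 0" "rot ?d \<bullet> (p b - p c) = 0"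
    using ne(1) det by (simp_all add: det2_def inner_vec_def sum_2 algebra_simps)
  then obtain c' where "p b - p c = c' *\<^sub>R rot (rot ?d)" by (rule orthogonal_imp_rot)
  then obtain t where t: "p b - p c = t *\<^sub>R ?d"
    by (intro that[of "- c'"]) (simp add: vec_eq_iff forall_2 algebra_simps)
  have t': "p a - p b = (1 - t) *\<^sub>R ?d"
    using t by (simp add: algebra_simps)
  have t'': "p c - p b = (- t) *\<^sub>R ?d" "p b - p a = (- (1 - t)) *\<^sub>R ?d"
    "p c - p a = (- 1) *\<^sub>R ?d"
    using t t' by (simp_all add: algebra_simps)
  have "t \<noteq> 0" "t \<noteq> 1" using t t' ne by auto
  have f: "?f (p b - p c) = ?g t *\<^sub>R ?f ?d" "?f (p c - p b) = - ?g t *\<^sub>R ?f ?d"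
    "?f (p a - p b) = ?g (1 - t) *\<^sub>R ?f ?d" "?f (p b - p a) = - ?g (1 - t) *\<^sub>R ?f ?d"
    "?f (p c - p a) = - ?f ?d"
    unfolding t t' t'' signed_power_scaleR spow_minus spow_1 by simp_all
  define \<omega> where "\<omega> e = (if e = {a, b} then ?g t else if e = {a, c} then - (?g t * ?g (1 - t))
    else ?g (1 - t))" for e
  have \<omega>: "\<omega> {a, b} = ?g t" "\<omega> {b, a} = ?g t" "\<omega> {a, c} = - (?g t * ?g (1 - t))"
    "\<omega> {c, a} = - (?g t * ?g (1 - t))" "\<omega> {b, c} = ?g (1 - t)" "\<omega> {c, b} = ?g (1 - t)"
    using abc by (auto simp: \<omega>_def doubleton_eq_iff)
  have "stress q p (pairs {a, b, c}) \<omega>"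
    unfolding stress_def
  proof
    fix v
    have D: "{a, b, c} - {a} = {b, c}" "{a, b, c} - {b} = {a, c}" "{a, b, c} - {c} = {a, b}"
      using abc by auto
    consider "v = a" | "v = b" | "v = c" | "v \<notin> {a, b, c}" by auto
    then show "(\<Sum>w\<in>nbrs (pairs {a, b, c}) v. \<omega> {v, w} *\<^sub>R ?f (p v - p w)) = 0"
      by cases (use abc in \<open>simp_all add: nbrs_pairs D f \<omega> algebra_simps\<close>)
  qed
  then have "\<omega> {a, b} = 0" using sf abc by (simp add: stress_free_def)
  then show False using \<open>t \<noteq> 0\<close> by (simp add: \<omega>)
qed

lemma right_triangle_stress_free:
  fixes x :: "'v \<Rightarrow> real ^ 2"
  assumes abc: "a \<noteq> b" "b \<noteq> c" "a \<noteq> c"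
    and x: "x a = 0" "x b = vector [1, 0]" "x c = vector [0, 1]"
  shows "stress_free q x (pairs {a, b, c})"
  unfolding stress_free_def
proof (intro allI impI)
  fix \<omega> assume "stress q x (pairs {a, b, c}) \<omega>"
  then have s: "(\<Sum>w\<in>nbrs (pairs {a, b, c}) v. \<omega> {v, w} *\<^sub>R signed_power (q - 1) (x v - x w)) = 0" for v
    by (simp add: stress_def)
  have D: "{a, b, c} - {a} = {b, c}" "{a, b, c} - {b} = {a, c}" "{a, b, c} - {c} = {a, b}"
    using abc by auto
  have "\<omega> {b, c} = 0" "\<omega> {b, a} = 0" "\<omega> {a, c} = 0"
    using s[of b] s[of a] abc by (auto simp: nbrs_pairs D x vec_eq_iff forall_2)
  then show "\<forall>e\<in>pairs {a, b, c}. \<omega> e = 0"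
    by (auto simp: pairs_def insert_commute)
qed

text \<open>For \<open>q = 2\<close> the six rows of four points are dependent, as they lie in a space of dimension
  five.  The four points here give a stress only if \<open>2 powr (q - 1) = 2\<close>.\<close>

lemma K4_stress_free:
  fixes x :: "'v \<Rightarrow> real ^ 2"
  assumes abcd: "a \<noteq> b" "a \<noteq> c" "a \<noteq> d" "b \<noteq> c" "b \<noteq> d" "c \<noteq> d" and q: "q \<noteq> 2"
    and x: "x a = 0" "x b = vector [1, 0]" "x c = vector [1, 1]" "x d = vector [2, 1]"
  shows "stress_free q x (pairs {a, b, c, d})"
  unfolding stress_free_def
proof (intro allI impI)
  fix \<omega> assume "stress q x (pairs {a, b, c, d}) \<omega>"
  then have s: "(\<Sum>w\<in>nbrs (pairs {a, b, c, d}) v. \<omega> {v, w} *\<^sub>R signed_power (q - 1) (x v - x w)) = 0" for v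
    by (simp add: stress_def)
  have D: "{a, b, c, d} - {a} = {b, c, d}" "{a, b, c, d} - {b} = {a, c, d}"
    "{a, b, c, d} - {c} = {a, b, d}" "{a, b, c, d} - {d} = {a, b, c}"
    using abcd by auto
  let ?s = "(2 :: real) powr (q - 1)"
  have s2: "?s \<noteq> 2" using q powr_inj[of 2 "q - 1" 1] by simp
  have sp: "spow (q - 1) 2 = ?s" by (simp add: spow_def)
  have sym: "\<omega> {d, a} = \<omega> {a, d}" "\<omega> {d, b} = \<omega> {b, d}" "\<omega> {d, c} = \<omega> {c, d}"
    "\<omega> {c, a} = \<omega> {a, c}" "\<omega> {c, b} = \<omega> {b, c}" "\<omega> {b, a} = \<omega> {a, b}"
    by (simp_all add: insert_commute)
  have d: "\<omega> {a, d} * ?s + (\<omega> {b, d} + \<omega> {c, d}) = 0" "\<omega> {a, d} + \<omega> {b, d} = 0"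
    using s[of d] abcd by (simp_all add: nbrs_pairs D x vec_eq_iff forall_2 sym sp)
  have c: "\<omega> {a, c} - \<omega> {c, d} = 0" "\<omega> {a, c} + \<omega> {b, c} = 0"
    using s[of c] abcd by (simp_all add: nbrs_pairs D x vec_eq_iff forall_2 sym sp)
  have b: "\<omega> {a, b} - \<omega> {b, d} = 0" "- \<omega> {b, c} - \<omega> {b, d} = 0"
    using s[of b] abcd by (simp_all add: nbrs_pairs D x vec_eq_iff forall_2 sym sp)
  have bd: "\<omega> {b, d} = - \<omega> {a, d}" "\<omega> {c, d} = - \<omega> {a, d}" using b c d(2) by linarith+
  have "\<omega> {a, d} * (?s - 2) = 0" using d(1) unfolding bd by (simp add: algebra_simps)
  then have "\<omega> {a, d} = 0" using s2 by simp
  then have "\<omega> {a, b} = 0" "\<omega> {a, c} = 0" "\<omega> {a, d} = 0" "\<omega> {b, c} = 0" "\<omega> {b, d} = 0" "\<omega> {c, d} = 0"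
    using b c d by simp_all
  then show "\<forall>e\<in>pairs {a, b, c, d}. \<omega> e = 0"
    by (auto simp: pairs_def insert_commute)
qed

lemma rigidity_matrix_cong:
  assumes "e \<in> pairs UNIV" "\<And>v. v \<in> e \<Longrightarrow> p v = p' v"
  shows "rigidity_matrix q p e = rigidity_matrix q p' e"
proof -
  obtain v w where e: "e = {v, w}" "v \<noteq> w" using assms(1) by (rule pairsE)
  show ?thesis
  proof
    fix j show "rigidity_matrix q p e j = rigidity_matrix q p' e j"
      using assms(2) e by (cases j) (simp add: rigidity_matrix_edge)
  qed
qed

lemma rigidity_matrix_outside: "v \<notin> e \<Longrightarrow> rigidity_matrix q p e (v, i) = 0"
  by (simp add: rigidity_matrix_def)

text \<open>The new vertex \<open>v\<close> is put on the midpoint of \<open>x\<close> and \<open>y\<close>.  As \<open>z\<close> is off their line,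
  equilibrium at \<open>v\<close> forces the stress on \<open>{v, z}\<close> to vanish and those on \<open>{v, x}\<close> and \<open>{v, y}\<close> to be
  equal; the two collinear bars then act on the rest like a single bar \<open>{x, y}\<close>, up to the factor
  \<open>spow (q - 1) (1 / 2)\<close> coming from their length.\<close>

lemma one_extension_stress_free:
  fixes p :: "'v \<Rightarrow> real ^ 2"
  assumes q: "1 < q" and fin: "finite E" and E: "E \<subseteq> pairs UNIV" and v: "v \<notin> \<Union>E"
    and xyz: "x \<noteq> y" "y \<noteq> z" "x \<noteq> z" "v \<notin> {x, y, z}" and xy: "{x, y} \<notin> E"
    and det: "det2 (p x - p z) (p y - p z) \<noteq> 0"
    and sf: "stress_free q p (insert {x, y} E)"
  shows "stress_free q (p(v := (1 / 2) *\<^sub>R (p x + p y))) (E \<union> {{v, x}, {v, y}, {v, z}})"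
  unfolding stress_free_def
proof (intro allI impI)
  let ?m = "(1 / 2) *\<^sub>R (p x + p y)" and ?f = "signed_power (q - 1) :: real ^ 2 \<Rightarrow> _"
  let ?p = "p(v := ?m)"
  let ?R = "rigidity_matrix q ?p" and ?E = "E \<union> {{v, x}, {v, y}, {v, z}}"
  let ?h = "spow (q - 1) (1 / 2)"
  fix \<omega> assume \<omega>: "stress q ?p ?E \<omega>"
  have E2: "?E \<subseteq> pairs UNIV" "finite ?E" using E fin xyz by auto
  have new: "{v, x} \<notin> E" "{v, y} \<notin> E" "{v, z} \<notin> E" using v by auto
  have "{v, x} \<noteq> {v, y}" "{v, x} \<noteq> {v, z}" "{v, y} \<noteq> {v, z}" using xyz by (auto simp: doubleton_eq_iff)
  then have split: "(\<Sum>e\<in>?E. h e) = (\<Sum>e\<in>E. h e) + (h {v, x} + (h {v, y} + h {v, z}))" for h :: "_ \<Rightarrow> real"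
    using new fin by (subst sum.union_disjoint) auto
  have row: "?R e = rigidity_matrix q p e" if "e \<in> E" for e
    by (rule rigidity_matrix_cong) (use that E v in auto)
  have rel: "(\<Sum>e\<in>E. \<omega> e * rigidity_matrix q p e (u, i)) + (\<omega> {v, x} * ?R {v, x} (u, i) +
      (\<omega> {v, y} * ?R {v, y} (u, i) + \<omega> {v, z} * ?R {v, z} (u, i))) = 0" for u i
  proof -
    have "(\<Sum>e\<in>E. \<omega> e * ?R e (u, i)) = (\<Sum>e\<in>E. \<omega> e * rigidity_matrix q p e (u, i))"
      by (intro sum.cong) (simp_all add: row)
    then show ?thesis
      using \<omega>[unfolded stress_iff_rows[OF E2(2,1)] split, rule_format, of u i] by simp
  qed
  have out: "(\<Sum>e\<in>E. \<omega> e * rigidity_matrix q p e (v, i)) = 0" for i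
    using v by (intro sum.neutral) (auto simp: rigidity_matrix_outside)
  have mx: "?m - p x = (1 / 2) *\<^sub>R (p y - p x)" and my: "?m - p y = (1 / 2) *\<^sub>R (p x - p y)"
    by (simp_all add: vec_eq_iff field_simps)
  have fx: "?f (?m - p x) = (- ?h) *\<^sub>R ?f (p x - p y)" and fy: "?f (?m - p y) = ?h *\<^sub>R ?f (p x - p y)"
    using signed_power_minus[of "q - 1" "p y - p x"]
    unfolding mx my signed_power_scaleR by simp_all
  have ne: "v \<noteq> x" "v \<noteq> y" "v \<noteq> z" using xyz by auto
  have R: "?R {v, x} (u, i) = (if u = v then - ?h * ?f (p x - p y) $ i else if u = x then ?h * ?f (p x - p y) $ i else 0)"
    "?R {v, y} (u, i) = (if u = v then ?h * ?f (p x - p y) $ i else if u = y then - ?h * ?f (p x - p y) $ i else 0)"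
    "?R {v, z} (u, i) = (if u = v then ?f (?m - p z) $ i else if u = z then - ?f (?m - p z) $ i else 0)" for u i
    using ne rigidity_matrix_edge[OF ne(1), of q ?p u i] rigidity_matrix_edge[OF ne(2), of q ?p u i]
      rigidity_matrix_edge[OF ne(3), of q ?p u i]
    by (simp_all add: fx fy del: signed_power_nth)
  have at_v: "((\<omega> {v, y} - \<omega> {v, x}) * ?h) *\<^sub>R ?f (p x - p y) + \<omega> {v, z} *\<^sub>R ?f (?m - p z) = 0"
    using rel[of v] unfolding R out
    by (simp add: vec_eq_iff algebra_simps del: signed_power_nth)
  have "det2 (p x - p y) (?m - p z) = det2 (p x - p z) (p y - p z)"
    by (simp add: det2_def field_simps)
  then have "det2 (?f (p x - p y)) (?f (?m - p z)) \<noteq> 0"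
    using det q by (simp only: det2_signed_power_eq_0_iff) simp
  from det2_independent[OF this at_v] have 1: "\<omega> {v, y} = \<omega> {v, x}" "\<omega> {v, z} = 0"
    by simp_all
  define \<omega>' where "\<omega>' e = (if e = {x, y} then \<omega> {v, x} * ?h else \<omega> e)" for e
  have I: "finite (insert {x, y} E)" "insert {x, y} E \<subseteq> pairs UNIV" using fin E xyz by auto
  have "(\<Sum>e\<in>insert {x, y} E. \<omega>' e * rigidity_matrix q p e (u, i)) = 0" for u i
  proof -
    have "(\<Sum>e\<in>E. \<omega>' e * rigidity_matrix q p e (u, i)) = (\<Sum>e\<in>E. \<omega> e * rigidity_matrix q p e (u, i))"
      using xy by (intro sum.cong) (auto simp: \<omega>'_def)
    then have "(\<Sum>e\<in>insert {x, y} E. \<omega>' e * rigidity_matrix q p e (u, i)) =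
        (\<Sum>e\<in>E. \<omega> e * rigidity_matrix q p e (u, i)) + \<omega> {v, x} * ?h * rigidity_matrix q p {x, y} (u, i)"
      using fin xy by (simp add: \<omega>'_def)
    also have "\<dots> = 0"
    proof (cases "u = v")
      case True
      then show ?thesis using out ne by (simp add: rigidity_matrix_outside)
    next
      case False
      then show ?thesis
        using rel[of u i] 1 xyz unfolding R rigidity_matrix_edge[OF xyz(1)]
        by (simp del: signed_power_nth split: if_splits)
    qed
    finally show ?thesis .
  qed
  then have "stress q p (insert {x, y} E) \<omega>'"
    by (simp add: stress_iff_rows[OF I])
  then have 0: "\<omega>' e = 0" if "e \<in> insert {x, y} E" for e
    using sf that unfolding stress_free_def by blast
  have "?h \<noteq> 0" by simp
  then have "\<omega> {v, x} = 0" using 0[of "{x, y}"] by (simp add: \<omega>'_def)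
  moreover have "\<omega> e = 0" if "e \<in> E" for e using 0[of e] that xy by (auto simp: \<omega>'_def split: if_splits)
  ultimately show "\<forall>e\<in>?E. \<omega> e = 0" using 1 by auto
qed

text \<open>Linear independence of finitely many vectors survives small changes.  A dual family
  \<open>b\<close> of the limit vectors is paired with the perturbed vectors; the resulting square matrix \<open>A\<close> is close
  to the identity, hence strictly diagonally dominant and injective.\<close>

lemma independent_family_open:
  fixes r :: "real \<Rightarrow> 'e \<Rightarrow> 'j \<Rightarrow> real"
  assumes fin: "finite E" "finite J"
    and lim: "\<And>e j. e \<in> E \<Longrightarrow> j \<in> J \<Longrightarrow> ((\<lambda>\<epsilon>. r \<epsilon> e j) \<longlongrightarrow> rlim e j) F"
    and indep: "\<And>\<omega>. \<forall>j\<in>J. (\<Sum>e\<in>E. \<omega> e * rlim e j) = 0 \<Longrightarrow> \<forall>e\<in>E. \<omega> e = 0"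
  shows "\<forall>\<^sub>F \<epsilon> in F. \<forall>\<omega>. (\<forall>j\<in>J. (\<Sum>e\<in>E. \<omega> e * r \<epsilon> e j) = 0) \<longrightarrow> (\<forall>e\<in>E. \<omega> e = 0)"
proof -
  define s where "s e j = (if j \<in> J then rlim e j else 0)" for e j
  have "\<exists>b. \<forall>e'\<in>E. (\<Sum>j\<in>J. b j * rlim e' j) = (if e' = e then 1 else 0)" if e: "e \<in> E" for e
  proof -
    have "s e \<notin> fs.span (s ` (E - {e}))"
    proof
      assume "s e \<in> fs.span (s ` (E - {e}))"
      then obtain c where c: "s e = (\<Sum>a\<in>s ` (E - {e}). fscale (c a) a)"
        using fs.span_finite[of "s ` (E - {e})"] fin by auto
      obtain T where T: "T \<subseteq> E - {e}" "inj_on s T" "s ` (E - {e}) = s ` T"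
        using subset_image_inj[of "s ` (E - {e})" s "E - {e}"] by auto
      define \<omega> where "\<omega> a = (if a = e then - 1 else if a \<in> T then c (s a) else 0)" for a
      have "(\<Sum>a\<in>E. \<omega> a * rlim a j) = 0" if "j \<in> J" for j
      proof -
        have "(\<Sum>a\<in>E. \<omega> a * rlim a j) = \<omega> e * rlim e j + (\<Sum>a\<in>E - {e}. \<omega> a * rlim a j)"
          using e fin(1) by (rule sum.remove[rotated])
        also have "(\<Sum>a\<in>E - {e}. \<omega> a * rlim a j) = (\<Sum>a\<in>T. \<omega> a * rlim a j)"
          using T(1) fin by (intro sum.mono_neutral_right) (auto simp: \<omega>_def)
        also have "\<dots> = (\<Sum>a\<in>T. c (s a) * s a j)"
          using T(1) that by (intro sum.cong) (auto simp: \<omega>_def s_def)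
        also have "\<dots> = s e j"
          unfolding c T(3) sum.reindex[OF T(2)] sum_fun_apply by simp
        finally show ?thesis using that by (simp add: \<omega>_def s_def)
      qed
      then show False using indep[of \<omega>] e by (auto simp: \<omega>_def)
    qed
    then obtain \<phi> where \<phi>: "functional \<phi>" "\<And>y. y \<in> s ` (E - {e}) \<Longrightarrow> \<phi> y = 0" "\<phi> (s e) = 1"
      using separating_functional by blast
    have "(\<Sum>j\<in>J. \<phi> (unit_fun j) * rlim e' j) = \<phi> (s e')" for e'
    proof -
      have "s e' = (\<Sum>j\<in>J. fscale (rlim e' j) (unit_fun j))"
      proof
        fix k
        have "(\<Sum>j\<in>J. rlim e' j * unit_fun j k) = (\<Sum>j\<in>J. if j = k then rlim e' k else 0)"
          by (intro sum.cong) (auto simp: unit_fun_def)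
        then show "s e' k = (\<Sum>j\<in>J. fscale (rlim e' j) (unit_fun j)) k"
          using fin by (simp add: sum_fun_apply s_def)
      qed
      then show ?thesis
        by (simp add: functional_sum[OF \<phi>(1)] functional_scale[OF \<phi>(1)] mult.commute)
    qed
    then show ?thesis using \<phi> by (intro exI[of _ "\<lambda>j. \<phi> (unit_fun j)"]) auto
  qed
  then obtain b where b: "\<And>e e'. e \<in> E \<Longrightarrow> e' \<in> E \<Longrightarrow> (\<Sum>j\<in>J. b e j * rlim e' j) = (if e' = e then 1 else 0)"
    by metis
  define A where "A \<epsilon> e e' = (\<Sum>j\<in>J. b e j * r \<epsilon> e' j)" for \<epsilon> e e'
  define n where "n = real (card E) + 1"
  have n: "n > 0" by (simp add: n_def)
  have "((\<lambda>\<epsilon>. A \<epsilon> e e') \<longlongrightarrow> (if e' = e then 1 else 0)) F" if "e \<in> E" "e' \<in> E" for e e'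
    unfolding A_def b[OF that, symmetric] using lim that by (intro tendsto_sum tendsto_mult) auto
  then have "\<forall>\<^sub>F \<epsilon> in F. \<bar>(if e' = e then 1 else 0) - A \<epsilon> e e'\<bar> < 1 / n" if "e \<in> E" "e' \<in> E" for e e'
    using tendstoD[of "\<lambda>\<epsilon>. A \<epsilon> e e'" _ F "1 / n"] that n
    unfolding dist_real_def by (subst abs_minus_commute) simp
  then have "\<forall>\<^sub>F \<epsilon> in F. \<forall>e\<in>E. \<forall>e'\<in>E. \<bar>(if e' = e then 1 else 0) - A \<epsilon> e e'\<bar> < 1 / n"
    by (intro eventually_ball_finite ballI fin)
  then show ?thesis
  proof eventually_elim
    case (elim \<epsilon>)
    show ?case
    proof (intro allI impI)
      fix \<omega> assume \<omega>: "\<forall>j\<in>J. (\<Sum>e\<in>E. \<omega> e * r \<epsilon> e j) = 0"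
      have A0: "(\<Sum>e'\<in>E. \<omega> e' * A \<epsilon> e e') = 0" for e
      proof -
        have "(\<Sum>e'\<in>E. \<omega> e' * A \<epsilon> e e') = (\<Sum>e'\<in>E. \<Sum>j\<in>J. b e j * (\<omega> e' * r \<epsilon> e' j))"
          by (simp add: A_def sum_distrib_left mult_ac)
        also have "\<dots> = (\<Sum>j\<in>J. b e j * (\<Sum>e'\<in>E. \<omega> e' * r \<epsilon> e' j))"
          by (subst sum.swap) (simp add: sum_distrib_left)
        finally show ?thesis using \<omega> by simp
      qed
      show "\<forall>e\<in>E. \<omega> e = 0"
      proof (cases "E = {}")
        case False
        \<comment> \<open>diagonal dominance, in the row of an entry of maximal modulus\<close>
        define m where "m = Max ((\<lambda>e. \<bar>\<omega> e\<bar>) ` E)"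
        have m: "\<bar>\<omega> e\<bar> \<le> m" if "e \<in> E" for e using that fin by (simp add: m_def)
        obtain e where e: "e \<in> E" "\<bar>\<omega> e\<bar> = m"
        proof -
          have "m \<in> (\<lambda>e. \<bar>\<omega> e\<bar>) ` E" unfolding m_def using fin False by (intro Max_in) auto
          then show thesis using that by blast
        qed
        have "\<omega> e = (\<Sum>e'\<in>E. \<omega> e' * (if e' = e then 1 else 0))"
          using fin e(1) by (simp add: if_distrib[of "\<lambda>x. _ * x"] cong: if_cong)
        also have "\<dots> = (\<Sum>e'\<in>E. \<omega> e' * ((if e' = e then 1 else 0) - A \<epsilon> e e'))"
          using A0[of e] by (simp add: right_diff_distrib sum_subtractf)
        finally have "m \<le> (\<Sum>e'\<in>E. \<bar>\<omega> e' * ((if e' = e then 1 else 0) - A \<epsilon> e e')\<bar>)"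
          using e(2) sum_abs by metis
        also have "\<dots> \<le> (\<Sum>e'\<in>E. m * (1 / n))"
        proof (rule sum_mono)
          fix e' assume e': "e' \<in> E"
          show "\<bar>\<omega> e' * ((if e' = e then 1 else 0) - A \<epsilon> e e')\<bar> \<le> m * (1 / n)"
            unfolding abs_mult using m[OF e'] e' e(1) elim abs_ge_zero[of "\<omega> e'"]
            by (intro mult_mono) (auto simp: less_imp_le)
        qed
        also have "\<dots> = (n - 1) * m / n" by (simp add: n_def)
        finally have "m * n \<le> (n - 1) * m" using n by (simp add: field_simps)
        then have "m \<le> 0" by (simp add: algebra_simps)
        then show ?thesis using m by fastforce
      qed simp
    qed
  qed
qed

lemma contracted_row:
  fixes x :: "'v \<Rightarrow> real ^ 'd"
  assumes "finite V" "a \<in> V" "b \<in> V" "a \<noteq> b"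
  shows "(\<Sum>v | v \<in> V \<and> \<kappa> v = c. rigidity_matrix q x {a, b} (v, i)) =
    ((if \<kappa> a = c then 1 else 0) - (if \<kappa> b = c then 1 else 0)) * signed_power (q - 1) (x a - x b) $ i"
proof -
  let ?F = "signed_power (q - 1) (x a - x b) $ i"
  have "(\<Sum>v | v \<in> V \<and> \<kappa> v = c. rigidity_matrix q x {a, b} (v, i)) =
      (\<Sum>v\<in>{v \<in> V. \<kappa> v = c}. (if v = a then ?F else 0) + (if v = b then - ?F else 0))"
    using assms(4) by (intro sum.cong) (auto simp: rigidity_matrix_edge)
  then show ?thesis
    using assms by (simp add: sum.distrib)
qed

definition contract :: "'v set \<Rightarrow> 'v \<Rightarrow> 'v \<Rightarrow> 'v" where
  "contract M k v = (if v \<in> M then k else v)"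

text \<open>The set \<open>M\<close> is placed as a small copy of itself, scaled by \<open>\<epsilon>\<close> towards \<open>p k\<close>.  Summing the
  equilibrium equations over \<open>M\<close> removes the edges inside \<open>M\<close> and leaves relations among the
  contracted rows of the other edges, which for \<open>\<epsilon> \<rightarrow> 0\<close> tend to the independent rows of the contracted
  graph.  So for small \<open>\<epsilon>\<close> a stress vanishes on the outer edges, and then also inside \<open>M\<close> since scaling
  only multiplies the rows there by a constant.\<close>

lemma contraction_stress_free:
  fixes p :: "'v \<Rightarrow> real ^ 'd"
  assumes q: "1 < q" and V: "finite V" "inj_on p V" and E: "E \<subseteq> pairs V" and M: "M \<subseteq> V" "k \<in> M"
    and inj: "inj_on ((`) (contract M k)) {e \<in> E. \<not> e \<subseteq> M}"
    and sfM: "stress_free q p {e \<in> E. e \<subseteq> M}"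
    and sfO: "stress_free q p ((`) (contract M k) ` {e \<in> E. \<not> e \<subseteq> M})"
  obtains x :: "'v \<Rightarrow> real ^ 'd" where "inj_on x V" "stress_free q x E"
proof -
  define \<kappa> where "\<kappa> = contract M k"
  have \<kappa>: "\<kappa> v = (if v \<in> M then k else v)" for v by (simp add: \<kappa>_def contract_def)
  have \<kappa>V: "\<kappa> v \<in> V" if "v \<in> V" for v using that M by (auto simp: \<kappa>)
  note inj = inj[folded \<kappa>_def] and sfO = sfO[folded \<kappa>_def]
  define EM where "EM = {e \<in> E. e \<subseteq> M}"
  define EO where "EO = {e \<in> E. \<not> e \<subseteq> M}"
  have finE: "finite E" using finite_subset[OF E] finite_pairs V by blast
  have fin: "finite EM" "finite EO" using finE by (auto simp: EM_def EO_def)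
  have E': "E \<subseteq> pairs UNIV" using E pairs_mono[of V UNIV] by blast
  have EM': "EM \<subseteq> pairs UNIV" using E' by (auto simp: EM_def)
  have EO: "\<kappa> ` e \<in> pairs UNIV" if "e \<in> EO" for e
  proof -
    have "e \<in> pairs V" using that E by (auto simp: EO_def)
    then obtain a b where e: "e = {a, b}" "a \<noteq> b" by (rule pairsE)
    then have "a \<notin> M \<or> b \<notin> M" using that by (simp add: EO_def)
    then have "\<kappa> a \<noteq> \<kappa> b" using e(2) M(2) by (auto simp: \<kappa>)
    then show ?thesis by (simp add: e(1))
  qed
  define x where "x \<epsilon> v = (if v \<in> M then p k + \<epsilon> *\<^sub>R (p v - p k) else p v)" for \<epsilon> v
  \<comment> \<open>the row of \<open>e\<close> with the columns of all vertices of \<open>M\<close> added up in the column of \<open>k\<close>\<close>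
  define r where "r \<epsilon> e = (\<lambda>(c, i). \<Sum>v | v \<in> V \<and> \<kappa> v = c. rigidity_matrix q (x \<epsilon>) e (v, i))" for \<epsilon> e
  have x_lim: "((\<lambda>\<epsilon>. x \<epsilon> v) \<longlongrightarrow> p (\<kappa> v)) (at_right 0)" for v
  proof (cases "v \<in> M")
    case True
    have "((\<lambda>\<epsilon>. p k + \<epsilon> *\<^sub>R (p v - p k)) \<longlongrightarrow> p k + 0 *\<^sub>R (p v - p k)) (at_right 0)"
      by (intro tendsto_intros)
    then show ?thesis using True by (simp add: x_def \<kappa>)
  qed (simp add: x_def \<kappa>)
  have r_lim: "((\<lambda>\<epsilon>. r \<epsilon> e j) \<longlongrightarrow> rigidity_matrix q p (\<kappa> ` e) j) (at_right 0)" if "e \<in> EO" for e j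
  proof -
    obtain c i where j: "j = (c, i)" by (cases j)
    have "e \<in> pairs V" using that E by (auto simp: EO_def)
    then obtain a b where e: "e = {a, b}" "a \<in> V" "b \<in> V" "a \<noteq> b" by (rule pairsE)
    have ne: "\<kappa> a \<noteq> \<kappa> b" using EO[OF that] e by simp
    have "rigidity_matrix q p (\<kappa> ` e) j =
        ((if \<kappa> a = c then 1 else 0) - (if \<kappa> b = c then 1 else 0)) *
          signed_power (q - 1) (p (\<kappa> a) - p (\<kappa> b)) $ i"
      using ne by (auto simp: e(1) j rigidity_matrix_edge)
    moreover have "((\<lambda>\<epsilon>. spow (q - 1) (x \<epsilon> a $ i - x \<epsilon> b $ i)) \<longlongrightarrow>
        spow (q - 1) (p (\<kappa> a) $ i - p (\<kappa> b) $ i)) (at_right 0)"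
      using q by (intro isCont_tendsto_compose[OF continuous_spow] tendsto_diff tendsto_vec_nth x_lim) simp
    then have "((\<lambda>\<epsilon>. ((if \<kappa> a = c then 1 else 0) - (if \<kappa> b = c then 1 else 0)) *
          signed_power (q - 1) (x \<epsilon> a - x \<epsilon> b) $ i) \<longlongrightarrow>
        ((if \<kappa> a = c then 1 else 0) - (if \<kappa> b = c then 1 else 0)) *
          signed_power (q - 1) (p (\<kappa> a) - p (\<kappa> b)) $ i) (at_right 0)"
      by (intro tendsto_mult tendsto_const) simp
    ultimately show ?thesis
      unfolding r_def j e(1) prod.case contracted_row[OF V(1) e(2-4)] by (simp only: e(1) j)
  qed
  have "\<forall>e\<in>EO. \<omega> e = 0"
    if \<omega>: "\<forall>j\<in>V \<times> UNIV. (\<Sum>e\<in>EO. \<omega> e * rigidity_matrix q p (\<kappa> ` e) j) = 0" for \<omega>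
  proof -
    define \<omega>' where "\<omega>' e = \<omega> (the_inv_into EO ((`) \<kappa>) e)" for e
    have \<omega>': "\<omega>' (\<kappa> ` e) = \<omega> e" if "e \<in> EO" for e
      using that inj by (simp add: \<omega>'_def EO_def[symmetric] the_inv_into_f_f)
    have fin': "finite ((`) \<kappa> ` EO)" "(`) \<kappa> ` EO \<subseteq> pairs UNIV" using fin EO by auto
    have "(\<Sum>e\<in>(`) \<kappa> ` EO. \<omega>' e * rigidity_matrix q p e (v, i)) = 0" for v i
    proof -
      have "(\<Sum>e\<in>(`) \<kappa> ` EO. \<omega>' e * rigidity_matrix q p e (v, i)) =
          (\<Sum>e\<in>EO. \<omega> e * rigidity_matrix q p (\<kappa> ` e) (v, i))"
        using inj by (subst sum.reindex) (auto simp: EO_def[symmetric] \<omega>')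
      also have "\<dots> = 0"
      proof (cases "v \<in> V")
        case False
        have "v \<notin> \<kappa> ` e" if "e \<in> EO" for e
        proof -
          have "e \<subseteq> V" using that E pairs_imp_subset[of e V] by (auto simp: EO_def)
          then show ?thesis using False \<kappa>V by blast
        qed
        then show ?thesis by (intro sum.neutral) (auto simp: rigidity_matrix_outside)
      qed (use \<omega> in simp)
      finally show ?thesis .
    qed
    then have "stress q p ((`) \<kappa> ` EO) \<omega>'" by (simp add: stress_iff_rows[OF fin'])
    then show ?thesis using sfO \<omega>' by (auto simp: stress_free_def EO_def[symmetric])
  qed
  from independent_family_open[where r = r and rlim = "\<lambda>e. rigidity_matrix q p (\<kappa> ` e)"
      and F = "at_right 0" and J = "V \<times> UNIV", OF fin(2) _ r_lim this]
  have "\<forall>\<^sub>F \<epsilon> in at_right 0. \<forall>\<omega>. (\<forall>j\<in>V \<times> UNIV. (\<Sum>e\<in>EO. \<omega> e * r \<epsilon> e j) = 0) \<longrightarrow> (\<forall>e\<in>EO. \<omega> e = 0)"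
    using V(1) by simp
  moreover have "\<forall>\<^sub>F \<epsilon> in at_right 0. \<forall>v\<in>V. \<forall>w\<in>V. \<kappa> v \<noteq> \<kappa> w \<longrightarrow> x \<epsilon> v \<noteq> x \<epsilon> w"
  proof (intro eventually_ball_finite ballI V(1))
    fix v w assume vw: "v \<in> V" "w \<in> V"
    have "\<forall>\<^sub>F \<epsilon> in at_right 0. x \<epsilon> v \<noteq> x \<epsilon> w" if "\<kappa> v \<noteq> \<kappa> w"
    proof -
      have "p (\<kappa> v) \<noteq> p (\<kappa> w)" using that V(2) \<kappa>V[OF vw(1)] \<kappa>V[OF vw(2)] by (auto dest: inj_onD)
      then have "p (\<kappa> v) - p (\<kappa> w) \<noteq> 0" by simp
      from tendsto_imp_eventually_ne[OF tendsto_diff[OF x_lim x_lim] this]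
      show ?thesis by simp
    qed
    then show "\<forall>\<^sub>F \<epsilon> in at_right 0. \<kappa> v \<noteq> \<kappa> w \<longrightarrow> x \<epsilon> v \<noteq> x \<epsilon> w"
      by (cases "\<kappa> v = \<kappa> w") auto
  qed
  moreover have "\<forall>\<^sub>F \<epsilon> in at_right 0. \<epsilon> > (0 :: real)" by (rule eventually_at_right_less)
  ultimately have "\<forall>\<^sub>F \<epsilon> in at_right 0. (\<forall>\<omega>. (\<forall>j\<in>V \<times> UNIV. (\<Sum>e\<in>EO. \<omega> e * r \<epsilon> e j) = 0) \<longrightarrow> (\<forall>e\<in>EO. \<omega> e = 0))
     \<and> (\<forall>v\<in>V. \<forall>w\<in>V. \<kappa> v \<noteq> \<kappa> w \<longrightarrow> x \<epsilon> v \<noteq> x \<epsilon> w) \<and> \<epsilon> > 0"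
    by (intro eventually_conj)
  from eventually_happens'[OF trivial_limit_at_right_real this] obtain \<epsilon>
    where \<epsilon>: "\<forall>\<omega>. (\<forall>j\<in>V \<times> UNIV. (\<Sum>e\<in>EO. \<omega> e * r \<epsilon> e j) = 0) \<longrightarrow> (\<forall>e\<in>EO. \<omega> e = 0)"
    "\<forall>v\<in>V. \<forall>w\<in>V. \<kappa> v \<noteq> \<kappa> w \<longrightarrow> x \<epsilon> v \<noteq> x \<epsilon> w" "\<epsilon> > 0"
    by (elim exE conjE)
  have xinj: "inj_on (x \<epsilon>) V"
  proof (rule inj_onI)
    fix v w assume vw: "v \<in> V" "w \<in> V" "x \<epsilon> v = x \<epsilon> w"
    then have "\<kappa> v = \<kappa> w" using \<epsilon>(2) by blast
    then have "v = w \<or> v \<in> M \<and> w \<in> M" using M(2) by (auto simp: \<kappa> split: if_splits)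
    moreover have "p v = p w" if "v \<in> M" "w \<in> M" using that vw(3) \<epsilon>(3) by (simp add: x_def)
    ultimately show "v = w" using vw V(2) by (auto dest: inj_onD)
  qed
  have "stress_free q (x \<epsilon>) E"
    unfolding stress_free_def
  proof (intro allI impI)
    fix \<omega> assume "stress q (x \<epsilon>) E \<omega>"
    then have \<omega>: "(\<Sum>e\<in>E. \<omega> e * rigidity_matrix q (x \<epsilon>) e (v, i)) = 0" for v i
      by (simp add: stress_iff_rows[OF finE E'])
    have EU: "E = EM \<union> EO" "EM \<inter> EO = {}" by (auto simp: EM_def EO_def)
    have "(\<Sum>e\<in>EO. \<omega> e * r \<epsilon> e (c, i)) = 0" for c i
    proof -
      have "r \<epsilon> e (c, i) = 0" if "e \<in> EM" for e
      proof -
        have "e \<in> pairs V" using that E by (auto simp: EM_def)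
        then obtain a b where e: "e = {a, b}" "a \<in> V" "b \<in> V" "a \<noteq> b" by (rule pairsE)
        then have "\<kappa> a = \<kappa> b" using that by (simp add: EM_def \<kappa>)
        then show ?thesis unfolding r_def e(1) prod.case contracted_row[OF V(1) e(2-4)] by simp
      qed
      then have "(\<Sum>e\<in>EO. \<omega> e * r \<epsilon> e (c, i)) = (\<Sum>e\<in>E. \<omega> e * r \<epsilon> e (c, i))"
        using fin EU by (intro sum.mono_neutral_left finE) auto
      also have "\<dots> = (\<Sum>v | v \<in> V \<and> \<kappa> v = c. \<Sum>e\<in>E. \<omega> e * rigidity_matrix q (x \<epsilon>) e (v, i))"
        unfolding r_def prod.case sum_distrib_left by (rule sum.swap)
      finally show ?thesis using \<omega> by simp
    qed
    then have 0: "\<forall>e\<in>EO. \<omega> e = 0" using \<epsilon>(1) by auto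
    have "(\<Sum>e\<in>EM. \<omega> e * rigidity_matrix q p e (v, i)) = 0" for v i
    proof -
      have row: "rigidity_matrix q (x \<epsilon>) e (v, i) = spow (q - 1) \<epsilon> * rigidity_matrix q p e (v, i)"
        if "e \<in> EM" for e
      proof -
        have "e \<in> pairs UNIV" using that EM' by blast
        then obtain a b where e: "e = {a, b}" "a \<noteq> b" by (rule pairsE)
        have "a \<in> M" "b \<in> M" using that e by (auto simp: EM_def)
        then have "x \<epsilon> a - x \<epsilon> b = \<epsilon> *\<^sub>R (p a - p b)" by (simp add: x_def algebra_simps)
        then show ?thesis
          unfolding e(1) rigidity_matrix_edge[OF e(2)]
          by (simp add: signed_power_scaleR del: signed_power_nth)
      qed
      have "0 = (\<Sum>e\<in>EM. \<omega> e * rigidity_matrix q (x \<epsilon>) e (v, i))"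
        unfolding \<omega>[of v i, symmetric] using 0 EU fin by (intro sum.mono_neutral_right finE) auto
      also have "\<dots> = spow (q - 1) \<epsilon> * (\<Sum>e\<in>EM. \<omega> e * rigidity_matrix q p e (v, i))"
        by (simp add: row sum_distrib_left mult_ac)
      finally show ?thesis using \<epsilon>(3) by simp
    qed
    then have "stress q p EM \<omega>" by (simp add: stress_iff_rows[OF fin(1) EM'])
    then have "\<forall>e\<in>EM. \<omega> e = 0" using sfM by (simp add: stress_free_def EM_def)
    then show "\<forall>e\<in>E. \<omega> e = 0" using 0 EU by auto
  qed
  from that[OF xinj this] show thesis .
qed

section \<open>Sparse edge sets and tight vertex sets\<close>

definition induced :: "'v set set \<Rightarrow> 'v set \<Rightarrow> 'v set set" where
  "induced E M = {e \<in> E. e \<subseteq> M}"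

text \<open>The counting condition of Laman (\<open>motion_dim q = 3\<close>) or the \<open>(2, 2)\<close>-sparsity condition
  (\<open>motion_dim q = 2\<close>).  Sets of size one are excluded because they would violate the former.\<close>

definition sparse_edges :: "real \<Rightarrow> 'v set set \<Rightarrow> bool" where
  "sparse_edges q E \<longleftrightarrow>
     (\<forall>M. finite M \<longrightarrow> 2 \<le> card M \<longrightarrow> card (induced E M) + motion_dim q \<le> 2 * card M)"

text \<open>Stated as an inequality so that it makes sense for arbitrary edge sets; in a sparse
  edge set it means that \<open>M\<close> induces the largest possible number of edges.\<close>

definition tight_set :: "real \<Rightarrow> 'v set set \<Rightarrow> 'v set \<Rightarrow> bool" where
  "tight_set q E M \<longleftrightarrow> finite M \<and> 2 \<le> card M \<and> 2 * card M \<le> card (induced E M) + motion_dim q"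

lemma motion_dim_bounds: "2 \<le> motion_dim q" "motion_dim q \<le> 3"
  by (simp_all add: motion_dim_def)

lemma finite_induced: "finite E \<Longrightarrow> finite (induced E M)"
  by (simp add: induced_def)

lemma sparse_mono:
  assumes "sparse_edges q E" "F \<subseteq> E" "finite E"
  shows "sparse_edges q F"
proof -
  have "card (induced F M) \<le> card (induced E M)" for M
    using assms(2,3) by (intro card_mono finite_induced) (auto simp: induced_def)
  then show ?thesis using assms(1) unfolding sparse_edges_def by (meson add_le_mono1 le_trans)
qed

lemma induced_empty:
  assumes "E \<subseteq> pairs UNIV" "card M < 2" "finite M"
  shows "induced E M = {}"
proof -
  have "\<not> e \<subseteq> M" if "e \<in> E" for e
  proof
    assume "e \<subseteq> M"
    have "e \<in> pairs UNIV" using that assms(1) by blast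
    then obtain v w where "e = {v, w}" "v \<noteq> w" by (rule pairsE)
    then have "2 \<le> card M" using card_mono[OF assms(3) \<open>e \<subseteq> M\<close>] by simp
    then show False using assms(2) by simp
  qed
  then show ?thesis by (auto simp: induced_def)
qed

lemma induced_restrict: "E \<subseteq> pairs W \<Longrightarrow> induced E (M \<inter> W) = induced E M"
  using pairs_imp_subset by (fastforce simp: induced_def)

text \<open>For \<open>motion_dim q = 2\<close> the bound extends to sets of size one, for \<open>motion_dim q = 3\<close> it does
  not; the hypothesis on the size of \<open>M\<close> covers both cases.\<close>

lemma sparse_card_intersection:
  assumes "sparse_edges q E" "E \<subseteq> pairs UNIV" "finite M" "motion_dim q \<le> card M + 1"
  shows "card (induced E M) + motion_dim q \<le> 2 * card M"
proof (cases "2 \<le> card M")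
  case False
  then have "card M = 1" "motion_dim q = 2"
    using assms(4) motion_dim_bounds(1)[of q] by linarith+
  then show ?thesis using induced_empty[OF assms(2)] assms(3) by simp
qed (use assms in \<open>simp add: sparse_edges_def\<close>)

text \<open>The number of induced edges is supermodular in the vertex set.\<close>

lemma tight_union:
  assumes E: "sparse_edges q E" "E \<subseteq> pairs UNIV" "finite E" and A: "tight_set q E A" and B: "tight_set q E B"
    and AB: "motion_dim q \<le> card (A \<inter> B) + 1"
  shows "tight_set q E (A \<union> B)"
proof -
  have fin: "finite A" "finite B" using A B by (auto simp: tight_set_def)
  have "card (induced E A) + card (induced E B) =
      card (induced E A \<union> induced E B) + card (induced E A \<inter> induced E B)"
    by (intro card_Un_Int finite_induced E)
  also have "induced E A \<inter> induced E B = induced E (A \<inter> B)"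
    by (auto simp: induced_def)
  also have "card (induced E A \<union> induced E B) \<le> card (induced E (A \<union> B))"
    by (intro card_mono finite_induced E) (auto simp: induced_def)
  finally have 1: "card (induced E A) + card (induced E B) \<le>
      card (induced E (A \<union> B)) + card (induced E (A \<inter> B))" by simp
  have 2: "card (induced E (A \<inter> B)) + motion_dim q \<le> 2 * card (A \<inter> B)"
    using sparse_card_intersection[OF E(1,2) _ AB] fin by simp
  have 3: "card A + card B = card (A \<union> B) + card (A \<inter> B)"
    using fin by (rule card_Un_Int)
  have "card A \<le> card (A \<union> B)" using fin by (intro card_mono) auto
  then show ?thesis using A B 1 2 3 fin unfolding tight_set_def by auto
qed

lemma two_le_card: "finite M \<Longrightarrow> a \<in> M \<Longrightarrow> b \<in> M \<Longrightarrow> a \<noteq> b \<Longrightarrow> 2 \<le> card M"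
  using card_mono[of M "{a, b}"] by simp

text \<open>Three rigid bodies that are pairwise joined at the vertices of a triangle form a rigid
  body.  If two of them share at least two vertices, the union lemma applies twice.  Otherwise each pair
  shares exactly one vertex and the counts add up: the three common vertices
  remove six degrees of freedom, which for \<open>motion_dim q = 3\<close> leaves three out of nine.\<close>

lemma tight_triangle:
  assumes E: "sparse_edges q E" "E \<subseteq> pairs UNIV" "finite E"
    and A: "tight_set q E A" "x \<in> A" "y \<in> A" and B: "tight_set q E B" "y \<in> B" "z \<in> B"
    and C: "tight_set q E C" "x \<in> C" "z \<in> C" and xyz: "x \<noteq> y" "y \<noteq> z" "x \<noteq> z"
  shows "tight_set q E (A \<union> B \<union> C)"
proof -
  have fin: "finite A" "finite B" "finite C" using A B C by (auto simp: tight_set_def)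
  have two: "tight_set q E (S \<union> T)" if "tight_set q E S" "tight_set q E T" "2 \<le> card (S \<inter> T)" for S T
    using tight_union[OF E that(1,2)] that(3) motion_dim_bounds(2)[of q] by simp
  consider "2 \<le> card (A \<inter> B)" | "2 \<le> card (B \<inter> C)" | "2 \<le> card (A \<inter> C)"
    | "\<not> 2 \<le> card (A \<inter> B)" "\<not> 2 \<le> card (B \<inter> C)" "\<not> 2 \<le> card (A \<inter> C)" by blast
  then show ?thesis
  proof cases
    case 1
    have "2 \<le> card ((A \<union> B) \<inter> C)" using two_le_card[of _ x z] fin A B C xyz by simp
    then show ?thesis using two[OF two[OF A(1) B(1) 1] C(1)] by blast
  next
    case 2
    have "2 \<le> card ((B \<union> C) \<inter> A)" using two_le_card[of _ x y] fin A B C xyz by simp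
    from two[OF two[OF B(1) C(1) 2] A(1) this] show ?thesis by (simp add: Un_ac)
  next
    case 3
    have "2 \<le> card ((A \<union> C) \<inter> B)" using two_le_card[of _ y z] fin A B C xyz by simp
    from two[OF two[OF A(1) C(1) 3] B(1) this] show ?thesis by (simp add: Un_ac)
  next
    case 4
    have AB: "A \<inter> B = {y}" using two_le_card[of "A \<inter> B" y] 4 fin A B by blast
    have BC: "B \<inter> C = {z}" using two_le_card[of "B \<inter> C" z] 4 fin B C by blast
    have AC: "A \<inter> C = {x}" using two_le_card[of "A \<inter> C" x] 4 fin A C by blast
    have "induced E S \<inter> induced E T = {}" if "S \<inter> T = {a}" for S T a
    proof -
      have "induced E S \<inter> induced E T = induced E (S \<inter> T)" by (auto simp: induced_def)
      then show ?thesis using induced_empty[OF E(2), of "{a}"] that by simp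
    qed
    then have dj: "induced E A \<inter> induced E B = {}" "(induced E A \<union> induced E B) \<inter> induced E C = {}"
      using AB BC AC by blast+
    have "card (induced E A) + card (induced E B) + card (induced E C) =
        card (induced E A \<union> induced E B \<union> induced E C)"
      using dj E(3) by (simp add: card_Un_disjoint finite_induced)
    also have "\<dots> \<le> card (induced E (A \<union> B \<union> C))"
      by (intro card_mono finite_induced E) (auto simp: induced_def)
    finally have 1: "card (induced E A) + card (induced E B) + card (induced E C) \<le>
        card (induced E (A \<union> B \<union> C))" .
    have ABC: "(A \<union> B) \<inter> C = {x, z}" using AC BC by blast
    have 2: "card A + card B = card (A \<union> B) + 1"
      using card_Un_Int[OF fin(1,2)] AB by simp
    have "card (A \<union> B) + card C = card (A \<union> B \<union> C) + card ((A \<union> B) \<inter> C)"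
      using fin by (intro card_Un_Int) auto
    then have 3: "card (A \<union> B) + card C = card (A \<union> B \<union> C) + 2"
      using ABC xyz by simp
    have "2 \<le> card (A \<union> B \<union> C)" using two_le_card[of _ x y] fin A xyz by simp
    then show ?thesis using A(1) B(1) C(1) 1 2 3 fin motion_dim_bounds(2)[of q]
      unfolding tight_set_def by auto
  qed
qed

lemma tight_insert:
  assumes M: "tight_set q E M" and w: "w \<notin> M" and fin: "finite E"
    and N: "N \<subseteq> nbrs E w \<inter> M" "2 \<le> card N"
  shows "tight_set q E (insert w M)" and "card (induced E M) + card N \<le> card (induced E (insert w M))"
proof -
  have finM: "finite M" using M by (simp add: tight_set_def)
  then have finN: "finite N" using N finite_subset by blast
  have inj: "inj_on (\<lambda>u. {w, u}) N" by (rule inj_on_doubleton)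
  have "induced E M \<inter> (\<lambda>u. {w, u}) ` N = {}" using w by (auto simp: induced_def)
  then have "card (induced E M) + card N = card (induced E M \<union> (\<lambda>u. {w, u}) ` N)"
    using finN fin inj by (simp add: card_Un_disjoint finite_induced card_image)
  also have "\<dots> \<le> card (induced E (insert w M))"
    using N by (intro card_mono finite_induced fin) (auto simp: induced_def nbrs_def)
  finally show *: "card (induced E M) + card N \<le> card (induced E (insert w M))" .
  then show "tight_set q E (insert w M)"
    using M N(2) w finM by (simp add: tight_set_def)
qed

text \<open>A set that violates the count only after the pair \<open>{x, y}\<close> has been added contains \<open>x\<close>
  and \<open>y\<close> and was tight before.\<close>

lemma tight_if_not_sparse_insert:
  assumes E: "sparse_edges q E" "E \<subseteq> pairs W" "finite E" and xy: "x \<in> W" "y \<in> W" "x \<noteq> y"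
    and ns: "\<not> sparse_edges q (insert {x, y} E)"
  obtains M where "tight_set q E M" "M \<subseteq> W" "x \<in> M" "y \<in> M"
proof -
  let ?E = "insert {x, y} E"
  obtain N where N: "finite N" "2 \<le> card N" "\<not> card (induced ?E N) + motion_dim q \<le> 2 * card N"
    using ns by (auto simp: sparse_edges_def)
  have sp: "card (induced E N) + motion_dim q \<le> 2 * card N"
    using E(1) N by (simp add: sparse_edges_def)
  have xyN: "x \<in> N" "y \<in> N"
  proof -
    have "{x, y} \<subseteq> N"
    proof (rule ccontr)
      assume "\<not> {x, y} \<subseteq> N"
      then have "induced ?E N = induced E N" by (auto simp: induced_def)
      then show False using sp N by simp
    qed
    then show "x \<in> N" "y \<in> N" by auto
  qed
  have "induced ?E N \<subseteq> insert {x, y} (induced E N)" by (auto simp: induced_def)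
  then have "card (induced ?E N) \<le> Suc (card (induced E N))"
    using card_mono[of "insert {x, y} (induced E N)" "induced ?E N"] finite_induced[OF E(3), of N]
    by (simp add: card_insert_if split: if_splits)
  then have "2 * card N \<le> card (induced E N) + motion_dim q" using N(3) by simp
  moreover have "card (N \<inter> W) \<le> card N" using N(1) by (intro card_mono) auto
  ultimately have "tight_set q E (N \<inter> W)"
    using N(1) xyN xy two_le_card[of "N \<inter> W" x y] induced_restrict[OF E(2)]
    by (simp add: tight_set_def)
  then show thesis using xyN xy that by blast
qed

lemma sum_degrees:
  assumes "finite W" "E \<subseteq> pairs W"
  shows "(\<Sum>v\<in>W. card (nbrs E v)) = 2 * card E"
proof -
  have fin: "finite E" using finite_subset[OF assms(2) finite_pairs[OF assms(1)]] .
  have E: "E \<subseteq> pairs UNIV" using assms(2) pairs_mono[of W UNIV] by blast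
  have "card (nbrs E v) = (\<Sum>e | e \<in> E \<and> v \<in> e. 1)" for v
    using sum_incident_edges[OF fin E, where v = v and h = "\<lambda>_. 1 :: nat"] by simp
  then have "(\<Sum>v\<in>W. card (nbrs E v)) = (\<Sum>e\<in>E. \<Sum>v | v \<in> W \<and> v \<in> e. 1)"
    by (simp only: sum.swap_restrict[OF assms(1) fin])
  also have "\<dots> = (\<Sum>e\<in>E. 2)"
  proof (intro sum.cong refl)
    fix e assume "e \<in> E"
    then have "e \<in> pairs W" using assms(2) by blast
    then obtain v w where "e = {v, w}" "v \<in> W" "w \<in> W" "v \<noteq> w" by (rule pairsE)
    moreover from this have "{u. u \<in> W \<and> u \<in> e} = {v, w}" by auto
    ultimately show "(\<Sum>v | v \<in> W \<and> v \<in> e. 1) = (2 :: nat)" by simp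
  qed
  finally show ?thesis by simp
qed

section \<open>Sparse edge sets are independent in generic placements\<close>

text \<open>These two properties are all that is used of genericity; the second reduces
  independence at \<open>p\<close> to independence in a special position.\<close>

locale generic_plane_placement =
  fixes q :: real and p :: "'v \<Rightarrow> real ^ 2" and V :: "'v set"
  assumes q: "1 < q" and inj: "inj_on p V"
    and generic: "\<And>E x. finite E \<Longrightarrow> E \<subseteq> pairs V \<Longrightarrow> (\<And>v w. {v, w} \<in> E \<Longrightarrow> x v \<noteq> x w) \<Longrightarrow>
      stress_free q (x :: 'v \<Rightarrow> real ^ 2) E \<Longrightarrow> stress_free q p E"
begin

lemma general_position: "general_position p V"
  unfolding general_position_def
proof (intro ballI impI notI)
  fix a b c assume abc: "a \<in> V" "b \<in> V" "c \<in> V" "a \<noteq> b \<and> b \<noteq> c \<and> a \<noteq> c"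
    and det: "det2 (p a - p c) (p b - p c) = 0"
  define x :: "'v \<Rightarrow> real ^ 2"
    where "x v = (if v = a then 0 else if v = b then vector [1, 0] else vector [0, 1])" for v
  have xi: "inj_on x {a, b, c}"
    using abc by (auto simp: inj_on_def x_def vec_eq_iff forall_2)
  have "x v \<noteq> x w" if "{v, w} \<in> pairs {a, b, c}" for v w
    using that[unfolded doubleton_in_pairs] inj_onD[OF xi, of v w] by blast
  moreover have "stress_free q x (pairs {a, b, c})"
    using abc by (intro right_triangle_stress_free) (auto simp: x_def)
  ultimately have "stress_free q p (pairs {a, b, c})"
    using abc by (intro generic[of _ x] finite_pairs pairs_mono) auto
  moreover have "inj_on p {a, b, c}"
    by (rule inj_on_subset[OF inj]) (use abc in auto)
  ultimately show False
    using collinear_triangle_stressed[of a b c p q] det abc by simp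
qed

lemma K4_generic_stress_free:
  assumes "q \<noteq> 2" and abcd: "{a, b, c, d} \<subseteq> V" "a \<noteq> b" "a \<noteq> c" "a \<noteq> d" "b \<noteq> c" "b \<noteq> d" "c \<noteq> d"
  shows "stress_free q p (pairs {a, b, c, d})"
proof -
  define x :: "'v \<Rightarrow> real ^ 2"
    where "x v = (if v = a then 0 else if v = b then vector [1, 0]
      else if v = c then vector [1, 1] else vector [2, 1])" for v
  have xi: "inj_on x {a, b, c, d}"
    using abcd by (auto simp: inj_on_def x_def vec_eq_iff forall_2)
  have "x v \<noteq> x w" if "{v, w} \<in> pairs {a, b, c, d}" for v w
    using that[unfolded doubleton_in_pairs] inj_onD[OF xi, of v w] by blast
  moreover have "stress_free q x (pairs {a, b, c, d})"
    using abcd assms(1) by (intro K4_stress_free) (auto simp: x_def)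
  ultimately show ?thesis
    using abcd by (intro generic[of _ x] finite_pairs pairs_mono) auto
qed

lemma noncollinear_signed_power:
  assumes "a \<in> V" "b \<in> V" "c \<in> V" "a \<noteq> b" "b \<noteq> c" "a \<noteq> c"
  shows "det2 (signed_power (q - 1) (p a - p b)) (signed_power (q - 1) (p a - p c)) \<noteq> 0"
proof -
  have "det2 (p b - p a) (p c - p a) \<noteq> 0"
    using general_position assms by (auto simp: general_position_def)
  then have "det2 (p a - p b) (p a - p c) \<noteq> 0" by (simp add: det2_def algebra_simps)
  then show ?thesis using q by (simp add: det2_signed_power_eq_0_iff)
qed

text \<open>At most two bars meet at \<open>v\<close>, in independent directions, so equilibrium at \<open>v\<close> makes
  their stresses vanish.\<close>

lemma low_degree_extension_stress_free:
  assumes fin: "finite E" and E: "E \<subseteq> pairs V" and sf: "stress_free q p {e \<in> E. v \<notin> e}"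
    and deg: "card (nbrs E v) \<le> 2"
  shows "stress_free q p E"
  unfolding stress_free_def
proof (intro allI impI)
  have E': "E \<subseteq> pairs UNIV" using E pairs_mono[of V UNIV] by blast
  fix \<omega> assume \<omega>: "stress q p E \<omega>"
  let ?f = "signed_power (q - 1) :: real ^ 2 \<Rightarrow> _"
  have s: "(\<Sum>w\<in>nbrs E v. \<omega> {v, w} *\<^sub>R ?f (p v - p w)) = 0"
    using \<omega> by (simp add: stress_def)
  have nb: "w \<in> V" "v \<in> V" "w \<noteq> v" if "w \<in> nbrs E v" for w
    using nbrs_irrefl[OF E that] by auto
  have "card (nbrs E v) = 0 \<or> card (nbrs E v) = 1 \<or> card (nbrs E v) = 2" using deg by linarith
  then have at_v: "\<omega> {v, w} = 0" if "w \<in> nbrs E v" for w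
  proof (elim disjE)
    assume "card (nbrs E v) = 0"
    then show ?thesis using that finite_nbrs[OF fin] by simp
  next
    assume "card (nbrs E v) = 1"
    then obtain a where "nbrs E v = {a}" by (auto simp: card_1_singleton_iff)
    moreover have "p v \<noteq> p w" using nb[OF that] inj by (auto dest: inj_onD)
    ultimately show ?thesis using that s by simp
  next
    assume "card (nbrs E v) = 2"
    then obtain a b where ab: "nbrs E v = {a, b}" "a \<noteq> b" by (auto simp: card_2_iff)
    then have "det2 (?f (p v - p a)) (?f (p v - p b)) \<noteq> 0"
      using nb[of a] nb[of b] by (intro noncollinear_signed_power) auto
    moreover have "\<omega> {v, a} *\<^sub>R ?f (p v - p a) + \<omega> {v, b} *\<^sub>R ?f (p v - p b) = 0"
      using s ab by simp
    ultimately have "\<omega> {v, a} = 0" "\<omega> {v, b} = 0" using det2_independent by blast+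
    then show ?thesis using that ab by auto
  qed
  have inc: "\<omega> e = 0" if "e \<in> E" "v \<in> e" for e
  proof -
    obtain w where "e = {v, w}" "w \<in> nbrs E v" 
        using incident_edgeE[OF E' \<open>e \<in> E\<close> \<open>v \<in> e\<close>] by blast
    then show ?thesis using at_v by simp
  qed
  let ?E0 = "{e \<in> E. v \<notin> e}"
  have E0: "finite ?E0" "?E0 \<subseteq> pairs UNIV" using fin E' by auto
  have "(\<Sum>e\<in>?E0. \<omega> e * rigidity_matrix q p e (u, i)) = (\<Sum>e\<in>E. \<omega> e * rigidity_matrix q p e (u, i))" for u i
    using fin inc by (intro sum.mono_neutral_left) auto
  then have "stress q p ?E0 \<omega>"
    using \<omega> by (simp add: stress_iff_rows[OF E0] stress_iff_rows[OF fin E'])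
  then have "\<forall>e\<in>?E0. \<omega> e = 0" using sf unfolding stress_free_def by blast
  then show "\<forall>e\<in>E. \<omega> e = 0" using inc by blast
qed

text \<open>Apply \<open>stress_free_count\<close> to the part of \<open>M\<close> in \<open>V\<close>; if it has fewer than two vertices,
  no edge is induced.\<close>

lemma stress_free_imp_sparse:
  assumes "finite E" "E \<subseteq> pairs V" "stress_free q p E"
  shows "sparse_edges q E"
  unfolding sparse_edges_def
proof (intro allI impI)
  fix M :: "'v set" assume M: "finite M" "2 \<le> card M"
  have E: "E \<subseteq> pairs UNIV" using assms(2) pairs_mono[of V UNIV] by blast
  have I: "induced E M = induced E (M \<inter> V)" using induced_restrict[OF assms(2)] by simp
  have le: "card (M \<inter> V) \<le> card M" using M(1) by (intro card_mono) auto
  show "card (induced E M) + motion_dim q \<le> 2 * card M"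
  proof (cases "2 \<le> card (M \<inter> V)")
    case True
    have "general_position p (M \<inter> V)" using general_position by (auto simp: general_position_def)
    moreover have "inj_on p (M \<inter> V)" using inj by (rule inj_on_subset) auto
    moreover have "induced E (M \<inter> V) \<subseteq> pairs (M \<inter> V)"
      using E mem_pairs_iff[of _ "M \<inter> V"] by (auto simp: induced_def)
    moreover have "stress_free q p (induced E (M \<inter> V))"
      using assms(3) by (rule stress_free_mono) (use assms E in \<open>auto simp: induced_def\<close>)
    ultimately have "card (induced E (M \<inter> V)) + motion_dim q \<le> 2 * card (M \<inter> V)"
      using M(1) True by (intro stress_free_count[of p]) auto
    then show ?thesis using I le by simp
  next
    case False
    then have "induced E M = {}" using I induced_empty[OF E, of "M \<inter> V"] M(1) by simp
    then show ?thesis using M motion_dim_bounds(2)[of q] by simp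
  qed
qed

text \<open>The midpoint of \<open>x\<close> and \<open>y\<close> may coincide with other vertices.  Such coincidences are allowed,
  since only the end points of an edge need distinct positions, and the neighbours \<open>x\<close>, \<open>y\<close>, \<open>z\<close> of \<open>v\<close> are off
  the midpoint.\<close>

lemma one_extension_generic:
  assumes fin: "finite E" and E: "E \<subseteq> pairs V" and N: "nbrs E v = {x, y, z}"
    and xyz: "x \<noteq> y" "y \<noteq> z" "x \<noteq> z"
    and sf: "stress_free q p (insert {x, y} {e \<in> E. v \<notin> e})" and xy: "{x, y} \<notin> E"
  shows "stress_free q p E"
proof -
  let ?E0 = "{e \<in> E. v \<notin> e}" and ?m = "(1 / 2) *\<^sub>R (p x + p y)"
  have E': "E \<subseteq> pairs UNIV" using E pairs_mono[of V UNIV] by blast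
  have nb: "x \<in> V" "y \<in> V" "z \<in> V" "v \<in> V" "x \<noteq> v" "y \<noteq> v" "z \<noteq> v"
    using nbrs_irrefl[OF E, of _ v] N by auto
  have EE: "E = ?E0 \<union> {{v, x}, {v, y}, {v, z}}"
  proof -
    have "e \<in> {{v, x}, {v, y}, {v, z}}" if "e \<in> E" "v \<in> e" for e
    proof -
      obtain w where "e = {v, w}" "w \<in> nbrs E v" 
        using incident_edgeE[OF E' \<open>e \<in> E\<close> \<open>v \<in> e\<close>] by blast
      then show ?thesis using N by auto
    qed
    moreover have "{v, x} \<in> E" "{v, y} \<in> E" "{v, z} \<in> E" using N by (auto simp: nbrs_def)
    ultimately show ?thesis by blast
  qed
  have det: "det2 (p x - p z) (p y - p z) \<noteq> 0"
    using general_position nb xyz by (auto simp: general_position_def)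
  have sfx: "stress_free q (p(v := ?m)) E"
  proof (subst EE, rule one_extension_stress_free[OF q])
    show "finite ?E0" "?E0 \<subseteq> pairs UNIV" "v \<notin> \<Union>?E0" using fin E' by auto
    show "v \<notin> {x, y, z}" "{x, y} \<notin> ?E0" using nb xy by auto
  qed (use xyz det sf in auto)
  have "p x \<noteq> p y" using inj nb xyz by (auto dest: inj_onD)
  then have mx: "?m \<noteq> p x" "?m \<noteq> p y"
    by (auto simp: vec_eq_iff forall_2)
  have mz: "?m \<noteq> p z"
  proof
    assume "?m = p z"
    then have "p x - p z = - (p y - p z)"
      by (auto simp: vec_eq_iff forall_2 field_simps)
    then have "det2 (p x - p z) (p y - p z) = det2 (- (p y - p z)) (p y - p z)" by (rule arg_cong)
    moreover have "det2 (- u) u = 0" for u by (simp add: det2_def)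
    ultimately show False using det by metis
  qed
  show ?thesis
  proof (rule generic[OF fin E _ sfx])
    fix a b assume ab: "{a, b} \<in> E"
    then have "{a, b} \<in> pairs V" using E by blast
    then have abV: "a \<in> V" "b \<in> V" "a \<noteq> b" by simp_all
    then have pab: "p a \<noteq> p b" using inj by (auto dest: inj_onD)
    have "a \<in> {x, y, z}" if "b = v" using ab that N by (auto simp: nbrs_def insert_commute)
    moreover have "b \<in> {x, y, z}" if "a = v" using ab that N by (auto simp: nbrs_def)
    ultimately show "(p(v := ?m)) a \<noteq> (p(v := ?m)) b"
      using pab abV(3) mx mz by (auto simp del: scaleR_add_right)
  qed
qed

text \<open>Contracting \<open>M\<close> keeps the graph simple because a vertex outside has at most one
  neighbour in \<open>M\<close>.  It keeps it sparse: a set that violates the count and contains \<open>k\<close> lifts to a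
  violating set that contains \<open>M\<close>, by tightness of \<open>M\<close>.  So the induction hypothesis \<open>IH\<close> applies to the
  contracted graph and to the part inside \<open>M\<close>.\<close>

lemma contraction_generic:
  assumes W: "finite W" "W \<subseteq> V" and E: "E \<subseteq> pairs W" and M: "M \<subseteq> W" "k \<in> M"
    and nb: "\<And>w a b. w \<in> W - M \<Longrightarrow> a \<in> nbrs E w \<inter> M \<Longrightarrow> b \<in> nbrs E w \<inter> M \<Longrightarrow> a = b"
    and q2: "q \<noteq> 2" and sp: "sparse_edges q E" and tight: "tight_set q E M"
    and IH: "\<And>F U. U \<subseteq> W \<Longrightarrow> card U < card W \<Longrightarrow> F \<subseteq> pairs U \<Longrightarrow> sparse_edges q F \<Longrightarrow> stress_free q p F"
    and ne: "M \<noteq> W"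
  shows "stress_free q p E"
proof -
  let ?\<kappa> = "contract M k"
  define EO where "EO = {e \<in> E. \<not> e \<subseteq> M}"
  have md: "motion_dim q = 2" using q2 by (simp add: motion_dim_def)
  have fin: "finite E" using finite_subset[OF E finite_pairs[OF W(1)]] .
  have finM: "finite M" using M(1) W(1) finite_subset by blast
  have EO: "\<exists>a b. e = {a, b} \<and> b \<in> W - M \<and> a \<in> W \<and> a \<noteq> b" if "e \<in> EO" for e
  proof -
    have "e \<in> pairs W" using that E by (auto simp: EO_def)
    then obtain a b where e: "e = {a, b}" "a \<in> W" "b \<in> W" "a \<noteq> b" by (rule pairsE)
    show ?thesis
    proof (cases "b \<in> M")
      case True
      then have "a \<notin> M" using that e by (simp add: EO_def)
      then show ?thesis using e by (intro exI[of _ b] exI[of _ a]) auto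
    qed (use e in blast)
  qed
  have \<kappa>: "?\<kappa> v = k" if "v \<in> M" for v using that by (simp add: contract_def)
  have \<kappa>': "?\<kappa> v = v" if "v \<notin> M" for v using that by (simp add: contract_def)
  have recover: "(a \<in> M \<and> a' \<in> M \<or> a = a') \<and> b = b' \<or> a = b' \<and> b = a'"
    if "{?\<kappa> a, ?\<kappa> b} = {?\<kappa> a', ?\<kappa> b'}" "b \<notin> M" "b' \<notin> M" for a b a' b'
    using that M(2) by (auto simp: contract_def doubleton_eq_iff split: if_splits)
  have injEO: "inj_on ((`) ?\<kappa>) EO"
  proof (rule inj_onI)
    fix e e' assume e: "e \<in> EO" "e' \<in> EO" "?\<kappa> ` e = ?\<kappa> ` e'"
    obtain a b where ab: "e = {a, b}" "b \<in> W - M" using EO[OF e(1)] by blast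
    obtain a' b' where ab': "e' = {a', b'}" "b' \<in> W - M" using EO[OF e(2)] by blast
    have "{?\<kappa> a, ?\<kappa> b} = {?\<kappa> a', ?\<kappa> b'}" using e(3) ab ab' by simp
    from recover[OF this] ab ab' consider "a \<in> M" "a' \<in> M" "b = b'" | "a = a'" "b = b'" | "a = b'" "b = a'"
      by blast
    then show "e = e'"
    proof cases
      case 1
      have "a \<in> nbrs E b \<inter> M" "a' \<in> nbrs E b \<inter> M"
        using e ab ab' 1 by (auto simp: EO_def nbrs_def insert_commute)
      then show ?thesis using nb[OF ab(2)] ab ab' 1 by blast
    qed (use ab ab' in auto)
  qed
  let ?U = "insert k (W - M)" and ?E' = "(`) ?\<kappa> ` EO"
  have E': "?E' \<subseteq> pairs ?U"
  proof (rule image_subsetI)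
    fix e assume "e \<in> EO"
    then obtain a b where ab: "e = {a, b}" "b \<in> W - M" "a \<in> W" "a \<noteq> b" using EO by blast
    then have "?\<kappa> b = b" "?\<kappa> a \<noteq> b" "?\<kappa> a \<in> ?U"
      using \<kappa>[of a] \<kappa>'[of a] \<kappa>'[of b] M(2) by (cases "a \<in> M"; force)+
    then show "?\<kappa> ` e \<in> pairs ?U" using ab by simp
  qed
  have cardU: "card ?U < card W"
  proof -
    have "card ?U = Suc (card W - card M)"
      using M W(1) finM by (simp add: card_Diff_subset)
    moreover have "card M \<le> card W" using M(1) W(1) by (rule card_mono[rotated])
    moreover have "2 \<le> card M" using tight by (simp add: tight_set_def)
    ultimately show ?thesis by arith
  qed
  have "sparse_edges q ?E'"
    unfolding sparse_edges_def
  proof (intro allI impI, rule ccontr)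
    fix N assume N: "finite N" "2 \<le> card N" and viol: "\<not> card (induced ?E' N) + motion_dim q \<le> 2 * card N"
    have "induced ?E' N = (`) ?\<kappa> ` {e \<in> EO. ?\<kappa> ` e \<subseteq> N}" by (auto simp: induced_def)
    then have lift: "card (induced ?E' N) = card {e \<in> EO. ?\<kappa> ` e \<subseteq> N}"
      using injEO by (simp add: card_image inj_on_def)
    show False
    proof (cases "k \<in> N")
      case False
      have "v \<in> N" if "?\<kappa> v \<in> N" for v
        using that False \<kappa>[of v] \<kappa>'[of v] by (cases "v \<in> M") auto
      then have "{e \<in> EO. ?\<kappa> ` e \<subseteq> N} \<subseteq> induced E N"
        unfolding EO_def induced_def by blast
      then have "card (induced ?E' N) \<le> card (induced E N)"
        unfolding lift by (intro card_mono finite_induced fin)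
      then show False using sp N viol unfolding sparse_edges_def by (meson add_le_mono1 le_trans)
    next
      case True
      let ?X = "{e \<in> EO. ?\<kappa> ` e \<subseteq> N}"
      have "v \<in> M \<union> N" if "?\<kappa> v \<in> N" for v
        using that \<kappa>'[of v] by (cases "v \<in> M") auto
      then have "?X \<subseteq> induced E (M \<union> N)"
        unfolding EO_def induced_def by blast
      moreover have "induced E M \<subseteq> induced E (M \<union> N)" by (auto simp: induced_def)
      moreover have "induced E M \<inter> ?X = {}" by (auto simp: induced_def EO_def)
      moreover have "finite ?X" using fin by (simp add: EO_def)
      ultimately have 1: "card (induced E M) + card ?X \<le> card (induced E (M \<union> N))"
        using card_mono[OF finite_induced[OF fin], of "induced E M \<union> ?X" "M \<union> N"] fin
        by (simp add: card_Un_disjoint finite_induced)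
      have "card M + card N = card (M \<union> N) + card (M \<inter> N)"
        using finM N(1) by (rule card_Un_Int)
      moreover have "0 < card (M \<inter> N)" using True M(2) finM by (auto simp: card_gt_0_iff)
      ultimately have 2: "card (M \<union> N) + 1 \<le> card M + card N" by linarith
      have "2 \<le> card (M \<union> N)" using N card_mono[of "M \<union> N" N] finM by simp
      then have "card (induced E (M \<union> N)) + motion_dim q \<le> 2 * card (M \<union> N)"
        using sp finM N(1) by (simp add: sparse_edges_def)
      then show False using 1 2 viol lift tight md by (simp add: tight_set_def)
    qed
  qed
  then have sfO: "stress_free q p ?E'"
    using M by (intro IH[OF _ cardU E']) auto
  have "card M < card W" using M(1) ne W(1) by (intro psubset_card_mono) auto
  moreover have "{e \<in> E. e \<subseteq> M} \<subseteq> pairs M" 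
    using E pairs_mono[of W UNIV] mem_pairs_iff[of _ M] by auto
  ultimately have sfM: "stress_free q p {e \<in> E. e \<subseteq> M}"
    by (rule IH[OF M(1)]) (rule sparse_mono[OF sp _ fin], auto)
  have "inj_on p W" using inj W(2) by (rule inj_on_subset)
  from contraction_stress_free[OF q W(1) this E M injEO[unfolded EO_def] sfM sfO[unfolded EO_def]]
  obtain x :: "'v \<Rightarrow> real ^ 2" where x: "inj_on x W" "stress_free q x E" by blast
  show ?thesis
  proof (rule generic[OF fin _ _ x(2)])
    show "E \<subseteq> pairs V" using E pairs_mono[OF W(2)] by blast
    fix v w assume "{v, w} \<in> E"
    then have "{v, w} \<in> pairs W" using E by blast
    then have "v \<in> W" "w \<in> W" "v \<noteq> w" by simp_all
    then show "x v \<noteq> x w" using x(1) by (auto dest: inj_onD)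
  qed
qed

text \<open>The theorem of Laman type, by the induction sketched at the beginning.  A vertex of degree
  at most three exists since the average degree is less than four.\<close>

theorem sparse_imp_stress_free:
  assumes "finite W" "W \<subseteq> V" "E \<subseteq> pairs W" "sparse_edges q E"
  shows "stress_free q p E"
  using assms
proof (induction "card W" arbitrary: W E rule: less_induct)
  case less
  note W = less.prems(1,2) and E = less.prems(3) and sp = less.prems(4)
  have fin: "finite E" using finite_subset[OF E finite_pairs[OF W(1)]] .
  have EV: "E \<subseteq> pairs V" using E pairs_mono[OF W(2)] by blast
  have E': "E \<subseteq> pairs UNIV" using E pairs_mono[of W UNIV] by blast
  have IH: "stress_free q p F" if "U \<subseteq> W" "card U < card W" "F \<subseteq> pairs U" "sparse_edges q F" for F U
    using that W by (intro less.hyps[of U]) (auto intro: finite_subset)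
  have IHv: "stress_free q p F" if "v \<in> W" "F \<subseteq> pairs (W - {v})" "sparse_edges q F" for F v
  proof (rule IH[of "W - {v}"])
    show "card (W - {v}) < card W" using W(1) that(1) by (rule card_Diff1_less)
  qed (use that in auto)
  have E0: "{e \<in> E. v \<notin> e} \<subseteq> pairs (W - {v})" for v
  proof
    fix e assume "e \<in> {e \<in> E. v \<notin> e}"
    then show "e \<in> pairs (W - {v})" using E mem_pairs_iff[of e W] mem_pairs_iff[of e "W - {v}"] by auto
  qed
  have sp0: "sparse_edges q {e \<in> E. v \<notin> e}" for v by (rule sparse_mono[OF sp _ fin]) auto
  show ?case
  proof (cases "card W < 2 \<or> (\<exists>v\<in>W. card (nbrs E v) \<le> 2)")
    case True
    then show ?thesis
    proof
      assume "card W < 2"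
      then have "E = {}" using induced_empty[OF E' _ W(1)] E pairs_imp_subset by (force simp: induced_def)
      then show ?thesis by (simp add: stress_free_def)
    next
      assume "\<exists>v\<in>W. card (nbrs E v) \<le> 2"
      then obtain v where v: "v \<in> W" "card (nbrs E v) \<le> 2" by blast
      show ?thesis
        by (rule low_degree_extension_stress_free[OF fin EV IHv[OF v(1) E0 sp0] v(2)])
    qed
  next
    case False
    then have cW: "2 \<le> card W" and deg: "\<And>v. v \<in> W \<Longrightarrow> 3 \<le> card (nbrs E v)" by auto
    have "induced E W = E" using E pairs_imp_subset by (auto simp: induced_def)
    then have EW: "card E + motion_dim q \<le> 2 * card W" using sp W(1) cW by (auto simp: sparse_edges_def)
    have "\<exists>v\<in>W. card (nbrs E v) \<le> 3"
    proof (rule ccontr)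
      assume "\<not> ?thesis"
      then have "(\<Sum>v\<in>W. 4) \<le> (\<Sum>v\<in>W. card (nbrs E v))" by (intro sum_mono) auto
      then show False using sum_degrees[OF W(1) E] EW motion_dim_bounds(1)[of q] by simp
    qed
    then obtain v where v: "v \<in> W" "card (nbrs E v) = 3" using deg by (meson le_antisym)
    then obtain x y z where N: "nbrs E v = {x, y, z}" and xyz: "x \<noteq> y" "y \<noteq> z" "x \<noteq> z"
      by (auto simp: card_3_iff)
    have nbW: "w \<in> W - {v}" if "w \<in> nbrs E v" for w
      using nbrs_irrefl[OF E that] by simp
    then have nb: "x \<in> W - {v}" "y \<in> W - {v}" "z \<in> W - {v}"
      unfolding N by blast+
    let ?E0 = "{e \<in> E. v \<notin> e}"
    have pair: "stress_free q p E \<or> (\<exists>M. tight_set q E M \<and> M \<subseteq> W - {v} \<and> a \<in> M \<and> b \<in> M)"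
      if abc: "nbrs E v = {a, b, c}" "a \<noteq> b" "b \<noteq> c" "a \<noteq> c" "{a, b} \<notin> E" for a b c
    proof (cases "sparse_edges q (insert {a, b} ?E0)")
      case True
      have "a \<in> W - {v}" "b \<in> W - {v}" using nbW unfolding abc(1) by blast+
      then have "insert {a, b} ?E0 \<subseteq> pairs (W - {v})" using E0[of v] abc(2) by simp
      from IHv[OF v(1) this True] show ?thesis
        using one_extension_generic[OF fin EV abc(1-4) _ abc(5)] by blast
    next
      case False
      have ab: "a \<in> W - {v}" "b \<in> W - {v}" using nbW unfolding abc(1) by blast+
      have fin0: "finite ?E0" using fin by simp
      obtain M where M: "tight_set q ?E0 M" "M \<subseteq> W - {v}" "a \<in> M" "b \<in> M"
        using tight_if_not_sparse_insert[OF sp0 E0 fin0 ab abc(2) False] by blast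
      have "induced ?E0 M = induced E M" using M(2) by (auto simp: induced_def)
      then have "tight_set q E M" using M(1) by (simp add: tight_set_def)
      then show ?thesis using M by blast
    qed
    have Ns: "nbrs E v = {x, y, z}" "nbrs E v = {y, z, x}" "nbrs E v = {x, z, y}" using N by auto
    note pxy = pair[OF Ns(1) xyz] and pyz = pair[OF Ns(2) xyz(2) xyz(3)[symmetric] xyz(1)[symmetric]]
      and pxz = pair[OF Ns(3) xyz(3) xyz(2)[symmetric] xyz(1)]
    show ?thesis
    proof (cases "q = 2")
      case True
      then have md: "motion_dim q = 3" by (simp add: motion_dim_def)
      have edge: "tight_set q E {a, b}" if "{a, b} \<in> E" "a \<noteq> b" for a b
      proof -
        have "{{a, b}} \<subseteq> induced E {a, b}" using that by (auto simp: induced_def)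
        from card_mono[OF finite_induced[OF fin] this] show ?thesis
          using that(2) md by (simp add: tight_set_def)
      qed
      show ?thesis
      proof (rule ccontr)
        assume ns: "\<not> ?thesis"
        \<comment> \<open>an edge is itself tight; for a non-adjacent pair the failed extension gives a tight set\<close>
        obtain A where A: "tight_set q E A" "A \<subseteq> W - {v}" "x \<in> A" "y \<in> A"
          using pxy ns edge[of x y] xyz nb by (cases "{x, y} \<in> E") auto
        obtain B where B: "tight_set q E B" "B \<subseteq> W - {v}" "y \<in> B" "z \<in> B"
          using pyz ns edge[of y z] xyz nb by (cases "{y, z} \<in> E") auto
        obtain C where C: "tight_set q E C" "C \<subseteq> W - {v}" "x \<in> C" "z \<in> C"
          using pxz ns edge[of x z] xyz nb by (cases "{x, z} \<in> E") auto
        let ?U = "A \<union> B \<union> C"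
        have U: "tight_set q E ?U"
          using tight_triangle[OF sp E' fin A(1,3,4) B(1,3,4) C(1,3,4) xyz] .
        have vU: "v \<notin> ?U" using A B C by auto
        have "{x, y, z} \<subseteq> nbrs E v \<inter> ?U" using N A B by auto
        from tight_insert(2)[OF U vU fin this]
        have "card (induced E ?U) + 3 \<le> card (induced E (insert v ?U))" using xyz by simp
        moreover have finU: "finite ?U" using U by (simp add: tight_set_def)
        then have "card (induced E (insert v ?U)) + motion_dim q \<le> 2 * card (insert v ?U)"
          using sp U unfolding sparse_edges_def tight_set_def
          by (metis card_insert_le finite_insert le_trans)
        ultimately show False using U vU finU md by (simp add: tight_set_def)
      qed
    next
      case False
      then have md: "motion_dim q = 2" by (simp add: motion_dim_def)
      show ?thesis
      proof (rule ccontr)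
        assume ns: "\<not> ?thesis"
        have "\<exists>M. tight_set q E M \<and> M \<subset> W"
        proof (cases "{x, y} \<in> E \<and> {y, z} \<in> E \<and> {x, z} \<in> E")
          case True
          let ?K = "{v, x, y, z}"
          have sub: "pairs ?K \<subseteq> E"
          proof
            fix e assume "e \<in> pairs ?K"
            then obtain a b where ab: "e = {a, b}" "a \<in> ?K" "b \<in> ?K" "a \<noteq> b" by (rule pairsE)
            have "{v, x} \<in> E" "{v, y} \<in> E" "{v, z} \<in> E" using N by (auto simp: nbrs_def)
            then show "e \<in> E" using ab True by (auto simp: insert_commute)
          qed
          then have K: "induced E ?K = pairs ?K"
            using E' mem_pairs_iff[of _ ?K] by (fastforce simp: induced_def)
          have vn: "v \<noteq> x" "v \<noteq> y" "v \<noteq> z" using nb by auto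
          have "card ?K = 4" using vn xyz by simp
          moreover have "2 * card (pairs ?K) = (\<Sum>u\<in>?K. card (nbrs (pairs ?K) u))"
            by (rule sum_degrees[symmetric]) auto
          then have "card (pairs ?K) = 6" using vn xyz by (simp add: nbrs_pairs)
          ultimately have "tight_set q E ?K" using K md by (simp add: tight_set_def)
          moreover have "?K \<subseteq> W" using nb v by auto
          moreover have "?K \<noteq> W"
          proof
            assume "?K = W"
            then have "E = pairs ?K" using sub E by auto
            then show False using ns K4_generic_stress_free[OF False, of v x y z] vn xyz \<open>?K = W\<close> W(2) by simp
          qed
          ultimately show ?thesis by blast
        next
          case False
          then obtain M where "tight_set q E M" "M \<subseteq> W - {v}" using pxy pyz pxz ns by metis
          then show ?thesis using v(1) by blast
        qed
        then obtain M0 where M0: "tight_set q E M0 \<and> M0 \<subset> W" by blast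
        have "card M \<le> card W" if "tight_set q E M \<and> M \<subset> W" for M
          using that W(1) by (intro card_mono) auto
        then obtain M where M: "tight_set q E M" "M \<subset> W"
          and max: "\<And>M'. tight_set q E M' \<and> M' \<subset> W \<Longrightarrow> card M' \<le> card M"
          using ex_has_greatest_nat[of "\<lambda>M. tight_set q E M \<and> M \<subset> W" M0 card "Suc (card W)"] M0
          by (metis le_imp_less_Suc)
        have finM: "finite M" using M(1) by (simp add: tight_set_def)
        obtain k where k: "k \<in> M" using M(1) by (fastforce simp: tight_set_def)
        \<comment> \<open>a vertex with two neighbours in \<open>M\<close> could be added to \<open>M\<close>; by maximality it would be the last
          vertex, and its degree, at least three, would violate sparsity\<close>
        have unique: "a = b" if w: "w \<in> W - M" and ab: "a \<in> nbrs E w \<inter> M" "b \<in> nbrs E w \<inter> M" for w a b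
        proof (rule ccontr)
          assume "a \<noteq> b"
          have T: "tight_set q E (insert w M)"
            by (rule tight_insert(1)[OF M(1) _ fin, of _ "{a, b}"]) (use w ab \<open>a \<noteq> b\<close> in auto)
          have "insert w M = W"
          proof (rule ccontr)
            assume "insert w M \<noteq> W"
            then have "card (insert w M) \<le> card M" using T w M(2) by (intro max) auto
            then show False using w finM by simp
          qed
          moreover have "nbrs E w \<subseteq> W - {w}" using nbrs_irrefl[OF E, of _ w] by auto
          ultimately have "nbrs E w \<subseteq> nbrs E w \<inter> M" by auto
          moreover have d3: "3 \<le> card (nbrs E w)" using deg w by simp
          ultimately have "card (induced E M) + card (nbrs E w) \<le> card (induced E W)"
            using tight_insert(2)[OF M(1) _ fin, of w "nbrs E w"] w \<open>insert w M = W\<close> by simp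
          moreover have "card W = Suc (card M)" using \<open>insert w M = W\<close> w finM by force
          ultimately show False
            using EW d3 M(1) md \<open>induced E W = E\<close> by (simp add: tight_set_def)
        qed
        have "stress_free q p E"
        proof (rule contraction_generic[OF W E _ k _ False sp M(1)])
          show "M \<subseteq> W" "M \<noteq> W" using M(2) by auto
        qed (fact unique, fact IH)
        then show False using ns by simp
      qed
    qed
  qed
qed

end

section \<open>Gluing tight sets\<close>

lemma two_le_cardE:
  assumes "2 \<le> card M"
  obtains a b where "a \<in> M" "b \<in> M" "a \<noteq> b"
proof -
  obtain T where T: "T \<subseteq> M" "card T = 2" using ex_card[OF assms] by blast
  then obtain a b where "T = {a, b}" "a \<noteq> b" by (auto simp: card_2_iff)
  then show thesis using T that by blast
qed

lemma card_pairs: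
  assumes "finite Q"
  shows "2 * card (pairs Q) = card Q * (card Q - 1)"
proof -
  have "(\<Sum>v\<in>Q. card (nbrs (pairs Q) v)) = (\<Sum>v\<in>Q. card Q - 1)"
    using assms by (intro sum.cong) (auto simp: nbrs_pairs)
  then show ?thesis using sum_degrees[OF assms order_refl] by simp
qed

text \<open>Take a tight set that contains as many elements of \<open>S\<close> as possible.  If some \<open>s\<close> in \<open>S\<close> is
  missing, it can be enlarged: for \<open>q = 2\<close> by the triangle lemma applied to \<open>s\<close> and two elements of \<open>S\<close>
  in the set, for \<open>q \<noteq> 2\<close> either by a tight set that meets it, or because \<open>s\<close> is adjacent to those two
  elements.  For \<open>q \<noteq> 2\<close> a single edge is not tight; to start, one needs a pair of \<open>S\<close> outside \<open>B\<close> or four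
  elements of \<open>S\<close> that are mutually adjacent.\<close>

lemma tight_cover:
  assumes B: "sparse_edges q B" "B \<subseteq> pairs V" "finite B" and S: "finite S" "4 \<le> card S" "S \<subseteq> V"
    and pair: "\<And>a b. a \<in> S \<Longrightarrow> b \<in> S \<Longrightarrow> a \<noteq> b \<Longrightarrow> {a, b} \<notin> B \<Longrightarrow>
      \<exists>M. tight_set q B M \<and> M \<subseteq> V \<and> a \<in> M \<and> b \<in> M"
  obtains M where "tight_set q B M" "M \<subseteq> V" "S \<subseteq> M"
proof -
  have B': "B \<subseteq> pairs UNIV" using B(2) pairs_mono[of V UNIV] by blast
  have pair2: "\<exists>M. tight_set q B M \<and> M \<subseteq> V \<and> a \<in> M \<and> b \<in> M"
    if ab: "a \<in> S" "b \<in> S" "a \<noteq> b" and q2: "q = 2" for a b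
  proof (cases "{a, b} \<in> B")
    case True
    then have "{{a, b}} \<subseteq> induced B {a, b}" by (auto simp: induced_def)
    from card_mono[OF finite_induced[OF B(3)] this] have "tight_set q B {a, b}"
      using ab q2 by (simp add: tight_set_def motion_dim_def)
    then show ?thesis using ab S(3) by blast
  qed (use pair ab in blast)
  have "\<exists>M. tight_set q B M \<and> M \<subseteq> V \<and> 2 \<le> card (M \<inter> S)"
  proof -
    obtain Q where Q: "Q \<subseteq> S" "card Q = 4" using ex_card[OF S(2)] by blast
    have finQ: "finite Q" using Q(1) S(1) finite_subset by blast
    show ?thesis
    proof (cases "q \<noteq> 2 \<and> pairs Q \<subseteq> B")
      case True
      have "induced B Q = pairs Q"
        using True B' mem_pairs_iff[of _ Q] by (auto simp: induced_def)
      then have "tight_set q B Q"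
        using Q(2) card_pairs[OF finQ] finQ True by (simp add: tight_set_def motion_dim_def)
      moreover have "Q \<inter> S = Q" using Q(1) by blast
      ultimately show ?thesis using Q S(3) by (intro exI[of _ Q]) auto
    next
      case False
      have "\<exists>a b. a \<in> S \<and> b \<in> S \<and> a \<noteq> b \<and> (q = 2 \<or> {a, b} \<notin> B)"
      proof (cases "q = 2")
        case True
        have "2 \<le> card Q" using Q(2) by simp
        then obtain a b where "a \<in> Q" "b \<in> Q" "a \<noteq> b" by (rule two_le_cardE)
        then show ?thesis using Q(1) True by blast
      next
        case False
        then obtain e where "e \<in> pairs Q" "e \<notin> B" using \<open>\<not> (q \<noteq> 2 \<and> pairs Q \<subseteq> B)\<close> by blast
        moreover from this obtain a b where "e = {a, b}" "a \<in> Q" "b \<in> Q" "a \<noteq> b" using pairsE by metis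
        ultimately show ?thesis using Q(1) by blast
      qed
      then obtain a b where ab: "a \<in> S" "b \<in> S" "a \<noteq> b" "q = 2 \<or> {a, b} \<notin> B" by blast
      then obtain M where M: "tight_set q B M" "M \<subseteq> V" "a \<in> M" "b \<in> M"
        using pair2[OF ab(1-3)] pair[OF ab(1-3)] by blast
      then show ?thesis using two_le_card[of "M \<inter> S" a b] ab S(1) by blast
    qed
  qed
  then obtain M0 where M0: "tight_set q B M0 \<and> M0 \<subseteq> V \<and> 2 \<le> card (M0 \<inter> S)" by blast
  let ?P = "\<lambda>M. tight_set q B M \<and> M \<subseteq> V \<and> 2 \<le> card (M \<inter> S)"
  have bound: "\<forall>M. ?P M \<longrightarrow> card (M \<inter> S) < Suc (card S)"
    using S(1) by (simp add: card_mono le_imp_less_Suc)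
  from ex_has_greatest_nat[of ?P M0 "\<lambda>M. card (M \<inter> S)", OF M0 bound]
  obtain M where M: "tight_set q B M" "M \<subseteq> V" "2 \<le> card (M \<inter> S)"
    and max: "\<And>M'. ?P M' \<Longrightarrow> card (M' \<inter> S) \<le> card (M \<inter> S)"
    by (elim exE conjE) metis
  have no_larger: False if "tight_set q B M'" "M' \<subseteq> V" "M \<subseteq> M'" "s \<in> S \<inter> M' - M" for M' s
  proof -
    have "M \<inter> S \<subset> M' \<inter> S" using that by blast
    then have "card (M \<inter> S) < card (M' \<inter> S)" using S(1) by (intro psubset_card_mono) auto
    moreover have "card (M' \<inter> S) \<le> card (M \<inter> S)" using max[of M'] that calculation M(3) by simp
    ultimately show False by simp
  qed
  have finM: "finite M" using M(1) by (simp add: tight_set_def)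
  from M(3) obtain a b where "a \<in> M \<inter> S" "b \<in> M \<inter> S" "a \<noteq> b" by (rule two_le_cardE)
  then have ab: "a \<in> M" "b \<in> M" "a \<in> S" "b \<in> S" "a \<noteq> b" by simp_all
  have "S \<subseteq> M"
  proof (rule ccontr)
    assume "\<not> S \<subseteq> M"
    then obtain s where s: "s \<in> S" "s \<notin> M" by blast
    have ne: "a \<noteq> s" "b \<noteq> s" using ab s by auto
    show False
    proof (cases "q = 2")
      case True
      obtain C where C: "tight_set q B C" "C \<subseteq> V" "a \<in> C" "s \<in> C"
        using pair2[OF ab(3) s(1) ne(1) True] by blast
      obtain D where D: "tight_set q B D" "D \<subseteq> V" "b \<in> D" "s \<in> D"
        using pair2[OF ab(4) s(1) ne(2) True] by blast
      have "tight_set q B (M \<union> D \<union> C)"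
        by (rule tight_triangle[OF B(1) B' B(3) M(1) ab(1,2) D(1,3,4) C(1,3,4) ab(5) ne(2,1)])
      then show False using no_larger[of "M \<union> D \<union> C" s] M(2) C D s by blast
    next
      case False
      have adj: "c \<in> nbrs B s" if c: "c \<in> M" "c \<in> S" for c
      proof (rule ccontr)
        assume "c \<notin> nbrs B s"
        then have "{c, s} \<notin> B" by (simp add: nbrs_def insert_commute)
        moreover have "c \<noteq> s" using c s by blast
        ultimately obtain C where C: "tight_set q B C" "C \<subseteq> V" "c \<in> C" "s \<in> C"
          using pair[of c s] c s by blast
        have "0 < card (M \<inter> C)" using finM c C(3) by (auto simp: card_gt_0_iff)
        then have "tight_set q B (M \<union> C)"
          using False by (intro tight_union[OF B(1) B' B(3) M(1) C(1)]) (simp add: motion_dim_def)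
        then show False using no_larger[of "M \<union> C" s] M(2) C s by blast
      qed
      have "tight_set q B (insert s M)"
        by (rule tight_insert(1)[OF M(1) s(2) B(3), of "{a, b}"]) (use adj ab in auto)
      then show False using no_larger[of "insert s M" s] M(2) s S(3) by blast
    qed
  qed
  then show thesis using M that by blast
qed

section \<open>Finite rigid pieces of a rigid countable framework\<close>

context generic_plane_placement
begin

text \<open>A spanned pair outside \<open>B\<close> makes the rows dependent, so by the Laman-type theorem it
  destroys sparsity.\<close>

lemma spanned_pair_tight:
  assumes B: "finite B" "B \<subseteq> pairs V" "stress_free q p B" and ab: "a \<in> V" "b \<in> V" "a \<noteq> b" "{a, b} \<notin> B"
    and span: "rigidity_matrix q p {a, b} \<in> fs.span (rigidity_matrix q p ` B)"
  shows "\<exists>M. tight_set q B M \<and> M \<subseteq> V \<and> a \<in> M \<and> b \<in> M"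
proof -
  let ?R = "rigidity_matrix q p" and ?B = "insert {a, b} B"
  have IV: "finite ?B" "?B \<subseteq> pairs V" using B ab by auto
  then have IU: "?B \<subseteq> pairs UNIV" using pairs_mono[of V UNIV] by blast
  have "\<not> stress_free q p ?B"
  proof
    assume "stress_free q p ?B"
    then have inj: "inj_on ?R ?B" and ind: "fs.independent (insert (?R {a, b}) (?R ` B))"
      using stress_free_iff_independent[OF IV(1) IU] by auto
    have "?R {a, b} \<notin> ?R ` B" using inj ab(4) by (auto simp: inj_on_def)
    then show False using ind span by (simp add: fs.independent_insert)
  qed
  moreover have "\<Union>?B \<subseteq> V" using IV(2) pairs_imp_subset by blast
  moreover have "finite e" if "e \<in> ?B" for e
    using that IV(2) by (auto simp: pairs_def)
  then have "finite (\<Union>?B)" using IV(1) by blast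
  moreover have "?B \<subseteq> pairs (\<Union>?B)"
    using IU mem_pairs_iff[of _ "\<Union>?B"] by blast
  ultimately have "\<not> sparse_edges q ?B"
    using sparse_imp_stress_free by blast
  from tight_if_not_sparse_insert[OF stress_free_imp_sparse[OF B] B(2,1) ab(1-3) this]
  show ?thesis by metis
qed

text \<open>Otherwise a functional separates the row of \<open>{a, b}\<close> from the rows of \<open>E\<close>.  It is a flex, hence
  trivial, hence it preserves the distance of \<open>a\<close> and \<open>b\<close> to first order.  The set \<open>E\<close> may be infinite.\<close>

lemma rigid_spans_pairs:
  assumes E: "E \<subseteq> pairs V" and ab: "a \<in> V" "b \<in> V" "a \<noteq> b"
    and rigid: "\<And>u. (\<And>v w. {v, w} \<in> E \<Longrightarrow> signed_power (q - 1) (p v - p w) \<bullet> (u v - u w) = 0)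
      \<Longrightarrow> trivial_on q p V u"
  shows "rigidity_matrix q p {a, b} \<in> fs.span (rigidity_matrix q p ` E)"
proof (rule ccontr)
  assume "\<not> ?thesis"
  then obtain \<phi> where \<phi>: "functional \<phi>" "\<And>y. y \<in> rigidity_matrix q p ` E \<Longrightarrow> \<phi> y = 0"
    "\<phi> (rigidity_matrix q p {a, b}) = 1"
    using separating_functional by blast
  have "trivial_on q p V (functional_velocity \<phi>)"
  proof (rule rigid)
    fix v w assume vw: "{v, w} \<in> E"
    then have "{v, w} \<in> pairs V" using E by blast
    then have "v \<noteq> w" by simp
    then show "signed_power (q - 1) (p v - p w) \<bullet> (functional_velocity \<phi> v - functional_velocity \<phi> w) = 0"
      using functional_row[OF \<phi>(1), of v w q p] \<phi>(2) vw by simp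
  qed
  from trivial_on_orthogonal[OF this ab(1,2)] show False
    using functional_row[OF \<phi>(1) ab(3), of q p] \<phi>(3) by simp
qed

lemma finite_spanning_stress_free:
  assumes E: "E \<subseteq> pairs V" and P: "finite P"
    and span: "\<And>e. e \<in> P \<Longrightarrow> rigidity_matrix q p e \<in> fs.span (rigidity_matrix q p ` E)"
  obtains B where "finite B" "B \<subseteq> E" "stress_free q p B"
    "\<forall>e\<in>P. rigidity_matrix q p e \<in> fs.span (rigidity_matrix q p ` B)"
proof -
  let ?R = "rigidity_matrix q p"
  have "\<exists>F. finite F \<and> F \<subseteq> E \<and> ?R e \<in> fs.span (?R ` F)" if e: "e \<in> P" for e
  proof -
    obtain T c where T: "finite T" "T \<subseteq> ?R ` E" "?R e = (\<Sum>a\<in>T. fscale (c a) a)"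
      using span[OF e] unfolding fs.span_explicit by blast
    obtain F where F: "F \<subseteq> E" "finite F" "T = ?R ` F"
      using finite_subset_image[OF T(1,2)] by blast
    have "?R e \<in> fs.span (?R ` F)"
      unfolding T(3) F(3) by (intro fs.span_sum fs.span_scale fs.span_base)
    then show ?thesis using F by blast
  qed
  then obtain F where F: "\<And>e. e \<in> P \<Longrightarrow> finite (F e) \<and> F e \<subseteq> E \<and> ?R e \<in> fs.span (?R ` F e)"
    by metis
  let ?F = "\<Union>e\<in>P. F e"
  obtain T where T: "T \<subseteq> ?R ` ?F" "fs.independent T" "?R ` ?F \<subseteq> fs.span T"
    using fs.maximal_independent_subset by blast
  obtain B where B: "B \<subseteq> ?F" "inj_on ?R B" "T = ?R ` B"
    using T(1) subset_image_inj[of T ?R ?F] by auto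
  have "finite ?F" "?F \<subseteq> E" using F P by auto
  then have fin: "finite B" and BE: "B \<subseteq> E" using B(1) finite_subset by auto
  show thesis
  proof
    have "B \<subseteq> pairs UNIV" using BE E pairs_mono[of V UNIV] by blast
    then show "stress_free q p B" using stress_free_iff_independent[OF fin] B T(2) by blast
    show "\<forall>e\<in>P. ?R e \<in> fs.span (?R ` B)"
    proof
      fix e assume e: "e \<in> P"
      then have "?R ` F e \<subseteq> fs.span (?R ` B)" using T(3) B(3) by blast
      from fs.span_minimal[OF this fs.subspace_span] show "?R e \<in> fs.span (?R ` B)"
        using F[OF e] by blast
    qed
  qed (use fin BE in auto)
qed

text \<open>The edges of \<open>B\<close> inside the tight set \<open>M\<close> are edges of \<open>E\<close>, and they already leave only
  trivial flexes.  The set \<open>S\<close> is enlarged to at least four elements: for \<open>q \<noteq> 2\<close>, two or three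
  mutually adjacent vertices need not lie in a common tight set.\<close>

theorem rigid_finite_exhaustion:
  assumes V: "infinite V" and E: "E \<subseteq> pairs V" and S: "finite S" "S \<subseteq> V"
    and rigid: "\<And>u. (\<And>v w. {v, w} \<in> E \<Longrightarrow> signed_power (q - 1) (p v - p w) \<bullet> (u v - u w) = 0)
      \<Longrightarrow> trivial_on q p V u"
  obtains M where "finite M" "M \<subseteq> V" "S \<subseteq> M"
    "\<And>u. (\<And>v w. {v, w} \<in> induced E M \<Longrightarrow> signed_power (q - 1) (p v - p w) \<bullet> (u v - u w) = 0)
      \<Longrightarrow> trivial_on q p M u"
proof -
  obtain Q where Q: "finite Q" "card Q = 4" "Q \<subseteq> V"
    using infinite_arbitrarily_large[OF V] by blast
  let ?S = "S \<union> Q"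
  have S': "finite ?S" "4 \<le> card ?S" "?S \<subseteq> V"
    using S Q card_mono[of ?S Q] by auto
  have spanE: "rigidity_matrix q p e \<in> fs.span (rigidity_matrix q p ` E)" if "e \<in> pairs ?S" for e
  proof -
    obtain a b where e: "e = {a, b}" "a \<in> ?S" "b \<in> ?S" "a \<noteq> b" using \<open>e \<in> pairs ?S\<close> by (rule pairsE)
    then have "a \<in> V" "b \<in> V" using S'(3) by auto
    then show ?thesis
      unfolding e(1) by (rule rigid_spans_pairs[OF E _ _ e(4) rigid])
  qed
  obtain B where B: "finite B" "B \<subseteq> E" "stress_free q p B"
    and span: "\<forall>e\<in>pairs ?S. rigidity_matrix q p e \<in> fs.span (rigidity_matrix q p ` B)"
    by (rule finite_spanning_stress_free[OF E finite_pairs[OF S'(1)] spanE])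
  have BV: "B \<subseteq> pairs V" using B(2) E by blast
  have pair: "\<exists>M. tight_set q B M \<and> M \<subseteq> V \<and> a \<in> M \<and> b \<in> M"
    if "a \<in> ?S" "b \<in> ?S" "a \<noteq> b" "{a, b} \<notin> B" for a b
    using that S'(3) by (intro spanned_pair_tight[OF B(1) BV B(3)] bspec[OF span]) auto
  obtain M where M: "tight_set q B M" "M \<subseteq> V" "?S \<subseteq> M"
    by (rule tight_cover[OF stress_free_imp_sparse[OF B(1) BV B(3)] BV B(1) S' pair])
  have finM: "finite M" "2 \<le> card M" using M(1) by (auto simp: tight_set_def)
  have BU: "B \<subseteq> pairs UNIV" using BV pairs_mono[of V UNIV] by blast
  show thesis
  proof (rule that[OF finM(1) M(2)])
    show "S \<subseteq> M" using M(3) by blast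
    fix u assume u: "\<And>v w. {v, w} \<in> induced E M \<Longrightarrow> signed_power (q - 1) (p v - p w) \<bullet> (u v - u w) = 0"
    show "trivial_on q p M u"
    proof (rule tight_stress_free_rigid[OF _ _ finM])
      show "general_position p M" using general_position M(2) by (auto simp: general_position_def)
      show "inj_on p M" using inj M(2) by (rule inj_on_subset)
      show "induced B M \<subseteq> pairs M" using BU mem_pairs_iff[of _ M] by (auto simp: induced_def)
      show "stress_free q p (induced B M)"
        by (rule stress_free_mono[OF B(3) _ B(1) BU]) (auto simp: induced_def)
      show "2 * card M \<le> card (induced B M) + motion_dim q" using M(1) by (simp add: tight_set_def)
      show "signed_power (q - 1) (p v - p w) \<bullet> (u v - u w) = 0" if "{v, w} \<in> induced B M" for v w
        using that B(2) by (intro u) (auto simp: induced_def)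
    qed
  qed
qed

end

section \<open>Rigidity and sequential rigidity\<close>

lemma generic_plane_placementI:
  assumes "1 < q" "generic_placement q G (p :: 'v \<Rightarrow> real ^ 2)"
  shows "generic_plane_placement q p (verts G)"
  using assms generic_placement_inj[OF assms(2)] generic_placement_stress_free[OF assms(2)]
  by unfold_locales blast+

lemma simple_graph_edges: "simple_graph G \<Longrightarrow> edges G \<subseteq> pairs (verts G)"
  unfolding simple_graph_def pairs_def by blast

lemma trivial_flex_iff:
  fixes p u :: "'v \<Rightarrow> real ^ 2"
  assumes "1 < q"
  shows "trivial_flex q G p u \<longleftrightarrow> trivial_on q p (verts G) u"
  unfolding trivial_flex_def trivial_on_def infinitesimal_rigid_motion_iff[OF assms] by auto

lemma infinitesimally_rigid_iff:
  fixes p :: "'v \<Rightarrow> real ^ 2"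
  assumes "1 < q" "placement G p"
  shows "infinitesimally_rigid q G p \<longleftrightarrow>
    (\<forall>u. (\<forall>v w. {v, w} \<in> edges G \<longrightarrow> signed_power (q - 1) (p v - p w) \<bullet> (u v - u w) = 0)
      \<longrightarrow> trivial_on q p (verts G) u)"
  by (simp only: infinitesimally_rigid_def infinitesimal_flex_iff[OF assms] trivial_flex_iff[OF assms(1)])

text \<open>A rigid motion of the form \<open>x \<mapsto> t + c *\<^sub>R rot x\<close> is determined by its values at the two
  distinct points \<open>p a\<close> and \<open>p b\<close>, so all members of the chain that contain \<open>a\<close> and \<open>b\<close> use the same one.\<close>

lemma trivial_on_chain:
  assumes inj: "inj_on p (\<Union>k. M k)" and mono: "\<And>k :: nat. M k \<subseteq> M (Suc k)"
    and triv: "\<And>k. trivial_on q p (M k) u" and ab: "a \<in> (\<Union>k. M k)" "b \<in> (\<Union>k. M k)" "a \<noteq> b"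
  shows "trivial_on q p (\<Union>k. M k) u"
proof -
  have le: "M k \<subseteq> M l" if "k \<le> l" for k l using that using lift_Suc_mono_le[of M k l] mono by blast
  obtain i j where "a \<in> M i" "b \<in> M j" using ab by blast
  then have K: "a \<in> M (max i j)" "b \<in> M (max i j)" using le[of i "max i j"] le[of j "max i j"] by auto
  obtain t c where c: "q \<noteq> 2 \<longrightarrow> c = 0" and tc: "\<forall>v\<in>M (max i j). u v = t + c *\<^sub>R rot (p v)"
    using triv[of "max i j"] by (auto simp: trivial_on_def)
  have "u v = t + c *\<^sub>R rot (p v)" if "v \<in> M k" for v k
  proof -
    let ?n = "max k (max i j)"
    obtain t' c' where tc': "\<forall>v\<in>M ?n. u v = t' + c' *\<^sub>R rot (p v)"
      using triv[of ?n] by (auto simp: trivial_on_def)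
    have abn: "a \<in> M ?n" "b \<in> M ?n" "v \<in> M ?n"
      using K that le[of "max i j" ?n] le[of k ?n] by auto
    have ea: "t' + c' *\<^sub>R rot (p a) = t + c *\<^sub>R rot (p a)" and eb: "t' + c' *\<^sub>R rot (p b) = t + c *\<^sub>R rot (p b)"
      using tc tc' K abn by (metis, metis)
    have "(c' - c) *\<^sub>R rot (p a - p b) = (t' + c' *\<^sub>R rot (p a) - (t + c *\<^sub>R rot (p a))) -
        (t' + c' *\<^sub>R rot (p b) - (t + c *\<^sub>R rot (p b)))"
      by (simp add: rot_diff algebra_simps)
    then have "(c' - c) *\<^sub>R rot (p a - p b) = 0" using ea eb by simp
    moreover have "p a \<noteq> p b" using inj ab by (auto dest: inj_onD)
    ultimately have "c' = c" by simp
    then have "t' = t" using ea by simp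
    then show ?thesis using tc' abn \<open>c' = c\<close> by simp
  qed
  then show ?thesis using c by (auto simp: trivial_on_def)
qed

text \<open>For the chain, the vertices are enumerated as \<open>v 0, v 1, \<dots>\<close>, and a finite rigid piece
  that contains \<open>v k\<close> and the previous piece is chosen at each stage.  Taking the edges induced by \<open>G\<close>
  makes the pieces increasing as subgraphs.\<close>

theorem infinitesimally_rigid_iff_sequentially:
  fixes G :: "'v ugraph" and p :: "'v \<Rightarrow> real ^ 2"
  assumes G: "simple_graph G" "countable (verts G)" "infinite (verts G)" and q: "1 < q"
    and gen: "generic_placement q G p"
  shows "infinitesimally_rigid q G p \<longleftrightarrow> sequentially_infinitesimally_rigid q G p"
proof -
  let ?V = "verts G" and ?E = "edges G"
  interpret generic_plane_placement q p ?V using generic_plane_placementI[OF q gen] .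
  have plG: "placement G p" using gen by (simp add: generic_placement_def)
  have E: "?E \<subseteq> pairs ?V" using G(1) by (rule simple_graph_edges)
  show ?thesis
  proof
    assume rigid: "infinitesimally_rigid q G p"
    let ?orth = "\<lambda>F u. \<forall>v w. {v, w} \<in> F \<longrightarrow> signed_power (q - 1) (p v - p w) \<bullet> (u v - u w) = 0"
    have rigid': "trivial_on q p ?V u"
      if "\<And>v w. {v, w} \<in> ?E \<Longrightarrow> signed_power (q - 1) (p v - p w) \<bullet> (u v - u w) = 0" for u
      using rigid that unfolding infinitesimally_rigid_iff[OF q plG] by blast
    have "\<exists>M. finite M \<and> M \<subseteq> ?V \<and> S \<subseteq> M \<and> (\<forall>u. ?orth (induced ?E M) u \<longrightarrow> trivial_on q p M u)"
      if "finite S" "S \<subseteq> ?V" for S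
      using rigid_finite_exhaustion[OF G(3) E that rigid'] by metis
    then obtain g where g: "\<And>S. finite S \<Longrightarrow> S \<subseteq> ?V \<Longrightarrow>
        finite (g S) \<and> g S \<subseteq> ?V \<and> S \<subseteq> g S \<and> (\<forall>u. ?orth (induced ?E (g S)) u \<longrightarrow> trivial_on q p (g S) u)"
      by metis
    define v where "v = from_nat_into ?V"
    have ran: "range v = ?V"
      unfolding v_def using G(2,3) by (intro range_from_nat_into) auto
    define M where "M = rec_nat (g {}) (\<lambda>k N. g (insert (v k) N))"
    have M0: "M 0 = g {}" and MS: "M (Suc k) = g (insert (v k) (M k))" for k
      by (simp_all add: M_def)
    have vV: "v k \<in> ?V" for k using ran by blast
    have M: "finite (M k) \<and> M k \<subseteq> ?V \<and> (\<forall>u. ?orth (induced ?E (M k)) u \<longrightarrow> trivial_on q p (M k) u)" for k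
    proof (induction k)
      case 0
      show ?case using g[of "{}"] by (simp add: M0)
    next
      case (Suc k)
      then show ?case using g[of "insert (v k) (M k)"] vV[of k] by (simp add: MS)
    qed
    have step: "insert (v k) (M k) \<subseteq> M (Suc k)" for k
      using g[of "insert (v k) (M k)"] M[of k] vV[of k] by (simp add: MS)
    define H where "H k = (M k, induced ?E (M k))" for k
    have HG: "subgraph (H k) G" and simp_H: "simple_graph (H k)" for k
    proof -
      show "simple_graph (H k)"
        unfolding simple_graph_def
      proof
        fix e assume "e \<in> edges (H k)"
        then have e: "e \<in> ?E" "e \<subseteq> M k" by (auto simp: H_def induced_def)
        then have "e \<in> pairs ?V" using E by blast
        then obtain a b where "e = {a, b}" "a \<noteq> b" by (rule pairsE)
        then show "\<exists>a\<in>verts (H k). \<exists>b\<in>verts (H k). a \<noteq> b \<and> e = {a, b}"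
          using e(2) by (auto simp: H_def)
      qed
      then show "subgraph (H k) G"
        using M[of k] by (auto simp: subgraph_def H_def induced_def)
    qed
    show "sequentially_infinitesimally_rigid q G p"
      unfolding sequentially_infinitesimally_rigid_def
    proof (intro exI[of _ H] conjI allI)
      fix k
      show "finite_subgraph (H k) G" using HG[of k] M[of k] by (simp add: finite_subgraph_def H_def)
      have "M k \<subseteq> M (Suc k)" using step[of k] by simp
      then show "subgraph (H k) (H (Suc k))"
        using simp_H[of k] by (auto simp: subgraph_def H_def induced_def)
      have "placement (H k) p" using plG by (auto simp: placement_def H_def induced_def)
      then show "infinitesimally_rigid q (H k) p"
        using M[of k] by (simp add: infinitesimally_rigid_iff[OF q] H_def)
    next
      have "v k \<in> (\<Union>k. M k)" for k using step[of k] by blast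
      then have "?V \<subseteq> (\<Union>k. M k)" unfolding ran[symmetric] by blast
      moreover have "(\<Union>k. M k) \<subseteq> ?V" using M by blast
      ultimately show "?V = (\<Union>k. verts (H k))" by (auto simp: H_def)
    qed
  next
    assume "sequentially_infinitesimally_rigid q G p"
    then obtain H where H: "\<And>k. finite_subgraph (H k) G" "\<And>k. subgraph (H k) (H (Suc k))"
      "?V = (\<Union>k. verts (H k))" "\<And>k. infinitesimally_rigid q (H k) p"
      unfolding sequentially_infinitesimally_rigid_def by blast
    obtain a b where ab: "a \<in> ?V" "b \<in> ?V" "a \<noteq> b"
      using G(3) by (metis finite.emptyI finite_insert finite_subset insert_iff subsetI)
    show "infinitesimally_rigid q G p"
      unfolding infinitesimally_rigid_iff[OF q plG]
    proof (intro allI impI)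
      fix u assume u: "\<forall>v w. {v, w} \<in> ?E \<longrightarrow> signed_power (q - 1) (p v - p w) \<bullet> (u v - u w) = 0"
      have "trivial_on q p (verts (H k)) u" for k
      proof -
        have sub: "edges (H k) \<subseteq> ?E" using H(1)[of k] by (simp add: finite_subgraph_def subgraph_def)
        then have "placement (H k) p" using plG by (auto simp: placement_def)
        then show ?thesis using H(4)[of k] u sub by (auto simp: infinitesimally_rigid_iff[OF q])
      qed
      moreover have "verts (H k) \<subseteq> verts (H (Suc k))" for k
        using H(2)[of k] by (simp add: subgraph_def)
      ultimately show "trivial_on q p ?V u"
        using inj ab unfolding H(3) by (intro trivial_on_chain[of p "\<lambda>k. verts (H k)"])
    qed
  qed
qed

theorem theorem3p18:
  fixes G :: "'v ugraph" and q :: real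
  assumes "simple_graph G"
    and "countable (verts G)" and "infinite (verts G)"
    and "1 < q"
  shows "rigid_graph TYPE(2) q G \<longleftrightarrow> sequentially_rigid_graph TYPE(2) q G"
  using infinitesimally_rigid_iff_sequentially[OF assms]
  unfolding rigid_graph_def sequentially_rigid_graph_def by blast

end
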